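(* Let $k\ge1$ be an integer, $T>0$, and let $f^0$ be a periodic, non-negative, not identically zero function in $L^1\cap H^k(\mathcal{D}_L)$ such that $\|(\mathcal{P}_Nf^0)^-\|_{L^2(\mathcal{D}_L)}\to0$ as $N\to\infty$ (this holds e.g. when $\mathcal{P}_Nf^0\to f^0$ uniformly). Let $f:[0,\infty)\times\mathcal{D}_L\to[0,\infty)$ be a non-negative periodic solution of $\partial_t f=Q^R(f,f)$, $f(0)=f^0$, with $f\in C([0,T];L^2(\mathcal{D}_L))$ and $\sup_{t\ge0}\|f(t)\|_{H^k(\mathcal{D}_L)}\le C_k<\infty$. Let $f_N^0=\mathcal{P}_Nf^0$ and let $f_N$ be the solution of $\partial_t f_N=\mathcal{P}_NQ^R(f_N,f_N)$, $f_N(0)=f_N^0$. Then there exist an integer $N_0$ and a constant $C$, depending only on $T$, $f^0$ (and $R,L,d,\Phi,b$, $C_k$), such that for all $N>N_0$ the solution $f_N$ exists on $[0,T]$ and the error $e_N=\mathcal{P}_Nf-f_N$ satisfies $$\|e_N(t)\|_{L^2(\mathcal{D}_L)}\le\frac{C}{N^k}\qquad\text{for all }t\in[0,T].$$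
   Context: Fix $d\ge 2$ and truncation parameters $L\ge R>0$. Let $\mathcal{D}_L=[-L,L]^d$; all functions of $v$ are $2L$-periodic in each coordinate, and norms are taken over one period, with $\|f\|_{H^k(\mathcal{D}_L)}^2=\sum_{|\nu|\le k}\|\partial_v^\nu f\|_{L^2(\mathcal{D}_L)}^2$. For real $f$, $f^-=\max\{-f,0\}$. The collision kernel is $B=\Phi(|q|)\,b(\sigma\cdot\hat q)$ where $\Phi:[0,\infty)\to[0,\infty)$ satisfies $\sup_{|v|\le R}\Phi(|v|)<\infty$, and $b\ge 0$ satisfies $b(s)=0$ for $s<0$ and $\int_{\mathbb{S}^{d-1}}b(\sigma\cdot e)\,\mathrm{d}\sigma<\infty$. For periodic $g,f$, the truncated collision operator is $$Q^R(g,f)(v)=\int_{\mathbb{R}^d}\int_{\mathbb{S}^{d-1}}\mathbf{1}_{|q|\le R}\Phi(|q|)b(\sigma\cdot\hat q)\big[g(v_*')f(v')-g(v-q)f(v)\big]\,\mathrm{d}\sigma\,\mathrm{d}q,$$ with $\hat q=q/|q|$, $v'=v-\frac{q-|q|\sigma}{2}$, $v_*'=v-\frac{q+|q|\sigma}{2}$. $\mathbb{P}_N=\mathrm{span}\{e^{\mathrm{i}\frac{\pi}{L}k\cdot v}: k\in\mathbb{Z}^d,\ -N/2\le k_j\le N/2\}$ and $\mathcal{P}_N g=\sum_k\hat g_ke^{\mathrm{i}\frac{\pi}{L}k\cdot v}$ (same range of $k$), $\hat g_k=(2L)^{-d}\int_{\mathcal{D}_L}g\,e^{-\mathrm{i}\frac{\pi}{L}k\cdot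 v}\,\mathrm{d}v$, the $L^2(\mathcal{D}_L)$-orthogonal projection onto $\mathbb{P}_N$. *)

theory Defs
  imports "HOL-Analysis.Analysis"
begin

definition dom_L :: "real \<Rightarrow> (real^'n) set" where
  "dom_L L = cbox (\<chi> j. - L) (\<chi> j. L)"

definition periodic_L :: "real \<Rightarrow> (real^'n \<Rightarrow> real) \<Rightarrow> bool" where
  "periodic_L L g \<longleftrightarrow> (\<forall>v j. g (v + (2 * L) *\<^sub>R axis j 1) = g v)"

definition in_L2 :: "real \<Rightarrow> (real^'n \<Rightarrow> real) \<Rightarrow> bool" where
  "in_L2 L g \<longleftrightarrow> set_borel_measurable lborel (dom_L L) g
      \<and> set_integrable lborel (dom_L L) (\<lambda>v. (g v)\<^sup>2)"

definition L2norm :: "real \<Rightarrow> (real^'n \<Rightarrow> real) \<Rightarrow> real" where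
  "L2norm L g = sqrt (LINT v:dom_L L|lborel. (g v)\<^sup>2)"

fun pd :: "'n list \<Rightarrow> (real^'n \<Rightarrow> real) \<Rightarrow> real^'n \<Rightarrow> real" where
  "pd [] \<phi> = \<phi>"
| "pd (j # js) \<phi> = (\<lambda>v. deriv (\<lambda>s. pd js \<phi> (v + s *\<^sub>R axis j 1)) 0)"

definition test_fn :: "real \<Rightarrow> (real^'n \<Rightarrow> real) \<Rightarrow> bool" where
  "test_fn L \<phi> \<longleftrightarrow> periodic_L L \<phi> \<and>
     (\<forall>js. continuous_on UNIV (pd js \<phi>) \<and>
           (\<forall>j v. (\<lambda>s. pd js \<phi> (v + s *\<^sub>R axis j 1)) differentiable (at 0)))"

definition weak_deriv :: "real \<Rightarrow> 'n list \<Rightarrow> (real^'n \<Rightarrow> real) \<Rightarrow> (real^'n \<Rightarrow> real) \<Rightarrow> bool" where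
  "weak_deriv L js g h \<longleftrightarrow> set_integrable lborel (dom_L L) g \<and> in_L2 L h \<and>
     (\<forall>\<phi>. test_fn L \<phi> \<longrightarrow>
        (LINT v:dom_L L|lborel. g v * pd js \<phi> v)
          = (-1) ^ length js * (LINT v:dom_L L|lborel. h v * \<phi> v))"

definition multi_idx :: "nat \<Rightarrow> ('n::finite \<Rightarrow> nat) set" where
  "multi_idx k = {\<nu>. sum \<nu> UNIV \<le> k}"

definition mi_list :: "('n \<Rightarrow> nat) \<Rightarrow> 'n list" where
  "mi_list \<nu> = (SOME js. \<forall>j. count_list js j = \<nu> j)"

definition Hk_le :: "real \<Rightarrow> nat \<Rightarrow> (real^'n::finite \<Rightarrow> real) \<Rightarrow> real \<Rightarrow> bool" where
  "Hk_le L k g C \<longleftrightarrow> (\<exists>G. (\<forall>\<nu>\<in>multi_idx k. weak_deriv L (mi_list \<nu>) g (G \<nu>)) \<and>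
       sqrt (\<Sum>\<nu>\<in>multi_idx k. (L2norm L (G \<nu>))\<^sup>2) \<le> C)"

definition in_Hk :: "real \<Rightarrow> nat \<Rightarrow> (real^'n::finite \<Rightarrow> real) \<Rightarrow> bool" where
  "in_Hk L k g \<longleftrightarrow> (\<exists>C. Hk_le L k g C)"

text \<open>Integral over the unit sphere S^{d-1} w.r.t. surface measure, via
  int_{S^{d-1}} h d sigma = d * int_{B(0,1)} h(x/|x|) dx.\<close>
definition sphere_int :: "(real^'n::finite \<Rightarrow> real) \<Rightarrow> real" where
  "sphere_int h = real CARD('n) * (LINT x:ball 0 1|lborel. h (x /\<^sub>R norm x))"

definition sphere_integrable :: "(real^'n::finite \<Rightarrow> real) \<Rightarrow> bool" where
  "sphere_integrable h \<longleftrightarrow> set_integrable lborel (ball 0 1) (\<lambda>x. h (x /\<^sub>R norm x))"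

definition QR :: "real \<Rightarrow> (real \<Rightarrow> real) \<Rightarrow> (real \<Rightarrow> real)
     \<Rightarrow> (real^'n::finite \<Rightarrow> real) \<Rightarrow> (real^'n \<Rightarrow> real) \<Rightarrow> real^'n \<Rightarrow> real" where
  "QR R \<Phi> b g f v =
     (LINT q:cball 0 R|lborel. \<Phi> (norm q) *
        sphere_int (\<lambda>\<sigma>. b (\<sigma> \<bullet> (q /\<^sub>R norm q)) *
          (g (v - (1/2) *\<^sub>R (q + norm q *\<^sub>R \<sigma>)) * f (v - (1/2) *\<^sub>R (q - norm q *\<^sub>R \<sigma>))
           - g (v - q) * f v)))"

definition kdot :: "int^'n \<Rightarrow> real^'n \<Rightarrow> real" where
  "kdot k v = (\<Sum>j\<in>UNIV. real_of_int (k $ j) * v $ j)"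

definition modes :: "nat \<Rightarrow> (int^'n::finite) set" where
  "modes N = {k. \<forall>j. - (real N / 2) \<le> real_of_int (k $ j) \<and> real_of_int (k $ j) \<le> real N / 2}"

definition fcoef :: "real \<Rightarrow> (real^'n::finite \<Rightarrow> real) \<Rightarrow> int^'n \<Rightarrow> complex" where
  "fcoef L g k = complex_of_real (1 / (2 * L) ^ CARD('n)) *
     (LINT v:dom_L L|lborel. complex_of_real (g v) *
        exp (- (\<i> * complex_of_real (pi / L * kdot k v))))"

text \<open>For real g, sum_{k in modes N} hat g_k e_k is real; P_N g is that (real) function.\<close>
definition proj :: "real \<Rightarrow> nat \<Rightarrow> (real^'n::finite \<Rightarrow> real) \<Rightarrow> real^'n \<Rightarrow> real" where
  "proj L N g v = Re (\<Sum>k\<in>modes N. fcoef L g k * exp (\<i> * complex_of_real (pi / L * kdot k v)))"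

definition in_PN :: "real \<Rightarrow> nat \<Rightarrow> (real^'n::finite \<Rightarrow> real) \<Rightarrow> bool" where
  "in_PN L N g \<longleftrightarrow> (\<exists>c. \<forall>v. complex_of_real (g v) =
      (\<Sum>k\<in>modes N. c k * exp (\<i> * complex_of_real (pi / L * kdot k v))))"

definition L2_deriv :: "real \<Rightarrow> (real \<Rightarrow> real^'n \<Rightarrow> real) \<Rightarrow> (real^'n \<Rightarrow> real) \<Rightarrow> real \<Rightarrow> real set \<Rightarrow> bool" where
  "L2_deriv L u u' t S \<longleftrightarrow>
     ((\<lambda>h. L2norm L (\<lambda>v. (u (t + h) v - u t v) / h - u' v)) \<longlongrightarrow> 0)
        (at 0 within {h. t + h \<in> S})"

definition boltz_sol :: "real \<Rightarrow> real \<Rightarrow> (real \<Rightarrow> real) \<Rightarrow> (real \<Rightarrow> real) \<Rightarrow> real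
     \<Rightarrow> (real^'n::finite \<Rightarrow> real) \<Rightarrow> (real \<Rightarrow> real^'n \<Rightarrow> real) \<Rightarrow> bool" where
  "boltz_sol L R \<Phi> b T f0 f \<longleftrightarrow>
     f 0 = f0 \<and>
     (\<forall>t\<ge>0. periodic_L L (f t) \<and> (\<forall>v. f t v \<ge> 0) \<and> in_L2 L (f t)
        \<and> in_L2 L (QR R \<Phi> b (f t) (f t))
        \<and> L2_deriv L f (QR R \<Phi> b (f t) (f t)) t {0..}) \<and>
     (\<forall>t\<in>{0..T}. ((\<lambda>s. L2norm L (\<lambda>v. f s v - f t v)) \<longlongrightarrow> 0) (at t within {0..T}))"

definition spectral_sol :: "real \<Rightarrow> real \<Rightarrow> (real \<Rightarrow> real) \<Rightarrow> (real \<Rightarrow> real) \<Rightarrow> nat \<Rightarrow> real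
     \<Rightarrow> (real^'n::finite \<Rightarrow> real) \<Rightarrow> (real \<Rightarrow> real^'n \<Rightarrow> real) \<Rightarrow> bool" where
  "spectral_sol L R \<Phi> b N T f0 fN \<longleftrightarrow>
     fN 0 = proj L N f0 \<and>
     (\<forall>t\<in>{0..T}. in_PN L N (fN t) \<and>
        L2_deriv L fN (proj L N (QR R \<Phi> b (fN t) (fN t))) t {0..T})"

end

theory Submission
  imports Defs
begin

text \<open>
  Two estimates carry the proof. The exchange of the directions of \<open>q\<close> and
  \<open>\<sigma>\<close> preserves the kernel, so Cauchy-Schwarz gives
  \<open>\<parallel>Q(f,f) - Q(h,h)\<parallel> \<le> c (\<parallel>f\<parallel> + \<parallel>h\<parallel>) \<parallel>f - h\<parallel>\<close> in \<open>L\<^sup>2\<close> of one period.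
  The projection error of \<open>f(t)\<close> is \<open>O(N\<^sup>-\<^sup>k)\<close> uniformly in time, because \<open>P\<^sub>N\<close> is an orthogonal projection,
  trigonometric polynomials are dense in \<open>L\<^sup>2\<close>, and a weak derivative multiplies Fourier coefficients by frequencies.

  Replace the argument of \<open>Q\<close> in the Galerkin system by its radial truncation at norm \<open>K = C\<^sub>k + 1\<close>. The resulting
  system is globally Lipschitz, hence solvable on \<open>[0,T]\<close>, and Gronwall's inequality applied to the difference between
  \<open>P\<^sub>N f\<close> and its solution yields a bound \<open>C N\<^sup>-\<^sup>k\<close>. For large \<open>N\<close> this is at most 1, so the truncation is never
  active and the solution solves the original system; a second use of Gronwall's inequality shows that it is the only one.
\<close>

section \<open>Square integrable functions\<close>

text \<open>\<open>Q\<close> is quadratic and so only locally Lipschitz, and the projection destroys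
  positivity, so no a priori bound on the Galerkin solution is at hand. The bound is borrowed from
  \<open>f\<close>: the truncation level exceeds the bound on \<open>P_N f\<close> by 1, which is
  exactly the room left for the error. The estimate on \<open>Q\<close> rests on
  \<open>R \<le> L\<close>: the shift between the two arguments of a product lies in a ball of
  radius R, which fits into one period, so integrating a square over that ball costs at most the
  squared norm. Functions are not identified modulo null sets; the norm is a seminorm, and
  statements about individual values of Q hold almost everywhere. The finite-dimensional Galerkin
  equation is solved in the Banach space of bounded continuous functions, because the space of
  trigonometric polynomials of degree N is not a type. Its Lipschitz constant there depends on N;
  this is harmless, since that constant serves existence only and does not enter the error
  bound.\<close>

definition sq_int :: "'a measure \<Rightarrow> ('a \<Rightarrow> real) \<Rightarrow> bool" where
  "sq_int M g \<longleftrightarrow> g \<in> borel_measurable M \<and> integrable M (\<lambda>x. (g x)\<^sup>2)"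

text \<open>Only a seminorm, and 0 by convention for a measurable function whose square is not
  integrable. Hence the triangle inequalities below carry \<open>sq_int\<close> hypotheses, while
  scaling does not.\<close>

definition norm2 :: "'a measure \<Rightarrow> ('a \<Rightarrow> real) \<Rightarrow> real" where
  "norm2 M g = sqrt (\<integral>x. (g x)\<^sup>2 \<partial>M)"

lemma norm2_nonneg [simp]: "0 \<le> norm2 M g"
  by (simp add: norm2_def)

lemma norm2_sq: "(norm2 M g)\<^sup>2 = (\<integral>x. (g x)\<^sup>2 \<partial>M)"
  by (simp add: norm2_def)

lemma norm2_zero [simp]: "norm2 M (\<lambda>x. 0) = 0"
  by (simp add: norm2_def)

lemma sq_int_measurable: "sq_int M g \<Longrightarrow> g \<in> borel_measurable M"
  by (simp add: sq_int_def)

lemma sq_int_mult: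
  assumes "sq_int M f" "sq_int M g"
  shows "integrable M (\<lambda>x. f x * g x)"
proof (rule Bochner_Integration.integrable_bound)
  show "integrable M (\<lambda>x. (f x)\<^sup>2 + (g x)\<^sup>2)"
    using assms by (auto simp: sq_int_def)
  show "(\<lambda>x. f x * g x) \<in> borel_measurable M"
    using assms by (auto simp: sq_int_def)
  have "\<bar>a * b\<bar> \<le> a\<^sup>2 + b\<^sup>2" for a b :: real
  proof -
    have "2 * (\<bar>a\<bar> * \<bar>b\<bar>) \<le> a\<^sup>2 + b\<^sup>2"
      using sum_squares_bound[of "\<bar>a\<bar>" "\<bar>b\<bar>"] by (simp add: mult.assoc)
    moreover have "0 \<le> \<bar>a\<bar> * \<bar>b\<bar>" by simp
    ultimately show ?thesis unfolding abs_mult by linarith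
  qed
  then show "AE x in M. norm (f x * g x) \<le> norm ((f x)\<^sup>2 + (g x)\<^sup>2)"
    by (intro AE_I2) simp
qed

lemma sq_int_cmult: "sq_int M f \<Longrightarrow> sq_int M (\<lambda>x. c * f x)"
  by (auto simp: sq_int_def power_mult_distrib)

lemma sq_int_divide: "sq_int M f \<Longrightarrow> sq_int M (\<lambda>x. f x / c)"
  by (auto simp: sq_int_def power_divide)

lemma sq_int_zero [simp]: "sq_int M (\<lambda>x. 0)"
  by (auto simp: sq_int_def)

lemma sq_int_add:
  assumes "sq_int M f" "sq_int M g"
  shows "sq_int M (\<lambda>x. f x + g x)"
  using assms sq_int_mult[OF assms]
  by (auto simp: sq_int_def power2_sum intro!: Bochner_Integration.integrable_add integrable_mult_right)
     (simp add: mult.assoc)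

lemma sq_int_diff:
  assumes "sq_int M f" "sq_int M g"
  shows "sq_int M (\<lambda>x. f x - g x)"
  using sq_int_add[OF assms(1) sq_int_cmult[OF assms(2), of "-1"]] by simp

lemma sq_int_abs: "sq_int M f \<Longrightarrow> sq_int M (\<lambda>x. \<bar>f x\<bar>)"
  by (auto simp: sq_int_def)

lemma sq_int_sum: "(\<And>i. i \<in> I \<Longrightarrow> sq_int M (f i)) \<Longrightarrow> sq_int M (\<lambda>x. \<Sum>i\<in>I. f i x)"
  by (induction I rule: infinite_finite_induct) (simp_all add: sq_int_add)

lemma norm2_cmult: "norm2 M (\<lambda>x. c * f x) = \<bar>c\<bar> * norm2 M f"
  by (simp add: norm2_def power_mult_distrib real_sqrt_mult)

lemma norm2_minus: "norm2 M (\<lambda>x. - f x) = norm2 M f"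
  by (simp add: norm2_def)

lemma norm2_divide: "norm2 M (\<lambda>x. f x / c) = norm2 M f / \<bar>c\<bar>"
  using norm2_cmult[of M "1 / c" f] by simp

lemma norm2_commute: "norm2 M (\<lambda>x. f x - g x) = norm2 M (\<lambda>x. g x - f x)"
  unfolding norm2_def by (subst power2_commute) (rule refl)

lemma sq_int_cong_AE:
  assumes "sq_int M f" "g \<in> borel_measurable M" "AE x in M. f x = g x"
  shows "sq_int M g" "norm2 M g = norm2 M f"
proof -
  have [measurable]: "f \<in> borel_measurable M" "g \<in> borel_measurable M"
    using assms by (auto simp: sq_int_def)
  have "integrable M (\<lambda>x. (f x)\<^sup>2) \<longleftrightarrow> integrable M (\<lambda>x. (g x)\<^sup>2)"
    using assms(3) by (intro integrable_cong_AE) auto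
  then show "sq_int M g" using assms by (auto simp: sq_int_def)
  show "norm2 M g = norm2 M f"
    unfolding norm2_def using assms(3) by (intro arg_cong[of _ _ sqrt] integral_cong_AE) auto
qed

lemma norm2_add_sq:
  assumes "sq_int M f" "sq_int M g"
  shows "(norm2 M (\<lambda>x. f x + g x))\<^sup>2 = (norm2 M f)\<^sup>2 + 2 * (\<integral>x. f x * g x \<partial>M) + (norm2 M g)\<^sup>2"
proof -
  have "(norm2 M (\<lambda>x. f x + g x))\<^sup>2 = (\<integral>x. (f x)\<^sup>2 + 2 * (f x * g x) + (g x)\<^sup>2 \<partial>M)"
    unfolding norm2_sq by (intro Bochner_Integration.integral_cong refl) (simp add: power2_sum)
  also have "\<dots> = (\<integral>x. (f x)\<^sup>2 \<partial>M) + 2 * (\<integral>x. f x * g x \<partial>M) + (\<integral>x. (g x)\<^sup>2 \<partial>M)"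
    using assms sq_int_mult[OF assms] by (simp add: sq_int_def)
  finally show ?thesis by (simp add: norm2_sq)
qed

lemma norm2_diff_sq:
  assumes "sq_int M f" "sq_int M g"
  shows "(norm2 M (\<lambda>x. f x - g x))\<^sup>2 = (norm2 M f)\<^sup>2 - 2 * (\<integral>x. f x * g x \<partial>M) + (norm2 M g)\<^sup>2"
  using norm2_add_sq[OF assms(1) sq_int_cmult[OF assms(2), of "-1"]]
  by (simp add: norm2_minus)

lemma norm2_Cauchy_Schwarz:
  assumes "sq_int M f" "sq_int M g"
  shows "\<bar>\<integral>x. f x * g x \<partial>M\<bar> \<le> norm2 M f * norm2 M g"
proof -
  define I where "I = (\<integral>x. f x * g x \<partial>M)"
  have main: "0 \<le> (norm2 M f)\<^sup>2 - 2 * t * I + t\<^sup>2 * (norm2 M g)\<^sup>2" for t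
  proof -
    have "(norm2 M (\<lambda>x. f x - t * g x))\<^sup>2 = (norm2 M f)\<^sup>2 - 2 * (\<integral>x. t * (f x * g x) \<partial>M) + (norm2 M (\<lambda>x. t * g x))\<^sup>2"
      using norm2_diff_sq[OF assms(1) sq_int_cmult[OF assms(2), of t]] by (simp add: mult_ac)
    then have "(norm2 M f)\<^sup>2 - 2 * (\<integral>x. t * (f x * g x) \<partial>M) + (norm2 M (\<lambda>x. t * g x))\<^sup>2 \<ge> 0"
      by (metis zero_le_power2)
    then show ?thesis by (simp add: norm2_cmult I_def power_mult_distrib)
  qed
  have "I\<^sup>2 \<le> (norm2 M f)\<^sup>2 * (norm2 M g)\<^sup>2"
  proof (cases "norm2 M g = 0")
    case True
    have "I = 0"
    proof (rule ccontr)
      assume "I \<noteq> 0"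
      \<comment> \<open>With \<open>norm2 M g = 0\<close> the quadratic polynomial in t is affine,
        and this t gives it the value -1.\<close>
      then show False using main[of "((norm2 M f)\<^sup>2 + 1) / (2 * I)"] True by simp
    qed
    then show ?thesis by simp
  next
    case False
    then have pos: "(norm2 M g)\<^sup>2 > 0" by simp
    \<comment> \<open>The chosen t minimises the polynomial.\<close>
    have "0 \<le> (norm2 M f)\<^sup>2 - I\<^sup>2 / (norm2 M g)\<^sup>2"
      using main[of "I / (norm2 M g)\<^sup>2"] False by (simp add: field_simps power2_eq_square)
    then show ?thesis using pos by (simp add: field_simps)
  qed
  then have "\<bar>I\<bar> \<le> \<bar>norm2 M f * norm2 M g\<bar>" unfolding abs_le_square_iff power_mult_distrib .
  then show ?thesis unfolding I_def[symmetric] by (simp only: abs_mult abs_of_nonneg norm2_nonneg)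
qed

lemma norm2_triangle:
  assumes "sq_int M f" "sq_int M g"
  shows "norm2 M (\<lambda>x. f x + g x) \<le> norm2 M f + norm2 M g"
proof (rule power2_le_imp_le)
  show "(norm2 M (\<lambda>x. f x + g x))\<^sup>2 \<le> (norm2 M f + norm2 M g)\<^sup>2"
    using norm2_add_sq[OF assms] norm2_Cauchy_Schwarz[OF assms] by (simp add: power2_sum)
qed simp

lemma norm2_triangle_diff:
  assumes "sq_int M f" "sq_int M g"
  shows "norm2 M (\<lambda>x. f x - g x) \<le> norm2 M f + norm2 M g"
  using norm2_triangle[OF assms(1) sq_int_cmult[OF assms(2), of "-1"]]
  by (simp add: norm2_minus)

lemma norm2_triangle3:
  assumes "sq_int M f" "sq_int M g" "sq_int M h"
  shows "norm2 M (\<lambda>x. f x - h x) \<le> norm2 M (\<lambda>x. f x - g x) + norm2 M (\<lambda>x. g x - h x)"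
  using norm2_triangle[OF sq_int_diff[OF assms(1,2)] sq_int_diff[OF assms(2,3)]] by simp

lemma norm2_rev_triangle:
  assumes "sq_int M f" "sq_int M g"
  shows "\<bar>norm2 M f - norm2 M g\<bar> \<le> norm2 M (\<lambda>x. f x - g x)"
proof -
  have "norm2 M f \<le> norm2 M (\<lambda>x. f x - g x) + norm2 M g"
    using norm2_triangle[OF sq_int_diff[OF assms] assms(2)] by simp
  moreover have "norm2 M g \<le> norm2 M (\<lambda>x. g x - f x) + norm2 M f"
    using norm2_triangle[OF sq_int_diff[OF assms(2,1)] assms(1)] by simp
  ultimately show ?thesis by (simp add: norm2_commute[of M g f])
qed

lemma (in finite_measure) sq_int_bounded:
  assumes "f \<in> borel_measurable M" "\<And>x. x \<in> space M \<Longrightarrow> \<bar>f x\<bar> \<le> B"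
  shows "sq_int M f" "norm2 M f \<le> B * sqrt (measure M (space M))"
proof -
  have bd: "(f x)\<^sup>2 \<le> B\<^sup>2" if "x \<in> space M" for x
    using assms(2)[OF that] by (metis abs_ge_zero power2_abs power_mono)
  show si: "sq_int M f"
    unfolding sq_int_def using assms bd
    by (auto intro!: integrable_const_bound[of _ "B\<^sup>2"])
  have "(norm2 M f)\<^sup>2 \<le> (\<integral>x. B\<^sup>2 \<partial>M)"
    unfolding norm2_sq using si bd by (intro integral_mono) (auto simp: sq_int_def)
  then have le: "(norm2 M f)\<^sup>2 \<le> (B * sqrt (measure M (space M)))\<^sup>2"
    by (simp add: power_mult_distrib mult.commute)
  show "norm2 M f \<le> B * sqrt (measure M (space M))"
  \<comment> \<open>The bound is assumed on points of the space only, so B could be negative if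
    there are none.\<close>
  proof (cases "space M = {}")
    case True then show ?thesis by (simp add: norm2_def Bochner_Integration.integral_empty)
  next
    case False
    then have "B \<ge> 0" using assms(2) by fastforce
    then show ?thesis using le by (auto intro: power2_le_imp_le)
  qed
qed

lemma (in finite_measure) sq_int_imp_integrable: "sq_int M f \<Longrightarrow> integrable M f"
  using sq_int_mult[of M f "\<lambda>x. 1"] by (simp add: sq_int_def)

text \<open>Dominated convergence for the squares, with majorant \<open>(|f| + w)^2\<close>. It
  serves the approximation by cut-off functions, by increasing sets and by simple functions.\<close>

lemma (in finite_measure) tendsto_norm2_dominated:
  assumes [measurable]: "\<And>i::nat. s i \<in> borel_measurable M" and f: "sq_int M f" and w: "sq_int M w"
    and lim: "AE x in M. (\<lambda>i. s i x) \<longlonglongrightarrow> f x" and dom: "\<And>i. AE x in M. \<bar>s i x\<bar> \<le> w x"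
  shows "(\<lambda>i. norm2 M (\<lambda>x. f x - s i x)) \<longlonglongrightarrow> 0"
proof -
  have [measurable]: "f \<in> borel_measurable M" "w \<in> borel_measurable M" using f w by (auto simp: sq_int_def)
  have "(\<lambda>i. \<integral>x. (f x - s i x)\<^sup>2 \<partial>M) \<longlonglongrightarrow> (\<integral>x. 0 \<partial>M)"
  proof (rule integral_dominated_convergence[where w = "\<lambda>x. (\<bar>f x\<bar> + w x)\<^sup>2"])
    show "integrable M (\<lambda>x. (\<bar>f x\<bar> + w x)\<^sup>2)"
      using sq_int_add[OF sq_int_abs[OF f] w] by (simp add: sq_int_def)
    show "AE x in M. (\<lambda>i. (f x - s i x)\<^sup>2) \<longlonglongrightarrow> 0"
      using lim
    proof eventually_elim
      case (elim x)
      have "(\<lambda>i. (f x - s i x)\<^sup>2) \<longlonglongrightarrow> (f x - f x)\<^sup>2"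
        by (intro tendsto_intros elim)
      then show ?case by simp
    qed
    show "AE x in M. norm ((f x - s i x)\<^sup>2) \<le> (\<bar>f x\<bar> + w x)\<^sup>2" for i
      using dom[of i]
    proof eventually_elim
      case (elim x)
      have "\<bar>f x - s i x\<bar> \<le> \<bar>f x\<bar> + w x" using elim by linarith
      then have "\<bar>f x - s i x\<bar>\<^sup>2 \<le> (\<bar>f x\<bar> + w x)\<^sup>2" by (intro power_mono) auto
      then show ?case by simp
    qed
  qed auto
  then have "(\<lambda>i. sqrt (\<integral>x. (f x - s i x)\<^sup>2 \<partial>M)) \<longlonglongrightarrow> sqrt 0"
    by (intro tendsto_real_sqrt) simp
  then show ?thesis unfolding norm2_def by simp
qed

lemma (in finite_measure) ennreal_norm2:
  assumes "sq_int M f"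
  shows "(\<integral>\<^sup>+x. ennreal ((f x)\<^sup>2) \<partial>M) = ennreal ((norm2 M f)\<^sup>2)"
  using assms by (simp add: norm2_sq sq_int_def nn_integral_eq_integral)

text \<open>The collision operator is estimated with non-negative integrals, where Fubini asks for
  no integrability; this returns membership in L2 and the norm bound together.\<close>

lemma sq_int_nn_integralI:
  assumes [measurable]: "f \<in> borel_measurable M" and le: "(\<integral>\<^sup>+x. ennreal ((f x)\<^sup>2) \<partial>M) \<le> ennreal (B\<^sup>2)" and B: "0 \<le> B"
  shows "sq_int M f" "norm2 M f \<le> B"
proof -
  have fin: "(\<integral>\<^sup>+x. ennreal ((f x)\<^sup>2) \<partial>M) < \<infinity>" using le by (simp add: order_le_less_trans)
  then have i: "integrable M (\<lambda>x. (f x)\<^sup>2)" by (intro integrableI_nonneg) auto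
  then show "sq_int M f" by (simp add: sq_int_def)
  have "ennreal (\<integral>x. (f x)\<^sup>2 \<partial>M) \<le> ennreal (B\<^sup>2)"
    using le i by (simp add: nn_integral_eq_integral)
  then have "(norm2 M f)\<^sup>2 \<le> B\<^sup>2" by (simp add: norm2_sq ennreal_le_iff)
  then show "norm2 M f \<le> B" using B by (rule power2_le_imp_le)
qed

section \<open>Periodic functions\<close>

abbreviation MD :: "real \<Rightarrow> (real^'n) measure" where
  "MD L \<equiv> restrict_space lborel (dom_L L)"

lemma dom_L_borel [measurable, simp]: "dom_L L \<in> sets borel"
  by (simp add: dom_L_def)

lemma mem_dom_L: "v \<in> dom_L L \<longleftrightarrow> (\<forall>j. - L \<le> v $ j \<and> v $ j \<le> L)"
  by (simp add: dom_L_def mem_box_cart)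

lemma in_L2_iff: "in_L2 L g \<longleftrightarrow> sq_int (MD L) g"
  by (simp add: in_L2_def sq_int_def integrable_restrict_space set_borel_measurable_def set_integrable_def
      borel_measurable_restrict_space_iff)

lemma L2norm_eq: "L2norm L g = norm2 (MD L) g"
  by (simp add: L2norm_def norm2_def integral_restrict_space set_lebesgue_integral_def)

lemma space_MD: "space (MD L) = dom_L L"
  by (simp add: space_restrict_space)

lemma finite_measure_MD: "finite_measure (MD L)"
proof
  have "emeasure lborel (dom_L L) \<noteq> \<infinity>"
    unfolding dom_L_def by (metis emeasure_lborel_cbox_finite less_irrefl)
  then show "emeasure (MD L) (space (MD L)) \<noteq> \<infinity>"
    by (subst emeasure_restrict_space) (auto simp: space_MD)
qed

interpretation MD: finite_measure "MD L" for L
  by (rule finite_measure_MD)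

lemma measure_MD: "0 \<le> L \<Longrightarrow> measure (MD L :: (real^'n) measure) (space (MD L)) = (2 * L) ^ CARD('n)"
  by (subst measure_restrict_space)
     (auto simp: space_MD dom_L_def content_cbox_cart interval_eq_empty_cart)

lemma borel_measurable_MD: "g \<in> borel_measurable borel \<Longrightarrow> g \<in> borel_measurable (MD L)"
  by (intro measurable_restrict_space1) simp

section \<open>The period lattice and translation invariance of integrals over one period\<close>

definition lat :: "real \<Rightarrow> int^'n \<Rightarrow> real^'n" where
  "lat L m = (\<chi> j. 2 * L * real_of_int (m $ j))"

lemma periodic_axis:
  assumes "periodic_L L g"
  shows "g (v + (2 * L * real_of_int m) *\<^sub>R axis j 1) = g v"
proof (induction m arbitrary: v rule: int_induct[where k = 0])
  case base
  show ?case by simp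
next
  case (step1 i)
  have "g (v + (2 * L * real_of_int (i + 1)) *\<^sub>R axis j 1)
      = g ((v + (2 * L * real_of_int i) *\<^sub>R axis j 1) + (2 * L) *\<^sub>R axis j 1)"
    by (simp add: algebra_simps)
  then show ?case using assms step1 unfolding periodic_L_def by metis
next
  case (step2 i)
  have "g (v + (2 * L * real_of_int (i - 1)) *\<^sub>R axis j 1)
      = g ((v + (2 * L * real_of_int (i - 1)) *\<^sub>R axis j 1) + (2 * L) *\<^sub>R axis j 1)"
    using assms unfolding periodic_L_def by metis
  also have "\<dots> = g (v + (2 * L * real_of_int i) *\<^sub>R axis j 1)"
    by (simp add: algebra_simps)
  finally show ?case using step2 by simp
qed

lemma periodic_lat:
  fixes g :: "real^'n::finite \<Rightarrow> real"
  assumes "periodic_L L g"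
  shows "g (v + lat L m) = g v"
proof -
  have "g (v + (\<Sum>j\<in>J. (2 * L * real_of_int (m $ j)) *\<^sub>R axis j 1)) = g v" if "finite J" for J
    using that
  proof (induction J arbitrary: v)
    case (insert j J)
    then show ?case using periodic_axis[OF assms] by (simp add: add.assoc[symmetric])
  qed simp
  moreover have "lat L m = (\<Sum>j\<in>UNIV. (2 * L * real_of_int (m $ j)) *\<^sub>R axis j 1)"
    by (simp add: lat_def vec_eq_iff axis_def if_distrib cong: if_cong)
  ultimately show ?thesis by simp
qed

lemma lat_minus: "lat L (- m) = - lat L m"
  by (simp add: lat_def vec_eq_iff)

text \<open>Half-open, so that it is a fundamental domain: its lattice translates tile the space
  without overlap, whereas translates of the closed cube \<open>dom_L\<close> share faces.\<close>

definition cell :: "real \<Rightarrow> (real^'n) set" where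
  "cell L = {v. \<forall>j. - L \<le> v $ j \<and> v $ j < L}"

text \<open>The index of the only lattice shift that brings v into \<open>cell\<close>.\<close>

definition lat_red :: "real \<Rightarrow> real^'n \<Rightarrow> int^'n" where
  "lat_red L v = (\<chi> j. - \<lfloor>(v $ j + L) / (2 * L)\<rfloor>)"

lemma lat_in_cell_iff:
  assumes "L > 0"
  shows "v + lat L m \<in> cell L \<longleftrightarrow> m = lat_red L v"
proof -
  have "- L \<le> x + 2 * L * real_of_int i \<and> x + 2 * L * real_of_int i < L \<longleftrightarrow> i = - \<lfloor>(x + L) / (2 * L)\<rfloor>" for x i
  proof -
    have "i = - \<lfloor>(x + L) / (2 * L)\<rfloor> \<longleftrightarrow> \<lfloor>(x + L) / (2 * L)\<rfloor> = - i" by auto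
    also have "\<dots> \<longleftrightarrow> real_of_int (- i) \<le> (x + L) / (2 * L) \<and> (x + L) / (2 * L) < real_of_int (- i) + 1"
      by (rule floor_eq_iff)
    also have "\<dots> \<longleftrightarrow> - L \<le> x + 2 * L * real_of_int i \<and> x + 2 * L * real_of_int i < L"
      using assms by (simp add: field_simps) (smt (verit))
    finally show ?thesis by simp
  qed
  then show ?thesis by (simp add: cell_def lat_red_def lat_def vec_eq_iff)
qed

lemma cell_borel [measurable, simp]: "cell L \<in> sets borel"
proof -
  have "cell L = (\<Inter>j. {v. - L \<le> v $ j} \<inter> {v. v $ j < L})" by (auto simp: cell_def)
  also have "\<dots> \<in> sets borel"
    by (intro sets.countable_INT' countable_finite sets.Int borel_closed borel_open closed_Collect_le open_Collect_less continuous_intros) auto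
  finally show ?thesis .
qed

text \<open>The translates of \<open>cell\<close> form a partition of unity. The sum is an integral
  against counting measure so that it can be exchanged with the integral over v; both signs of the
  shift occur in the next proof.\<close>

lemma nn_integral_lattice_cell:
  assumes "L > 0"
  shows "(\<integral>\<^sup>+m. indicator (cell L) (v + lat L m) \<partial>count_space UNIV) = (1::ennreal)"
    and "(\<integral>\<^sup>+m. indicator (cell L) (v - lat L m) \<partial>count_space UNIV) = (1::ennreal)"
proof -
  have "(\<lambda>m. indicator (cell L) (v + lat L m) :: ennreal) = indicator {lat_red L v}"
    by (auto simp: indicator_def lat_in_cell_iff[OF assms])
  then show "(\<integral>\<^sup>+m. indicator (cell L) (v + lat L m) \<partial>count_space UNIV) = (1::ennreal)"
    by (simp add: one_ennreal_def)
  have "v - lat L m \<in> cell L \<longleftrightarrow> m = - lat_red L v" for m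
    using lat_in_cell_iff[OF assms, of v "- m"] by (simp add: lat_minus) (metis minus_minus)
  then have "(\<lambda>m. indicator (cell L) (v - lat L m) :: ennreal) = indicator {- lat_red L v}"
    by (auto simp: indicator_def)
  then show "(\<integral>\<^sup>+m. indicator (cell L) (v - lat L m) \<partial>count_space UNIV) = (1::ennreal)"
    by (simp add: one_ennreal_def)
qed

lemma nn_integral_lborel_shift:
  fixes f :: "'a::euclidean_space \<Rightarrow> ennreal"
  assumes [measurable]: "f \<in> borel_measurable borel"
  shows "(\<integral>\<^sup>+v. f (v + a) \<partial>lborel) = (\<integral>\<^sup>+v. f v \<partial>lborel)"
proof -
  have "(\<integral>\<^sup>+v. f v \<partial>lborel) = (\<integral>\<^sup>+v. f v \<partial>(distr lborel borel ((+) a)))"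
    by (simp add: lborel_distr_plus)
  also have "\<dots> = (\<integral>\<^sup>+v. f (a + v) \<partial>lborel)" by (rule nn_integral_distr) auto
  finally show ?thesis by (simp add: add.commute)
qed

text \<open>Unfolding and refolding: insert the partition of unity at \<open>v + a\<close>, exchange
  sum and integral, translate each summand by \<open>a\<close> plus a lattice vector, and sum up the
  translates of the other indicator. The cube is never cut into pieces.\<close>

lemma nn_integral_cell_shift:
  fixes G :: "real^'n::finite \<Rightarrow> ennreal"
  assumes L: "L > 0" and [measurable]: "G \<in> borel_measurable borel" and per: "\<And>v m. G (v + lat L m) = G v"
  shows "(\<integral>\<^sup>+v. indicator (cell L) v * G (v + a) \<partial>lborel) = (\<integral>\<^sup>+v. indicator (cell L) v * G v \<partial>lborel)"
proof -
  have per': "G (v - lat L m) = G v" for v m using per[of "v - lat L m" m] by simp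
  have "(\<integral>\<^sup>+v. indicator (cell L) v * G (v + a) \<partial>lborel)
     = (\<integral>\<^sup>+v. (\<integral>\<^sup>+m. indicator (cell L) v * G (v + a) * indicator (cell L) (v + a + lat L m) \<partial>count_space UNIV) \<partial>lborel)"
    by (subst nn_integral_cmult) (simp_all add: nn_integral_lattice_cell[OF L])
  also have "\<dots> = (\<integral>\<^sup>+m. (\<integral>\<^sup>+v. indicator (cell L) v * G (v + a) * indicator (cell L) (v + a + lat L m) \<partial>lborel) \<partial>count_space UNIV)"
    by (intro nn_integral_count_space_nn_integral) simp_all
  also have "\<dots> = (\<integral>\<^sup>+m. (\<integral>\<^sup>+v. indicator (cell L) (v - a - lat L m) * G v * indicator (cell L) v \<partial>lborel) \<partial>count_space UNIV)"
  proof (rule nn_integral_cong)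
    fix m :: "int^'n"
    have "(\<integral>\<^sup>+v. indicator (cell L) (v - a - lat L m) * G (v - lat L m) * indicator (cell L) v \<partial>lborel)
      = (\<integral>\<^sup>+v. indicator (cell L) ((v + (a + lat L m)) - a - lat L m) * G ((v + (a + lat L m)) - lat L m) * indicator (cell L) (v + (a + lat L m)) \<partial>lborel)"
      by (subst nn_integral_lborel_shift[symmetric, of _ "a + lat L m"]) simp_all
    also have "\<dots> = (\<integral>\<^sup>+v. indicator (cell L) v * G (v + a) * indicator (cell L) (v + a + lat L m) \<partial>lborel)"
      by (simp add: add.assoc[symmetric])
    finally show "(\<integral>\<^sup>+v. indicator (cell L) v * G (v + a) * indicator (cell L) (v + a + lat L m) \<partial>lborel) =
      (\<integral>\<^sup>+v. indicator (cell L) (v - a - lat L m) * G v * indicator (cell L) v \<partial>lborel)"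
      by (simp only: per')
  qed
  also have "\<dots> = (\<integral>\<^sup>+v. (\<integral>\<^sup>+m. indicator (cell L) (v - a - lat L m) * G v * indicator (cell L) v \<partial>count_space UNIV) \<partial>lborel)"
    by (intro nn_integral_count_space_nn_integral[symmetric]) simp_all
  also have "\<dots> = (\<integral>\<^sup>+v. indicator (cell L) v * G v \<partial>lborel)"
    by (subst nn_integral_multc, simp, subst nn_integral_multc, simp)
       (simp add: nn_integral_lattice_cell[OF L] mult.commute)
  finally show ?thesis .
qed

text \<open>The closed cube defines the norms, the half-open one tiles the space, and the open one
  is where the embedding of the torus is injective. They differ by null sets and are exchanged by
  the lemmas below.\<close>

abbreviation open_cube :: "real \<Rightarrow> (real^'n::finite) set" where
  "open_cube L \<equiv> box (\<chi> j. - L) (\<chi> j. L)"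

lemma mem_open_cube: "v \<in> open_cube L \<longleftrightarrow> (\<forall>j. \<bar>v $ j\<bar> < L)"
proof -
  have "- L < x \<and> x < L \<longleftrightarrow> \<bar>x\<bar> < L" for x by linarith
  then show ?thesis by (simp add: mem_box_cart)
qed

lemma open_cube_subset_dom: "open_cube L \<subseteq> dom_L L"
  unfolding dom_L_def by (rule box_subset_cbox)

lemma AE_open_cube_dom: "AE v in lborel. v \<in> dom_L L \<longrightarrow> v \<in> (open_cube L :: (real^'n::finite) set)"
proof -
  have eq: "emeasure lborel (dom_L L :: (real^'n) set) = emeasure lborel (open_cube L :: (real^'n) set)"
    unfolding dom_L_def by (subst emeasure_lborel_cbox_eq, subst emeasure_lborel_box_eq) auto
  note fin = emeasure_lborel_box_finite[of "\<chi> j. - L" "\<chi> j. L :: real^'n"]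
  have "emeasure lborel (dom_L L - open_cube L :: (real^'n) set) = emeasure lborel (dom_L L :: (real^'n) set) - emeasure lborel (open_cube L :: (real^'n) set)"
    using fin open_cube_subset_dom by (intro emeasure_Diff) auto
  then have "emeasure lborel (dom_L L - open_cube L :: (real^'n) set) = 0"
    using eq fin by (simp add: ennreal_diff_self)
  then have "AE v in lborel. v \<notin> (dom_L L - open_cube L :: (real^'n) set)" by (intro AE_not_in) (auto simp: null_sets_def)
  then show ?thesis by simp
qed

lemma AE_open_cube: "AE v in MD L. v \<in> (open_cube L :: (real^'n::finite) set)"
  using AE_open_cube_dom by (subst AE_restrict_space_iff) auto

lemma AE_cell_dom:
  "AE v in lborel. v \<in> cell L \<longleftrightarrow> v \<in> (dom_L L :: (real^'n::finite) set)"
  using AE_open_cube_dom[of L]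
proof eventually_elim
  case (elim v)
  have "v \<in> open_cube L \<Longrightarrow> v \<in> cell L" "v \<in> cell L \<Longrightarrow> v \<in> dom_L L"
    by (auto simp: mem_box_cart cell_def mem_dom_L less_imp_le)
  then show ?case using elim by blast
qed

lemma nn_integral_MD:
  fixes G :: "real^'n::finite \<Rightarrow> ennreal"
  shows "(\<integral>\<^sup>+v. G v \<partial>MD L) = (\<integral>\<^sup>+v. indicator (cell L) v * G v \<partial>lborel)"
proof -
  have "(\<integral>\<^sup>+v. G v \<partial>MD L) = (\<integral>\<^sup>+v. G v * indicator (dom_L L) v \<partial>lborel)"
    by (simp add: nn_integral_restrict_space)
  also have "\<dots> = (\<integral>\<^sup>+v. indicator (cell L) v * G v \<partial>lborel)"
    using AE_cell_dom[of L] by (intro nn_integral_cong_AE) (auto simp: indicator_def)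
  finally show ?thesis .
qed

lemma nn_integral_MD_shift:
  fixes G :: "real^'n::finite \<Rightarrow> ennreal"
  assumes L: "L > 0" and "G \<in> borel_measurable borel" and per: "\<And>v m. G (v + lat L m) = G v"
  shows "(\<integral>\<^sup>+v. G (v + a) \<partial>MD L) = (\<integral>\<^sup>+v. G v \<partial>MD L)"
  unfolding nn_integral_MD by (rule nn_integral_cell_shift[OF assms])

lemma integral_MD_shift:
  fixes g :: "real^'n::finite \<Rightarrow> real"
  assumes L: "L > 0" and per: "periodic_L L g" and [measurable]: "g \<in> borel_measurable borel"
    and int: "\<And>a. integrable (MD L) (\<lambda>v. g (v + a))"
  shows "(\<integral>v. g (v + a) \<partial>MD L) = (\<integral>v. g v \<partial>MD L)"
proof -
  have "integrable (MD L) g" using int[of 0] by simp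
  moreover have "(\<integral>\<^sup>+v. ennreal (g (v + a)) \<partial>MD L) = (\<integral>\<^sup>+v. ennreal (g v) \<partial>MD L)"
    by (rule nn_integral_MD_shift[OF L]) (simp_all add: periodic_lat[OF per])
  moreover have "(\<integral>\<^sup>+v. ennreal (- g (v + a)) \<partial>MD L) = (\<integral>\<^sup>+v. ennreal (- g v) \<partial>MD L)"
    by (rule nn_integral_MD_shift[OF L]) (simp_all add: periodic_lat[OF per])
  ultimately show ?thesis using int[of a] by (simp add: real_lebesgue_integral_def)
qed

text \<open>Measurability is given on the cube only, but \<open>Q\<close> evaluates its argument
  outside of it. A periodic function is its restriction composed with the reduction to the
  fundamental domain, which is measurable because the floor function is.\<close>

lemma periodic_borel_measurable:
  fixes g :: "real^'n::finite \<Rightarrow> real"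
  assumes L: "L > 0" and per: "periodic_L L g" and m: "g \<in> borel_measurable (MD L)"
  shows "g \<in> borel_measurable borel"
proof -
  have [measurable]: "(\<lambda>x. indicator (dom_L L) x *\<^sub>R g x) \<in> borel_measurable borel"
    using m by (subst (asm) borel_measurable_restrict_space_iff) auto
  have [measurable]: "(\<lambda>v. v + lat L (lat_red L v)) \<in> borel \<rightarrow>\<^sub>M (borel :: (real^'n) measure)"
  proof (rule borel_measurable_euclidean_space[THEN iffD2, rule_format])
    fix i :: "real^'n" assume "i \<in> Basis"
    then obtain j where i: "i = axis j 1" by (auto simp: Basis_vec_def)
    have "(\<lambda>v::real^'n. v $ j + 2 * L * real_of_int (- \<lfloor>(v $ j + L) / (2 * L)\<rfloor>)) \<in> borel_measurable borel"
      by measurable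
    then show "(\<lambda>x. (x + lat L (lat_red L x)) \<bullet> i) \<in> borel_measurable borel"
      by (simp add: i cart_eq_inner_axis[symmetric] lat_def lat_red_def)
  qed
  have eq: "g v = indicator (dom_L L) (v + lat L (lat_red L v)) *\<^sub>R g (v + lat L (lat_red L v))" for v
  proof -
    have "v + lat L (lat_red L v) \<in> cell L" using lat_in_cell_iff[OF L] by auto
    then have "v + lat L (lat_red L v) \<in> dom_L L" by (auto simp: cell_def mem_dom_L less_imp_le)
    then show ?thesis by (simp add: periodic_lat[OF per])
  qed
  have "(\<lambda>v. indicator (dom_L L) (v + lat L (lat_red L v)) *\<^sub>R g (v + lat L (lat_red L v))) \<in> borel_measurable borel"
    by (rule measurable_compose[of "\<lambda>v. v + lat L (lat_red L v)" borel borel "\<lambda>x. indicator (dom_L L) x *\<^sub>R g x" borel]) measurable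
  then show ?thesis by (subst (asm) eq[symmetric])
qed

section \<open>Trigonometric polynomials and the Fourier projection\<close>

text \<open>All functions of v are real, so the complex modes are replaced by their real and
  imaginary parts.\<close>

definition cosk :: "real \<Rightarrow> int^'n::finite \<Rightarrow> real^'n \<Rightarrow> real" where
  "cosk L k v = cos (pi / L * kdot k v)"

definition sink :: "real \<Rightarrow> int^'n::finite \<Rightarrow> real^'n \<Rightarrow> real" where
  "sink L k v = sin (pi / L * kdot k v)"

lemma kdot_add: "kdot k (v + w) = kdot k v + kdot k w"
  by (simp add: kdot_def algebra_simps sum.distrib)

lemma kdot_scaleR: "kdot k (c *\<^sub>R v) = c * kdot k v"
  by (simp add: kdot_def sum_distrib_left mult_ac)

lemma kdot_axis: "kdot k (axis j 1) = real_of_int (k $ j)"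
  by (simp add: kdot_def axis_def if_distrib cong: if_cong)

lemma kdot_plus: "kdot (k + l) v = kdot k v + kdot l v"
  by (simp add: kdot_def algebra_simps sum.distrib)

lemma kdot_minus: "kdot (k - l) v = kdot k v - kdot l v"
  by (simp add: kdot_def algebra_simps sum_subtractf)

lemma kdot_uminus: "kdot (- l) v = - kdot l v"
  by (simp add: kdot_def sum_negf)

lemma kdot_zero [simp]: "kdot 0 v = 0"
  by (simp add: kdot_def)

lemma continuous_on_kdot [continuous_intros]: "continuous_on S (kdot k)"
  unfolding kdot_def by (intro continuous_intros)

lemma continuous_on_cosk [continuous_intros]: "continuous_on S (cosk L k)"
  unfolding cosk_def by (intro continuous_intros)

lemma continuous_on_sink [continuous_intros]: "continuous_on S (sink L k)"
  unfolding sink_def by (intro continuous_intros)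

lemma cosk_borel [measurable]: "cosk L k \<in> borel_measurable borel"
  by (intro borel_measurable_continuous_onI continuous_intros)

lemma sink_borel [measurable]: "sink L k \<in> borel_measurable borel"
  by (intro borel_measurable_continuous_onI continuous_intros)

lemma sq_int_cosk [simp]: "sq_int (MD L) (cosk L' k)"
  by (rule MD.sq_int_bounded[of _ _ 1]) (auto simp: borel_measurable_MD, simp add: cosk_def)

lemma sq_int_sink [simp]: "sq_int (MD L) (sink L' k)"
  by (rule MD.sq_int_bounded[of _ _ 1]) (auto simp: borel_measurable_MD, simp add: sink_def)

lemma cosk_uminus [simp]: "cosk L (- k) v = cosk L k v"
  by (simp add: cosk_def kdot_uminus)

lemma sink_uminus [simp]: "sink L (- k) v = - sink L k v"
  by (simp add: sink_def kdot_uminus)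

lemma abs_cosk_le: "\<bar>cosk L k v\<bar> \<le> 1"
  by (simp add: cosk_def)

lemma abs_sink_le: "\<bar>sink L k v\<bar> \<le> 1"
  by (simp add: sink_def)

lemma kdot_period:
  "L > 0 \<Longrightarrow> pi / L * kdot k (v + (2 * L) *\<^sub>R axis j 1) = pi / L * kdot k v + 2 * pi * real_of_int (k $ j)"
  by (simp add: kdot_add kdot_scaleR kdot_axis distrib_left)

lemma periodic_cosk: "L > 0 \<Longrightarrow> periodic_L L (cosk L k)"
  unfolding periodic_L_def cosk_def by (simp only: kdot_period cos_add cos_int_2pin sin_int_2pin) simp

lemma periodic_sink: "L > 0 \<Longrightarrow> periodic_L L (sink L k)"
  unfolding periodic_L_def sink_def by (simp only: kdot_period sin_add cos_int_2pin sin_int_2pin) simp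

text \<open>A translation by which the phase grows by \<open>pi\<close> changes the sign of the integrand but not its integral.\<close>
lemma integral_cosk_sink:
  fixes k :: "int^'n::finite"
  assumes L: "L > 0"
  shows "(\<integral>v. cosk L k v \<partial>MD L) = (if k = 0 then (2 * L) ^ CARD('n) else 0)"
    and "(\<integral>v. sink L k v \<partial>MD L) = 0"
proof -
  have shift: "(\<integral>v. cosk L k (v + a) \<partial>MD L) = (\<integral>v. cosk L k v \<partial>MD L)"
    "(\<integral>v. sink L k (v + a) \<partial>MD L) = (\<integral>v. sink L k v \<partial>MD L)" for a
  proof -
    have "integrable (MD L) (\<lambda>v. cosk L k (v + a))" "integrable (MD L) (\<lambda>v. sink L k (v + a))" for a
      by (rule MD.integrable_const_bound[of _ 1]; auto intro!: borel_measurable_MD simp: abs_cosk_le abs_sink_le)+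
    then show "(\<integral>v. cosk L k (v + a) \<partial>MD L) = (\<integral>v. cosk L k v \<partial>MD L)"
    "(\<integral>v. sink L k (v + a) \<partial>MD L) = (\<integral>v. sink L k v \<partial>MD L)"
      using integral_MD_shift[OF L periodic_cosk[OF L] cosk_borel] integral_MD_shift[OF L periodic_sink[OF L] sink_borel]
      by blast+
  qed
  have *: "(\<integral>v. cosk L k v \<partial>MD L) = 0 \<and> (\<integral>v. sink L k v \<partial>MD L) = 0" if "k \<noteq> 0"
  proof -
    obtain j where j: "k $ j \<noteq> 0" using \<open>k \<noteq> 0\<close> by (auto simp: vec_eq_iff)
    define a :: "real^'n" where "a = (L / real_of_int (k $ j)) *\<^sub>R axis j 1"
    have eq: "pi / L * kdot k (v + a) = pi / L * kdot k v + pi" for v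
      using L j by (simp add: a_def kdot_add kdot_scaleR kdot_axis field_simps)
    have "cosk L k (v + a) = - cosk L k v" "sink L k (v + a) = - sink L k v" for v
      unfolding cosk_def sink_def eq by simp_all
    then show ?thesis using shift[of a] by simp
  qed
  have "(\<integral>v. cosk L k v \<partial>MD L) = (2 * L) ^ CARD('n)" if "k = 0"
    using that measure_MD[where ?'n = 'n, of L] L by (simp add: cosk_def)
  then show "(\<integral>v. cosk L k v \<partial>MD L) = (if k = 0 then (2 * L) ^ CARD('n) else 0)" using * by auto
  show "(\<integral>v. sink L k v \<partial>MD L) = 0" using * by (cases "k = 0") (auto simp: sink_def)
qed

lemma integrable_cosk [simp]: "integrable (MD L) (cosk L k)"
  by (rule MD.sq_int_imp_integrable) simp

lemma integrable_sink [simp]: "integrable (MD L) (sink L k)"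
  by (rule MD.sq_int_imp_integrable) simp

text \<open>The index set contains k and -k, which give the same cosine and opposite sines. This
  redundancy is the origin of the second indicator and of the halved volume
  \<open>V\<close>.\<close>

lemma trig_orthogonality:
  fixes k l :: "int^'n::finite"
  assumes L: "L > 0"
  defines "V \<equiv> (2 * L) ^ CARD('n) / 2"
  shows "(\<integral>v. cosk L k v * cosk L l v \<partial>MD L) = V * ((if k = l then 1 else 0) + (if k = - l then 1 else 0))"
    and "(\<integral>v. sink L k v * sink L l v \<partial>MD L) = V * ((if k = l then 1 else 0) - (if k = - l then 1 else 0))"
    and "(\<integral>v. cosk L k v * sink L l v \<partial>MD L) = 0"
    and "(\<integral>v. sink L k v * cosk L l v \<partial>MD L) = 0"
proof -
  have e: "k - l = 0 \<longleftrightarrow> k = l" "k + l = 0 \<longleftrightarrow> k = - l" by (auto simp: eq_neg_iff_add_eq_0)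
  have e1: "cosk L k v * cosk L l v = (cosk L (k - l) v + cosk L (k + l) v) / 2" for v
    by (simp add: cosk_def kdot_plus kdot_minus cos_times_cos algebra_simps diff_divide_distrib)
  show "(\<integral>v. cosk L k v * cosk L l v \<partial>MD L) = V * ((if k = l then 1 else 0) + (if k = - l then 1 else 0))"
    using e unfolding e1 by (simp add: integral_cosk_sink[OF L] V_def)
  have e2: "sink L k v * sink L l v = (cosk L (k - l) v - cosk L (k + l) v) / 2" for v
    by (simp add: cosk_def sink_def kdot_plus kdot_minus sin_times_sin algebra_simps diff_divide_distrib)
  show "(\<integral>v. sink L k v * sink L l v \<partial>MD L) = V * ((if k = l then 1 else 0) - (if k = - l then 1 else 0))"
    using e unfolding e2 by (simp add: integral_cosk_sink[OF L] V_def)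
  have *: "cosk L k v * sink L l v = (sink L (k + l) v - sink L (k - l) v) / 2" for k l :: "int^'n" and v
    by (simp add: cosk_def sink_def kdot_plus kdot_minus cos_times_sin algebra_simps diff_divide_distrib)
  show "(\<integral>v. cosk L k v * sink L l v \<partial>MD L) = 0"
    by (simp add: * integral_cosk_sink[OF L])
  show "(\<integral>v. sink L k v * cosk L l v \<partial>MD L) = 0"
    by (subst mult.commute) (simp add: * integral_cosk_sink[OF L])
qed

section \<open>Frequencies and real trigonometric polynomials\<close>

lemma mem_modes: "k \<in> modes N \<longleftrightarrow> (\<forall>j. \<bar>real_of_int (k $ j)\<bar> \<le> real N / 2)"
proof -
  have "- a \<le> x \<and> x \<le> a \<longleftrightarrow> \<bar>x\<bar> \<le> a" for a x :: real by linarith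
  then show ?thesis by (simp only: modes_def mem_Collect_eq)
qed

lemma finite_modes [simp]: "finite (modes N :: (int^'n::finite) set)"
proof (rule finite_subset)
  show "(modes N :: (int^'n) set) \<subseteq> vec_lambda ` (PiE UNIV (\<lambda>_. {- int N..int N}))"
  proof
    fix k :: "int^'n" assume "k \<in> modes N"
    then have k: "\<bar>real_of_int (k $ j)\<bar> \<le> real N / 2" for j by (simp add: mem_modes)
    have "k $ j \<in> {- int N..int N}" for j
      using k[of j] by auto
    then show "k \<in> vec_lambda ` (PiE UNIV (\<lambda>_. {- int N..int N}))"
      by (intro image_eqI[of _ _ "vec_nth k"]) auto
  qed
  show "finite (vec_lambda ` (PiE (UNIV :: 'n set) (\<lambda>_. {- int N..int N})))"
    by (intro finite_imageI finite_PiE) auto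
qed

lemma uminus_modes: "- k \<in> modes N \<longleftrightarrow> k \<in> modes N"
  by (simp add: mem_modes)

lemma modes_mono: "M \<le> N \<Longrightarrow> modes M \<subseteq> modes N"
  by (auto simp: mem_modes) (metis divide_right_mono of_nat_le_iff order_trans zero_le_numeral)

text \<open>The real form of \<open>in_PN\<close>. The coefficients are not unique, as k and -k
  yield dependent functions; only the spanned space matters.\<close>

definition trig_poly :: "real \<Rightarrow> nat \<Rightarrow> (real^'n::finite \<Rightarrow> real) \<Rightarrow> bool" where
  "trig_poly L N p \<longleftrightarrow> (\<exists>a b. p = (\<lambda>v. \<Sum>k\<in>modes N. a k * cosk L k v + b k * sink L k v))"

lemma trig_polyI:
  "(\<And>v. p v = (\<Sum>k\<in>modes N. a k * cosk L k v + b k * sink L k v)) \<Longrightarrow> trig_poly L N p"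
  unfolding trig_poly_def by (intro exI[of _ a] exI[of _ b] ext)

lemma trig_poly_sq_int: "trig_poly L N p \<Longrightarrow> sq_int (MD L) p"
  by (auto simp: trig_poly_def intro!: sq_int_sum sq_int_add sq_int_cmult)

lemma trig_poly_continuous: "trig_poly L N p \<Longrightarrow> continuous_on UNIV p"
  by (auto simp: trig_poly_def intro!: continuous_intros continuous_on_compose2[OF continuous_on_cosk] continuous_on_compose2[OF continuous_on_sink])

lemma trig_poly_periodic:
  assumes "L > 0" "trig_poly L N p"
  shows "periodic_L L p"
proof -
  have "cosk L k (v + (2 * L) *\<^sub>R axis j 1) = cosk L k v" "sink L k (v + (2 * L) *\<^sub>R axis j 1) = sink L k v" for k :: "int^'a" and v j
    using periodic_cosk[OF assms(1), of k] periodic_sink[OF assms(1), of k] by (auto simp: periodic_L_def)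
  then show ?thesis using assms(2) by (auto simp: trig_poly_def periodic_L_def)
qed

lemma trig_poly_cmult:
  assumes "trig_poly L N p"
  shows "trig_poly L N (\<lambda>v. c * p v)"
proof -
  obtain a b where p: "p = (\<lambda>v. \<Sum>k\<in>modes N. a k * cosk L k v + b k * sink L k v)"
    using assms by (auto simp: trig_poly_def)
  show ?thesis unfolding trig_poly_def
    by (rule exI[of _ "\<lambda>k. c * a k"], rule exI[of _ "\<lambda>k. c * b k"])
       (simp add: p sum_distrib_left algebra_simps)
qed

lemma trig_poly_add:
  assumes "trig_poly L N p" "trig_poly L N q"
  shows "trig_poly L N (\<lambda>v. p v + q v)"
proof -
  obtain a b where p: "p = (\<lambda>v. \<Sum>k\<in>modes N. a k * cosk L k v + b k * sink L k v)"
    using assms by (auto simp: trig_poly_def)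
  obtain a' b' where q: "q = (\<lambda>v. \<Sum>k\<in>modes N. a' k * cosk L k v + b' k * sink L k v)"
    using assms by (auto simp: trig_poly_def)
  show ?thesis unfolding trig_poly_def
    by (rule exI[of _ "\<lambda>k. a k + a' k"], rule exI[of _ "\<lambda>k. b k + b' k"])
       (simp add: p q sum.distrib[symmetric] algebra_simps)
qed

lemma trig_poly_diff:
  assumes "trig_poly L N p" "trig_poly L N q"
  shows "trig_poly L N (\<lambda>v. p v - q v)"
  using trig_poly_add[OF assms(1) trig_poly_cmult[OF assms(2), of "-1"]] by simp

lemma trig_poly_mono:
  assumes "trig_poly L M p" "M \<le> N"
  shows "trig_poly L N p"
proof -
  obtain a b where p: "p = (\<lambda>v. \<Sum>k\<in>modes M. a k * cosk L k v + b k * sink L k v)"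
    using assms by (auto simp: trig_poly_def)
  have "(\<Sum>k\<in>modes M. a k * cosk L k v + b k * sink L k v) =
    (\<Sum>k\<in>modes N. (if k \<in> modes M then a k else 0) * cosk L k v + (if k \<in> modes M then b k else 0) * sink L k v)" for v
    using modes_mono[OF assms(2)] by (intro sum.mono_neutral_cong_left) auto
  then show ?thesis unfolding p by (rule trig_polyI)
qed

lemma in_PN_imp_trig_poly:
  assumes "in_PN L N g"
  shows "trig_poly L N g"
proof -
  obtain c where c: "\<And>v. complex_of_real (g v) = (\<Sum>k\<in>modes N. c k * exp (\<i> * complex_of_real (pi / L * kdot k v)))"
    using assms unfolding in_PN_def by blast
  have "g v = (\<Sum>k\<in>modes N. Re (c k) * cosk L k v + (- Im (c k)) * sink L k v)" for v
  proof -
    have "g v = Re (complex_of_real (g v))" by simp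
    also have "\<dots> = (\<Sum>k\<in>modes N. Re (c k) * cosk L k v + (- Im (c k)) * sink L k v)"
      unfolding c cosk_def sink_def by (simp add: Re_exp Im_exp cis_conv_exp[symmetric])
    finally show ?thesis .
  qed
  then show ?thesis by (rule trig_polyI)
qed

text \<open>Since \<open>modes N\<close> is symmetric, taking the real part amounts to replacing
  \<open>c k\<close> by the mean of \<open>c k\<close> and the conjugate of \<open>c (- k)\<close>.
  The argument never looks at the coefficients, so \<open>proj\<close> yields a trigonometric
  polynomial for every g whatsoever.\<close>

lemma proj_in_PN: "in_PN L N (proj L N g)"
proof -
  define e where "e k v = exp (\<i> * complex_of_real (pi / L * kdot k v))" for k :: "int^'a" and v
  define c where "c = fcoef L g"
  have e: "cnj (e k v) = e (- k) v" for k v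
    by (simp add: e_def exp_cnj kdot_uminus)
  have "complex_of_real (proj L N g v) = (\<Sum>k\<in>modes N. (c k + cnj (c (- k))) / 2 * e k v)" for v
  proof -
    have 1: "cnj (\<Sum>k\<in>modes N. c k * e k v) = (\<Sum>k\<in>modes N. cnj (c (- k)) * e k v)"
      by (simp add: e, rule sum.reindex_bij_witness[of _ uminus uminus]) (auto simp: uminus_modes)
    have "complex_of_real (proj L N g v) = ((\<Sum>k\<in>modes N. c k * e k v) + cnj (\<Sum>k\<in>modes N. c k * e k v)) / 2"
      unfolding proj_def c_def[symmetric] e_def[symmetric] by (simp only: complex_add_cnj) simp
    then show ?thesis unfolding 1 by (simp add: sum.distrib[symmetric] sum_divide_distrib algebra_simps add_divide_distrib)
  qed
  then show ?thesis unfolding in_PN_def e_def by (intro exI[of _ "\<lambda>k. (c k + cnj (c (- k))) / 2"]) blast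
qed

lemmas proj_trig_poly = in_PN_imp_trig_poly[OF proj_in_PN]

section \<open>Real Fourier coefficients and orthogonality of the projection\<close>

definition fcos :: "real \<Rightarrow> (real^'n::finite \<Rightarrow> real) \<Rightarrow> int^'n \<Rightarrow> real" where
  "fcos L g k = (\<integral>v. g v * cosk L k v \<partial>MD L) / (2 * L) ^ CARD('n)"

definition fsin :: "real \<Rightarrow> (real^'n::finite \<Rightarrow> real) \<Rightarrow> int^'n \<Rightarrow> real" where
  "fsin L g k = (\<integral>v. g v * sink L k v \<partial>MD L) / (2 * L) ^ CARD('n)"

lemma fcoef_eq:
  fixes g :: "real^'n::finite \<Rightarrow> real"
  assumes "sq_int (MD L) g"
  shows "fcoef L g k = Complex (fcos L g k) (- fsin L g k)"
proof -
  have i: "integrable (MD L) (\<lambda>v. complex_of_real (g v * cosk L k v) - \<i> * complex_of_real (g v * sink L k v))"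
    by (intro Bochner_Integration.integrable_diff integrable_mult_right integrable_of_real sq_int_mult assms sq_int_cosk sq_int_sink)
  have "(LINT v:dom_L L|lborel. complex_of_real (g v) * exp (- (\<i> * complex_of_real (pi / L * kdot k v))))
    = (\<integral>v. complex_of_real (g v) * exp (- (\<i> * complex_of_real (pi / L * kdot k v))) \<partial>MD L)"
    by (simp add: integral_restrict_space set_lebesgue_integral_def)
  also have "\<dots> = (\<integral>v. complex_of_real (g v * cosk L k v) - \<i> * complex_of_real (g v * sink L k v) \<partial>MD L)"
    by (intro Bochner_Integration.integral_cong refl)
       (simp add: cosk_def sink_def complex_eq_iff Re_exp Im_exp)
  also have "\<dots> = complex_of_real (\<integral>v. g v * cosk L k v \<partial>MD L) - \<i> * complex_of_real (\<integral>v. g v * sink L k v \<partial>MD L)"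
    by (subst Bochner_Integration.integral_diff)
       (auto intro!: integrable_mult_right integrable_of_real sq_int_mult assms simp del: of_real_mult)
  finally show ?thesis
    by (simp add: fcoef_def fcos_def fsin_def complex_eq_iff)
qed

lemma proj_eq:
  assumes "sq_int (MD L) g"
  shows "proj L N g v = (\<Sum>k\<in>modes N. fcos L g k * cosk L k v + fsin L g k * sink L k v)"
  by (simp add: proj_def fcoef_eq[OF assms] cosk_def sink_def Re_exp Im_exp)

lemma fcos_diff: "sq_int (MD L) f \<Longrightarrow> sq_int (MD L) g \<Longrightarrow> fcos L (\<lambda>v. f v - g v) k = fcos L f k - fcos L g k"
  by (simp add: fcos_def left_diff_distrib sq_int_mult diff_divide_distrib)

lemma fsin_diff: "sq_int (MD L) f \<Longrightarrow> sq_int (MD L) g \<Longrightarrow> fsin L (\<lambda>v. f v - g v) k = fsin L f k - fsin L g k"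
  by (simp add: fsin_def left_diff_distrib sq_int_mult diff_divide_distrib)

lemma proj_diff:
  "sq_int (MD L) f \<Longrightarrow> sq_int (MD L) g \<Longrightarrow> proj L N (\<lambda>v. f v - g v) v = proj L N f v - proj L N g v"
  by (simp add: proj_eq sq_int_diff fcos_diff fsin_diff sum_subtractf[symmetric] algebra_simps)

lemma proj_divide:
  assumes "sq_int (MD L) f"
  shows "proj L N (\<lambda>v. f v / c) v = proj L N f v / c"
  by (simp add: proj_eq[OF sq_int_divide[OF assms]] proj_eq[OF assms] fcos_def fsin_def sum_divide_distrib add_divide_distrib mult_ac)

lemma fcos_uminus: "fcos L g (- k) = fcos L g k"
  by (simp add: fcos_def)

lemma fsin_uminus: "fsin L g (- k) = - fsin L g k"
  by (simp add: fsin_def)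

lemma integral_proj_cosk:
  fixes g :: "real^'n::finite \<Rightarrow> real"
  assumes L: "L > 0" and g: "sq_int (MD L) g" and l: "l \<in> modes N"
  shows "(\<integral>v. proj L N g v * cosk L l v \<partial>MD L) = (\<integral>v. g v * cosk L l v \<partial>MD L)"
    and "(\<integral>v. proj L N g v * sink L l v \<partial>MD L) = (\<integral>v. g v * sink L l v \<partial>MD L)"
proof -
  define V where "V = (2 * L) ^ CARD('n) / 2"
  have V: "V \<noteq> 0" using L by (simp add: V_def)
  have if_mult: "x * (V * (if P then 1 else 0)) = (if P then x * V else 0)" for x P by simp
  have "(\<integral>v. proj L N g v * cosk L l v \<partial>MD L)
     = (\<integral>v. (\<Sum>k\<in>modes N. fcos L g k * (cosk L k v * cosk L l v) + fsin L g k * (sink L k v * cosk L l v)) \<partial>MD L)"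
    unfolding proj_eq[OF g] by (intro Bochner_Integration.integral_cong refl) (simp only: sum_distrib_right distrib_right mult.assoc)
  also have "\<dots> = (\<Sum>k\<in>modes N. fcos L g k * (V * ((if k = l then 1 else 0) + (if k = - l then 1 else 0))))"
    by (simp add: Bochner_Integration.integral_sum sq_int_mult trig_orthogonality[OF L] V_def)
  \<comment> \<open>The indices l and -l contribute equally because the coefficient is even in k;
    together they restore the full volume 2V of the cube.\<close>
  also have "\<dots> = fcos L g l * V + fcos L g (- l) * V"
    using l uminus_modes[of l N] by (simp add: distrib_left sum.distrib if_mult)
  also have "\<dots> = (\<integral>v. g v * cosk L l v \<partial>MD L)"
    using L by (simp add: fcos_uminus) (simp add: V_def fcos_def)
  finally show "(\<integral>v. proj L N g v * cosk L l v \<partial>MD L) = (\<integral>v. g v * cosk L l v \<partial>MD L)" .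
  have "(\<integral>v. proj L N g v * sink L l v \<partial>MD L)
     = (\<integral>v. (\<Sum>k\<in>modes N. fcos L g k * (cosk L k v * sink L l v) + fsin L g k * (sink L k v * sink L l v)) \<partial>MD L)"
    unfolding proj_eq[OF g] by (intro Bochner_Integration.integral_cong refl) (simp only: sum_distrib_right distrib_right mult.assoc)
  also have "\<dots> = (\<Sum>k\<in>modes N. fsin L g k * (V * ((if k = l then 1 else 0) - (if k = - l then 1 else 0))))"
    by (simp add: Bochner_Integration.integral_sum sq_int_mult trig_orthogonality[OF L] V_def)
  \<comment> \<open>Here the coefficient is odd in k, so the minus sign makes the two contributions
    add up as well.\<close>
  also have "\<dots> = fsin L g l * V - fsin L g (- l) * V"
    using l uminus_modes[of l N] by (simp add: right_diff_distrib sum_subtractf if_mult)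
  also have "\<dots> = (\<integral>v. g v * sink L l v \<partial>MD L)"
    using L by (simp add: fsin_uminus) (simp add: V_def fsin_def)
  finally show "(\<integral>v. proj L N g v * sink L l v \<partial>MD L) = (\<integral>v. g v * sink L l v \<partial>MD L)" .
qed

lemma proj_sq_int [simp]: "sq_int (MD L) (proj L N g)"
  by (rule trig_poly_sq_int[OF proj_trig_poly])

text \<open>This says that \<open>g - proj L N g\<close> is orthogonal to all trigonometric
  polynomials of degree N; Pythagoras, contraction and best approximation all come from it.\<close>

lemma integral_proj_trig_poly:
  assumes L: "L > 0" and g: "sq_int (MD L) g" and p: "trig_poly L N p"
  shows "(\<integral>v. proj L N g v * p v \<partial>MD L) = (\<integral>v. g v * p v \<partial>MD L)"
proof -
  obtain a b where p: "p = (\<lambda>v. \<Sum>k\<in>modes N. a k * cosk L k v + b k * sink L k v)"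
    using p by (auto simp: trig_poly_def)
  have "(\<integral>v. h v * p v \<partial>MD L) = (\<Sum>k\<in>modes N. a k * (\<integral>v. h v * cosk L k v \<partial>MD L) + b k * (\<integral>v. h v * sink L k v \<partial>MD L))"
    if h: "sq_int (MD L) h" for h
  proof -
    have "(\<integral>v. h v * p v \<partial>MD L) = (\<integral>v. (\<Sum>k\<in>modes N. a k * (h v * cosk L k v) + b k * (h v * sink L k v)) \<partial>MD L)"
      unfolding p by (intro Bochner_Integration.integral_cong refl) (simp add: sum_distrib_left algebra_simps)
    then show ?thesis by (simp add: Bochner_Integration.integral_sum sq_int_mult h)
  qed
  then show ?thesis using g integral_proj_cosk[OF L g] by simp
qed

lemma proj_pythagoras:
  assumes L: "L > 0" and g: "sq_int (MD L) g" and p: "trig_poly L N p"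
  shows "(norm2 (MD L) (\<lambda>v. g v - p v))\<^sup>2
    = (norm2 (MD L) (\<lambda>v. g v - proj L N g v))\<^sup>2 + (norm2 (MD L) (\<lambda>v. proj L N g v - p v))\<^sup>2"
proof -
  have q: "trig_poly L N (\<lambda>v. proj L N g v - p v)" by (intro trig_poly_diff proj_trig_poly p)
  note s = proj_sq_int[of L N g] trig_poly_sq_int[OF q]
  have "(\<integral>v. (g v - proj L N g v) * (proj L N g v - p v) \<partial>MD L)
     = (\<integral>v. g v * (proj L N g v - p v) \<partial>MD L) - (\<integral>v. proj L N g v * (proj L N g v - p v) \<partial>MD L)"
    by (subst left_diff_distrib) (intro Bochner_Integration.integral_diff sq_int_mult g s)
  then have "(\<integral>v. (g v - proj L N g v) * (proj L N g v - p v) \<partial>MD L) = 0"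
    using integral_proj_trig_poly[OF L g q] by simp
  then show ?thesis
    using norm2_add_sq[OF sq_int_diff[OF g s(1)] s(2)] by simp
qed

lemma trig_poly_zero: "trig_poly L N (\<lambda>v. 0)"
  unfolding trig_poly_def by (intro exI[of _ "\<lambda>_. 0"]) simp

lemma norm2_proj_sq:
  assumes L: "L > 0" and g: "sq_int (MD L) g"
  shows "(norm2 (MD L) g)\<^sup>2 = (norm2 (MD L) (\<lambda>v. g v - proj L N g v))\<^sup>2 + (norm2 (MD L) (proj L N g))\<^sup>2"
  using proj_pythagoras[OF L g trig_poly_zero[of L N]] by simp

lemma norm2_proj_le:
  assumes L: "L > 0" and g: "sq_int (MD L) g"
  shows "norm2 (MD L) (proj L N g) \<le> norm2 (MD L) g"
  by (rule power2_le_imp_le) (use norm2_proj_sq[OF assms, of N] in auto)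

lemma proj_best_approximation:
  assumes L: "L > 0" and g: "sq_int (MD L) g" and p: "trig_poly L N p"
  shows "norm2 (MD L) (\<lambda>v. g v - proj L N g v) \<le> norm2 (MD L) (\<lambda>v. g v - p v)"
  by (rule power2_le_imp_le) (use proj_pythagoras[OF assms] in auto)

text \<open>Parseval's identity for finitely many modes. Orthogonality turns the squared norm into
  the integral of \<open>g\<close> times its projection, so that no double sum over modes
  arises.\<close>

lemma norm2_proj_eq_coeffs:
  fixes g :: "real^'n::finite \<Rightarrow> real"
  assumes L: "L > 0" and g: "sq_int (MD L) g"
  shows "(norm2 (MD L) (proj L N g))\<^sup>2 = (2 * L) ^ CARD('n) * (\<Sum>k\<in>modes N. (fcos L g k)\<^sup>2 + (fsin L g k)\<^sup>2)"
proof -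
  have "(norm2 (MD L) (proj L N g))\<^sup>2 = (\<integral>v. proj L N g v * proj L N g v \<partial>MD L)"
    unfolding norm2_sq by (simp add: power2_eq_square)
  also have "\<dots> = (\<integral>v. g v * proj L N g v \<partial>MD L)"
    by (rule integral_proj_trig_poly[OF L g proj_trig_poly])
  also have "\<dots> = (\<integral>v. (\<Sum>k\<in>modes N. fcos L g k * (g v * cosk L k v) + fsin L g k * (g v * sink L k v)) \<partial>MD L)"
    by (intro Bochner_Integration.integral_cong refl) (simp add: proj_eq[OF g] sum_distrib_left algebra_simps)
  also have "\<dots> = (\<Sum>k\<in>modes N. fcos L g k * (\<integral>v. g v * cosk L k v \<partial>MD L) + fsin L g k * (\<integral>v. g v * sink L k v \<partial>MD L))"
    by (simp add: Bochner_Integration.integral_sum sq_int_mult g)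
  also have "\<dots> = (2 * L) ^ CARD('n) * (\<Sum>k\<in>modes N. (fcos L g k)\<^sup>2 + (fsin L g k)\<^sup>2)"
  proof -
    define W where "W = (2 * L) ^ CARD('n)"
    have "W \<noteq> 0" using L by (simp add: W_def)
    then have "x / W * x + y / W * y = W * ((x / W)\<^sup>2 + (y / W)\<^sup>2)" for x y
      by (simp add: power2_eq_square field_simps)
    then show ?thesis unfolding fcos_def fsin_def W_def[symmetric] by (simp only: sum_distrib_left)
  qed
  finally show ?thesis .
qed

text \<open>Stated pointwise, not merely in norm, because \<open>spectral_sol\<close> prescribes the
  initial value as a function.\<close>

lemma proj_of_trig_poly:
  fixes p :: "real^'n::finite \<Rightarrow> real"
  assumes L: "L > 0" and p: "trig_poly L N p"
  shows "proj L N p v = p v"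
proof -
  have if_mult: "(if P then 1 else 0) * x = (if P then x else 0)" for x :: real and P by simp
  \<comment> \<open>Each of k = l and k = -l carries half of the mode; for l = 0 both indicators
    fire at the same index and give the whole.\<close>
  have fc: "fcos L (cosk L l) k = ((if k = l then 1 else 0) + (if k = - l then 1 else 0)) / 2"
    "fsin L (cosk L l) k = 0" "fcos L (sink L l) k = 0"
    "fsin L (sink L l) k = ((if k = l then 1 else 0) - (if k = - l then 1 else 0)) / 2" for k l :: "int^'n"
    using L trig_orthogonality[OF L, of l k] by (auto simp: fcos_def fsin_def)
  have pc: "proj L N (cosk L l) v = cosk L l v" "proj L N (sink L l) v = sink L l v" if l: "l \<in> modes N" for l
  proof -
    have "proj L N (cosk L l) v = (\<Sum>k\<in>modes N. (if k = l then 1 else 0) * (cosk L k v / 2) + (if k = - l then 1 else 0) * (cosk L k v / 2))"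
      unfolding proj_eq[OF sq_int_cosk] fc by (intro sum.cong refl) (simp add: field_simps)
    then show "proj L N (cosk L l) v = cosk L l v"
      using l uminus_modes[of l N] by (simp add: sum.distrib if_mult sum_divide_distrib[symmetric])
    have "proj L N (sink L l) v = (\<Sum>k\<in>modes N. (if k = l then 1 else 0) * (sink L k v / 2) - (if k = - l then 1 else 0) * (sink L k v / 2))"
      unfolding proj_eq[OF sq_int_sink] fc by (intro sum.cong refl) (simp add: field_simps)
    then show "proj L N (sink L l) v = sink L l v"
      using l uminus_modes[of l N] by (simp add: sum_subtractf if_mult sum_divide_distrib[symmetric])
  qed
  obtain a b where p': "p = (\<lambda>v. \<Sum>l\<in>modes N. a l * cosk L l v + b l * sink L l v)"
    using p by (auto simp: trig_poly_def)
  have lin: "(\<integral>w. p w * h w \<partial>MD L) = (\<Sum>l\<in>modes N. a l * (\<integral>w. cosk L l w * h w \<partial>MD L) + b l * (\<integral>w. sink L l w * h w \<partial>MD L))"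
    if h: "sq_int (MD L) h" for h
  proof -
    have "(\<integral>w. p w * h w \<partial>MD L) = (\<integral>w. (\<Sum>l\<in>modes N. a l * (cosk L l w * h w) + b l * (sink L l w * h w)) \<partial>MD L)"
      unfolding p' by (intro Bochner_Integration.integral_cong refl) (simp only: sum_distrib_right distrib_right mult.assoc)
    then show ?thesis by (simp add: Bochner_Integration.integral_sum sq_int_mult h)
  qed
  have fp: "fcos L p k = (\<Sum>l\<in>modes N. a l * fcos L (cosk L l) k + b l * fcos L (sink L l) k)"
    "fsin L p k = (\<Sum>l\<in>modes N. a l * fsin L (cosk L l) k + b l * fsin L (sink L l) k)" for k
    by (simp_all add: fcos_def fsin_def lin sum_divide_distrib add_divide_distrib)
  have "proj L N p v = (\<Sum>k\<in>modes N. \<Sum>l\<in>modes N.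
      a l * (fcos L (cosk L l) k * cosk L k v + fsin L (cosk L l) k * sink L k v)
    + b l * (fcos L (sink L l) k * cosk L k v + fsin L (sink L l) k * sink L k v))"
    unfolding proj_eq[OF trig_poly_sq_int[OF p]] fp
    by (intro sum.cong refl) (simp only: sum_distrib_right sum.distrib[symmetric], intro sum.cong refl, simp add: algebra_simps)
  also have "\<dots> = (\<Sum>l\<in>modes N. \<Sum>k\<in>modes N.
      a l * (fcos L (cosk L l) k * cosk L k v + fsin L (cosk L l) k * sink L k v)
    + b l * (fcos L (sink L l) k * cosk L k v + fsin L (sink L l) k * sink L k v))"
    by (rule sum.swap)
  also have "\<dots> = (\<Sum>l\<in>modes N. a l * proj L N (cosk L l) v + b l * proj L N (sink L l) v)"
    by (simp only: proj_eq[OF sq_int_cosk] proj_eq[OF sq_int_sink] sum_distrib_left sum.distrib distrib_left)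
  also have "\<dots> = p v" by (simp add: p' pc cong: sum.cong)
  finally show ?thesis .
qed

text \<open>From L2 to the sup norm, with a constant depending on N and L but not on g or v. It
  makes the Galerkin vector field Lipschitz on bounded continuous functions.\<close>

lemma proj_sup_bound:
  obtains c where "0 \<le> c" "\<And>g v. sq_int (MD L) g \<Longrightarrow> \<bar>proj L N g v\<bar> \<le> c * norm2 (MD L) (g :: real^'n::finite \<Rightarrow> real)"
proof
  define c where "c = (\<Sum>k\<in>modes N. norm2 (MD L) (cosk L (k :: int^'n)) / \<bar>(2 * L) ^ CARD('n)\<bar> + norm2 (MD L) (sink L k) / \<bar>(2 * L) ^ CARD('n)\<bar>)"
  show "0 \<le> c" unfolding c_def by (intro sum_nonneg add_nonneg_nonneg divide_nonneg_nonneg) auto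
  fix g :: "real^'n \<Rightarrow> real" and v assume g: "sq_int (MD L) g"
  have 1: "\<bar>fcos L g k * cosk L k v\<bar> \<le> norm2 (MD L) g * (norm2 (MD L) (cosk L k) / \<bar>(2 * L) ^ CARD('n)\<bar>)" for k
  proof -
    have "\<bar>fcos L g k\<bar> \<le> norm2 (MD L) g * norm2 (MD L) (cosk L k) / \<bar>(2 * L) ^ CARD('n)\<bar>"
      unfolding fcos_def abs_divide by (intro divide_right_mono norm2_Cauchy_Schwarz g sq_int_cosk) simp
    moreover have "\<bar>cosk L k v\<bar> \<le> 1" by (simp add: cosk_def)
    ultimately show ?thesis
      unfolding abs_mult using mult_mono[of "\<bar>fcos L g k\<bar>" _ "\<bar>cosk L k v\<bar>" 1] by fastforce
  qed
  have 2: "\<bar>fsin L g k * sink L k v\<bar> \<le> norm2 (MD L) g * (norm2 (MD L) (sink L k) / \<bar>(2 * L) ^ CARD('n)\<bar>)" for k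
  proof -
    have "\<bar>fsin L g k\<bar> \<le> norm2 (MD L) g * norm2 (MD L) (sink L k) / \<bar>(2 * L) ^ CARD('n)\<bar>"
      unfolding fsin_def abs_divide by (intro divide_right_mono norm2_Cauchy_Schwarz g sq_int_sink) simp
    moreover have "\<bar>sink L k v\<bar> \<le> 1" by (simp add: sink_def)
    ultimately show ?thesis
      unfolding abs_mult using mult_mono[of "\<bar>fsin L g k\<bar>" _ "\<bar>sink L k v\<bar>" 1] by fastforce
  qed
  have "\<bar>proj L N g v\<bar> \<le> (\<Sum>k\<in>modes N. \<bar>fcos L g k * cosk L k v\<bar> + \<bar>fsin L g k * sink L k v\<bar>)"
    unfolding proj_eq[OF g] by (rule order_trans[OF sum_abs]) (intro sum_mono abs_triangle_ineq)
  also have "\<dots> \<le> (\<Sum>k\<in>modes N. norm2 (MD L) g * (norm2 (MD L) (cosk L (k :: int^'n)) / \<bar>(2 * L) ^ CARD('n)\<bar>) + norm2 (MD L) g * (norm2 (MD L) (sink L k) / \<bar>(2 * L) ^ CARD('n)\<bar>))"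
    by (intro sum_mono add_mono 1 2)
  also have "\<dots> = c * norm2 (MD L) g"
    unfolding c_def by (simp only: mult.commute[of _ "norm2 (MD L) g"] sum_distrib_left distrib_left)
  finally show "\<bar>proj L N g v\<bar> \<le> c * norm2 (MD L) g" .
qed

subsection \<open>Density of trigonometric polynomials\<close>

lemma trig_poly_sum: "(\<And>i. i \<in> I \<Longrightarrow> trig_poly L N (f i)) \<Longrightarrow> trig_poly L N (\<lambda>v. \<Sum>i\<in>I. f i v)"
  by (induction I rule: infinite_finite_induct) (simp_all add: trig_poly_zero trig_poly_add)

lemma trig_poly_cosk: "k \<in> modes N \<Longrightarrow> trig_poly L N (cosk L k)"
  by (rule trig_polyI[where a = "\<lambda>l. if l = k then 1 else 0" and b = "\<lambda>l. 0"])
     (simp add: if_distrib[of "\<lambda>x. x * _"] cong: if_cong)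

lemma trig_poly_sink: "k \<in> modes N \<Longrightarrow> trig_poly L N (sink L k)"
  by (rule trig_polyI[where b = "\<lambda>l. if l = k then 1 else 0" and a = "\<lambda>l. 0"])
     (simp add: if_distrib[of "\<lambda>x. x * _"] cong: if_cong)

lemma modes_add:
  assumes "k \<in> modes M" "l \<in> modes N"
  shows "k + l \<in> modes (M + N)" "k - l \<in> modes (M + N)"
proof -
  have "\<bar>x + y\<bar> \<le> real (M + N) / 2 \<and> \<bar>x - y\<bar> \<le> real (M + N) / 2" if "\<bar>x\<bar> \<le> real M / 2" "\<bar>y\<bar> \<le> real N / 2" for x y :: real
    using that by (auto simp: abs_le_iff add_divide_distrib)
  then show "k + l \<in> modes (M + N)" "k - l \<in> modes (M + N)" using assms by (auto simp: mem_modes)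
qed

text \<open>Product-to-sum formulas. Closure under products is what makes polynomials in cosines and
  sines of the coordinates trigonometric polynomials.\<close>

lemma trig_poly_mult:
  assumes "trig_poly L M p" "trig_poly L N q"
  shows "trig_poly L (M + N) (\<lambda>v. p v * q v)"
proof -
  obtain a b where p: "p = (\<lambda>v. \<Sum>k\<in>modes M. a k * cosk L k v + b k * sink L k v)"
    using assms by (auto simp: trig_poly_def)
  obtain a' b' where q: "q = (\<lambda>v. \<Sum>l\<in>modes N. a' l * cosk L l v + b' l * sink L l v)"
    using assms by (auto simp: trig_poly_def)
  have "trig_poly L (M + N) (\<lambda>v. (a k * cosk L k v + b k * sink L k v) * (a' l * cosk L l v + b' l * sink L l v))"
    if k: "k \<in> modes M" and l: "l \<in> modes N" for k l
  proof -
    have "(a k * cosk L k v + b k * sink L k v) * (a' l * cosk L l v + b' l * sink L l v)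
      = ((a k * a' l - b k * b' l) / 2) * cosk L (k + l) v + ((a k * a' l + b k * b' l) / 2) * cosk L (k - l) v
      + ((a k * b' l + b k * a' l) / 2) * sink L (k + l) v + ((b k * a' l - a k * b' l) / 2) * sink L (k - l) v" for v
      by (simp add: cosk_def sink_def kdot_plus kdot_minus distrib_left right_diff_distrib cos_add cos_diff sin_add sin_diff)
         (simp add: field_simps)
    then show ?thesis
      by (simp only:) (intro trig_poly_add trig_poly_cmult trig_poly_cosk trig_poly_sink modes_add k l)
  qed
  then have "trig_poly L (M + N) (\<lambda>v. \<Sum>k\<in>modes M. \<Sum>l\<in>modes N. (a k * cosk L k v + b k * sink L k v) * (a' l * cosk L l v + b' l * sink L l v))"
    by (intro trig_poly_sum)
  then show ?thesis unfolding p q sum_product .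
qed

text \<open>The period torus inside a Euclidean space. Pulled back along this map, polynomials
  become trigonometric polynomials, so the polynomial form of the Stone-Weierstrass theorem gives
  density.\<close>

definition torus_emb :: "real \<Rightarrow> real^'n::finite \<Rightarrow> (real^'n) \<times> (real^'n)" where
  "torus_emb L v = ((\<chi> j. cos (pi / L * v $ j)), (\<chi> j. sin (pi / L * v $ j)))"

lemma continuous_on_torus_emb: "continuous_on S (torus_emb L)"
  unfolding torus_emb_def by (intro continuous_intros)

lemma trig_poly_const: "trig_poly L N (\<lambda>v. c)"
proof -
  have "trig_poly L N (\<lambda>v. c * cosk L 0 v)" by (intro trig_poly_cmult trig_poly_cosk) (simp add: mem_modes)
  then show ?thesis by (simp add: cosk_def)
qed

lemma trig_poly_coordinate:
  "trig_poly L 2 (\<lambda>v. cos (pi / L * v $ j))" "trig_poly L 2 (\<lambda>v. sin (pi / L * v $ j))"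
proof -
  have "real_of_int (axis j 1 $ i) * v $ i = (if i = j then v $ i else 0)" for v :: "real^'a" and i
    by (simp add: axis_def)
  then have k: "kdot (axis j 1) v = v $ j" for v by (simp add: kdot_def)
  \<comment> \<open>Frequencies in \<open>modes N\<close> are at most N/2, so the first harmonic
    needs N = 2.\<close>
  have m: "axis j (1::int) \<in> modes 2" by (auto simp: mem_modes axis_def)
  show "trig_poly L 2 (\<lambda>v. cos (pi / L * v $ j))" "trig_poly L 2 (\<lambda>v. sin (pi / L * v $ j))"
    using trig_poly_cosk[OF m, of L] trig_poly_sink[OF m, of L] unfolding cosk_def[abs_def] sink_def[abs_def] k .
qed

lemma trig_poly_polynomial_torus:
  fixes h :: "(real^'n::finite) \<times> (real^'n) \<Rightarrow> real"
  assumes "real_polynomial_function h"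
  shows "\<exists>N. trig_poly L N (\<lambda>v. h (torus_emb L v))"
  using assms
proof induction
  case (linear f)
  have "f (torus_emb L v) = (\<Sum>i\<in>Basis. f i * (torus_emb L v \<bullet> i))" for v
  proof -
    have "f (torus_emb L v) = f (\<Sum>i\<in>Basis. (torus_emb L v \<bullet> i) *\<^sub>R i)" by (simp add: euclidean_representation)
    also have "\<dots> = (\<Sum>i\<in>Basis. f i * (torus_emb L v \<bullet> i))"
      by (simp add: linear_sum[OF bounded_linear.linear[OF linear]] linear_cmul[OF bounded_linear.linear[OF linear]] mult.commute)
    finally show ?thesis .
  qed
  moreover have "trig_poly L 2 (\<lambda>v. torus_emb L v \<bullet> i)" if i: "i \<in> Basis" for i :: "(real^'n) \<times> (real^'n)"
  proof -
    from i obtain j where "i = (axis j 1, 0) \<or> i = (0, axis j 1)"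
      by (auto simp: Basis_prod_def Basis_vec_def)
    then show ?thesis
      using trig_poly_coordinate[of L j] by (auto simp: torus_emb_def inner_axis)
  qed
  ultimately have "trig_poly L 2 (\<lambda>v. f (torus_emb L v))"
    by (simp only:) (intro trig_poly_sum trig_poly_cmult)
  then show ?case by blast
next
  case (const c)
  show ?case using trig_poly_const by blast
next
  case (add f g)
  then obtain M N where "trig_poly L M (\<lambda>v. f (torus_emb L v))" "trig_poly L N (\<lambda>v. g (torus_emb L v))" by blast
  then have "trig_poly L (M + N) (\<lambda>v. f (torus_emb L v) + g (torus_emb L v))"
    by (intro trig_poly_add) (auto elim: trig_poly_mono)
  then show ?case by blast
next
  case (mult f g)
  then show ?case using trig_poly_mult by blast
qed

text \<open>The L2 closure of the trigonometric polynomials; density is shown by enlarging the class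
  of its known members step by step.\<close>

definition trig_approx :: "real \<Rightarrow> (real^'n::finite \<Rightarrow> real) \<Rightarrow> bool" where
  "trig_approx L g \<longleftrightarrow> sq_int (MD L) g \<and> (\<forall>e>0. \<exists>N p. trig_poly L N p \<and> norm2 (MD L) (\<lambda>v. g v - p v) < e)"

lemma trig_approx_limit:
  assumes g: "sq_int (MD L) g" and s: "\<And>i::nat. trig_approx L (s i)" and lim: "(\<lambda>i. norm2 (MD L) (\<lambda>v. g v - s i v)) \<longlonglongrightarrow> 0"
  shows "trig_approx L g"
  unfolding trig_approx_def
proof (intro conjI g allI impI)
  fix e :: real assume "e > 0"
  then have "eventually (\<lambda>i. norm2 (MD L) (\<lambda>v. g v - s i v) < e / 2) sequentially"
    using order_tendstoD(2)[OF lim, of "e / 2"] by simp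
  then obtain i where i: "norm2 (MD L) (\<lambda>v. g v - s i v) < e / 2"
    by (auto simp: eventually_sequentially)
  have si: "sq_int (MD L) (s i)" using s by (auto simp: trig_approx_def)
  obtain N p where p: "trig_poly L N p" "norm2 (MD L) (\<lambda>v. s i v - p v) < e / 2"
    using s[of i] \<open>e > 0\<close> unfolding trig_approx_def by (meson half_gt_zero)
  have "norm2 (MD L) (\<lambda>v. g v - p v) < e"
    using norm2_triangle3[OF g si trig_poly_sq_int[OF p(1)]] i p(2) by simp
  then show "\<exists>N p. trig_poly L N p \<and> norm2 (MD L) (\<lambda>v. g v - p v) < e" using p(1) by blast
qed

lemma trig_approx_add:
  assumes "trig_approx L f" "trig_approx L g"
  shows "trig_approx L (\<lambda>v. f v + g v)"
  unfolding trig_approx_def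
proof (intro conjI allI impI)
  have f: "sq_int (MD L) f" and g: "sq_int (MD L) g" using assms by (auto simp: trig_approx_def)
  then show "sq_int (MD L) (\<lambda>v. f v + g v)" by (rule sq_int_add)
  fix e :: real assume "e > 0"
  then obtain M p N q where p: "trig_poly L M p" "norm2 (MD L) (\<lambda>v. f v - p v) < e / 2"
     and q: "trig_poly L N q" "norm2 (MD L) (\<lambda>v. g v - q v) < e / 2"
    using assms unfolding trig_approx_def by (meson half_gt_zero)
  have "trig_poly L (M + N) (\<lambda>v. p v + q v)"
    using p q by (intro trig_poly_add) (auto elim: trig_poly_mono)
  moreover have "norm2 (MD L) (\<lambda>v. (f v + g v) - (p v + q v)) < e"
    using norm2_triangle[OF sq_int_diff[OF f trig_poly_sq_int[OF p(1)]] sq_int_diff[OF g trig_poly_sq_int[OF q(1)]]] p(2) q(2)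
    by (simp add: algebra_simps)
  ultimately show "\<exists>N p. trig_poly L N p \<and> norm2 (MD L) (\<lambda>v. f v + g v - p v) < e" by blast
qed

lemma trig_approx_cmult:
  assumes "trig_approx L f"
  shows "trig_approx L (\<lambda>v. c * f v)"
  unfolding trig_approx_def
proof (intro conjI allI impI)
  show "sq_int (MD L) (\<lambda>v. c * f v)" using assms by (auto simp: trig_approx_def intro: sq_int_cmult)
  fix e :: real assume e: "e > 0"
  then have "e / (\<bar>c\<bar> + 1) > 0" by simp
  then obtain N p where p: "trig_poly L N p" "norm2 (MD L) (\<lambda>v. f v - p v) < e / (\<bar>c\<bar> + 1)"
    using assms unfolding trig_approx_def by meson
  have "norm2 (MD L) (\<lambda>v. c * f v - c * p v) = \<bar>c\<bar> * norm2 (MD L) (\<lambda>v. f v - p v)"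
    using norm2_cmult[of "MD L" c "\<lambda>v. f v - p v"] by (simp add: right_diff_distrib)
  also have "\<dots> \<le> \<bar>c\<bar> * (e / (\<bar>c\<bar> + 1))" using p(2) by (intro mult_left_mono) auto
  also have "\<dots> < e" using e by (simp add: field_simps)
  finally show "\<exists>N p. trig_poly L N p \<and> norm2 (MD L) (\<lambda>v. c * f v - p v) < e"
    using trig_poly_cmult[OF p(1), of c] by blast
qed

lemma trig_approx_continuous_torus:
  fixes h :: "(real^'n::finite) \<times> (real^'n) \<Rightarrow> real"
  assumes h: "continuous_on UNIV h"
  shows "trig_approx L (\<lambda>v. h (torus_emb L v))"
proof -
  have cont: "continuous_on S (\<lambda>v. h (torus_emb L v))" for S
    by (rule continuous_on_compose2[OF h continuous_on_torus_emb]) simp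
  have c: "compact (dom_L L :: (real^'n) set)" by (simp add: dom_L_def compact_cbox)
  have "bounded ((\<lambda>v. h (torus_emb L v)) ` dom_L L)"
    by (intro compact_imp_bounded compact_continuous_image cont c)
  then obtain B where B: "\<And>v. v \<in> dom_L L \<Longrightarrow> \<bar>h (torus_emb L v)\<bar> \<le> B" unfolding bounded_iff by auto
  have hb: "(\<lambda>v. h (torus_emb L v)) \<in> borel_measurable (MD L)"
    by (intro borel_measurable_MD borel_measurable_continuous_onI cont)
  show ?thesis unfolding trig_approx_def
  proof (intro conjI allI impI)
    show "sq_int (MD L) (\<lambda>v. h (torus_emb L v))"
      by (rule MD.sq_int_bounded[OF hb, of B]) (simp add: space_MD B)
    fix e :: real assume e: "e > 0"
    define m where "m = sqrt (measure (MD L :: (real^'n) measure) (space (MD L)))"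
    have m: "m \<ge> 0" by (simp add: m_def)
    have "compact (torus_emb L ` (dom_L L :: (real^'n) set))"
      by (intro compact_continuous_image continuous_on_torus_emb c)
    \<comment> \<open>A uniform error e/(m+1) over the cube yields an L2 error below e; the added 1
      keeps the quotient meaningful when m = 0.\<close>
    then obtain q where q: "real_polynomial_function q" "\<And>x. x \<in> torus_emb L ` dom_L L \<Longrightarrow> \<bar>h x - q x\<bar> < e / (m + 1)"
      using Stone_Weierstrass_real_polynomial_function[of "torus_emb L ` dom_L L" h "e / (m + 1)"]
        continuous_on_subset[OF h] e m by auto
    obtain N where N: "trig_poly L N (\<lambda>v. q (torus_emb L v))" using trig_poly_polynomial_torus[OF q(1)] by blast
    have "norm2 (MD L) (\<lambda>v. h (torus_emb L v) - q (torus_emb L v)) \<le> e / (m + 1) * m"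
      unfolding m_def
    proof (rule MD.sq_int_bounded)
      show "(\<lambda>v. h (torus_emb L v) - q (torus_emb L v)) \<in> borel_measurable (MD L)"
        using hb sq_int_measurable[OF trig_poly_sq_int[OF N]] by simp
      show "\<bar>h (torus_emb L x) - q (torus_emb L x)\<bar> \<le> e / (sqrt (measure (MD L :: (real^'n) measure) (space (MD L))) + 1)"
        if "x \<in> space (MD L)" for x
        using that q(2)[of "torus_emb L x"] by (simp add: space_MD m_def less_imp_le)
    qed
    also have "\<dots> < e" using e m by (simp add: field_simps)
    finally show "\<exists>N p. trig_poly L N p \<and> norm2 (MD L) (\<lambda>v. h (torus_emb L v) - p v) < e" using N by blast
  qed
qed

lemma torus_emb_inj:
  assumes L: "L > 0" and v: "v \<in> open_cube L" "w \<in> open_cube L" and eq: "torus_emb L v = torus_emb L w"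
  shows "v = w"
proof -
  have "v $ j = w $ j" for j
  proof -
    have "cos (pi / L * v $ j) = cos (pi / L * w $ j)" "sin (pi / L * v $ j) = sin (pi / L * w $ j)"
      using eq by (auto simp: torus_emb_def vec_eq_iff)
    then obtain n :: int where n: "pi / L * v $ j = pi / L * w $ j + 2 * pi * n"
      using sin_cos_eq_iff[of "pi / L * v $ j" "pi / L * w $ j"] by auto
    then have "pi * (v $ j - w $ j) = pi * (2 * L * n)" using L by (simp add: field_simps)
    then have e: "v $ j - w $ j = 2 * L * n" by simp
    have "\<bar>v $ j\<bar> < L" "\<bar>w $ j\<bar> < L" using v by (simp_all add: mem_open_cube)
    then have "\<bar>v $ j - w $ j\<bar> < 2 * L" by linarith
    then have "\<bar>real_of_int n\<bar> < 1" unfolding e using L by (simp add: abs_mult)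
    then have "n = 0" by linarith
    then show ?thesis using e by simp
  qed
  then show ?thesis by (simp add: vec_eq_iff)
qed

lemma sq_int_indicator [simp]: "A \<in> sets borel \<Longrightarrow> sq_int (MD L) (indicator A :: (real^'n) \<Rightarrow> real)"
  by (rule MD.sq_int_bounded[of _ _ 1]) (auto simp: indicator_def intro!: borel_measurable_MD)

text \<open>Continuous cut-offs of the distance to the image of K, taken in the ambient Euclidean
  space, converge to the indicator of that image. As the embedding is injective on the open cube,
  the pullbacks converge to the indicator of K almost everywhere.\<close>

lemma trig_approx_indicator_compact:
  fixes K :: "(real^'n::finite) set"
  assumes L: "L > 0" and K: "compact K" "K \<subseteq> open_cube L"
  shows "trig_approx L (indicator K)"
proof (cases "K = {}")
  case True
  then show ?thesis using trig_approx_continuous_torus[of "\<lambda>_. 0" L] by (simp add: indicator_def[abs_def])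
next
  case False
  define C where "C = torus_emb L ` K"
  have C: "compact C" "C \<noteq> {}" using False K unfolding C_def
    by (auto intro!: compact_continuous_image continuous_on_torus_emb)
  define h where "h m z = max 0 (1 - real m * infdist z C)" for m :: nat and z
  have hc: "continuous_on UNIV (h m)" for m unfolding h_def by (intro continuous_intros)
  have h01: "0 \<le> h m z" "h m z \<le> 1" for m z by (auto simp: h_def infdist_nonneg)
  have Kb: "K \<in> sets borel" using K by (simp add: borel_compact)
  have app: "trig_approx L (\<lambda>v. h m (torus_emb L v))" for m by (rule trig_approx_continuous_torus[OF hc])
  show ?thesis
  proof (rule trig_approx_limit[where s = "\<lambda>m v. h m (torus_emb L v)"])
    show "(\<lambda>m. norm2 (MD L) (\<lambda>v. indicator K v - h m (torus_emb L v))) \<longlonglongrightarrow> 0"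
    proof (rule MD.tendsto_norm2_dominated[where w = "\<lambda>v. 1"])
      show "(\<lambda>v. h m (torus_emb L v)) \<in> borel_measurable (MD L)" for m
        using app[of m] by (simp add: trig_approx_def sq_int_def)
      show "sq_int (MD L) (\<lambda>v::real^'n. 1)" by (rule MD.sq_int_bounded[of _ _ 1]) auto
      show "AE v in MD L. (\<lambda>m. h m (torus_emb L v)) \<longlonglongrightarrow> indicator K v"
        using AE_open_cube
      proof eventually_elim
        case (elim v)
        show ?case
        proof (cases "v \<in> K")
          case True
          then have "torus_emb L v \<in> C" by (auto simp: C_def)
          then show ?thesis using True by (simp add: h_def)
        next
          case False
          have "torus_emb L v \<notin> C"
            using torus_emb_inj[OF L elim] K(2) False by (auto simp: C_def)
          then have d: "infdist (torus_emb L v) C > 0"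
            using C by (metis compact_imp_closed in_closed_iff_infdist_zero infdist_nonneg less_eq_real_def)
          obtain m0 :: nat where m0: "real m0 * infdist (torus_emb L v) C \<ge> 1"
            using ex_less_of_nat_mult[OF d, of 1] by (auto intro: less_imp_le)
          have "h m (torus_emb L v) = 0" if "m \<ge> m0" for m
          proof -
            have "real m0 * infdist (torus_emb L v) C \<le> real m * infdist (torus_emb L v) C"
              using that d by (intro mult_right_mono) auto
            then show ?thesis using m0 by (simp add: h_def)
          qed
          then have "eventually (\<lambda>m. h m (torus_emb L v) = 0) sequentially"
            by (auto simp: eventually_sequentially)
          then show ?thesis using False by (simp add: tendsto_eventually)
        qed
      qed
      show "AE v in MD L. \<bar>h m (torus_emb L v)\<bar> \<le> 1" for m using h01 by simp
    qed (simp add: Kb)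
  qed (use app Kb in auto)
qed

lemma trig_approx_incseq:
  fixes A :: "nat \<Rightarrow> (real^'n::finite) set"
  assumes A: "\<And>i. A i \<in> sets borel" "incseq A" and app: "\<And>i. trig_approx L (indicator (A i))"
  shows "trig_approx L (indicator (\<Union>i. A i))"
proof (rule trig_approx_limit[OF _ app])
  show "sq_int (MD L) (indicator (\<Union>i. A i) :: _ \<Rightarrow> real)" using A by (intro sq_int_indicator) auto
  show "(\<lambda>i. norm2 (MD L) (\<lambda>v. indicator (\<Union>i. A i) v - indicator (A i) v)) \<longlonglongrightarrow> 0"
  proof (rule MD.tendsto_norm2_dominated[where w = "\<lambda>v. 1"])
    show "(indicator (A i) :: _ \<Rightarrow> real) \<in> borel_measurable (MD L)" for i using app[of i] by (simp add: trig_approx_def sq_int_def)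
    show "sq_int (MD L) (\<lambda>v::real^'n. 1)" by (rule MD.sq_int_bounded[of _ _ 1]) auto
    show "AE x in MD L. (\<lambda>i. indicator (A i) x :: real) \<longlonglongrightarrow> indicator (\<Union>i. A i) x"
      using LIMSEQ_indicator_incseq[OF A(2)] by auto
    show "sq_int (MD L) (indicator (\<Union>i. A i) :: _ \<Rightarrow> real)" using A by (intro sq_int_indicator) auto
  qed (auto simp: indicator_def)
qed

text \<open>Closed sets are exhausted by compact pieces inside the open cube. They form an
  intersection-stable generator of the Borel sets, and the sets in question are closed under
  complements and countable disjoint unions, so Dynkin's argument reaches every Borel set.\<close>

lemma trig_approx_indicator_borel:
  fixes A :: "(real^'n::finite) set"
  assumes L: "L > 0" and A: "A \<in> sets borel"
  shows "trig_approx L (indicator (A \<inter> open_cube L))"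
proof -
  have closed: "trig_approx L (indicator (F \<inter> open_cube L))" if F: "closed F" for F :: "(real^'n) set"
  proof -
    \<comment> \<open>The slightly smaller closed cubes keep the pieces compact and away from the
      faces, where the embedding fails to be injective.\<close>
    define K where "K m = F \<inter> cbox (\<chi> j. - (L - 1 / real (Suc m))) (\<chi> j. L - 1 / real (Suc m))" for m :: nat
    have memK: "v \<in> K m \<longleftrightarrow> v \<in> F \<and> (\<forall>j. \<bar>v $ j\<bar> \<le> L - 1 / real (Suc m))" for v m
    proof -
      have "- a \<le> x \<and> x \<le> a \<longleftrightarrow> \<bar>x\<bar> \<le> a" for a x :: real by linarith
      then show ?thesis by (simp only: K_def Int_iff mem_box_cart vec_lambda_beta)
    qed
    have K: "compact (K m)" for m unfolding K_def using F by (intro closed_Int_compact compact_cbox)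
    have sub: "K m \<subseteq> open_cube L" for m
      unfolding subset_iff memK mem_open_cube by (auto intro: order_le_less_trans)
    have inc: "incseq K"
    proof (rule incseq_SucI, rule subsetI)
      fix m v assume v: "v \<in> K m"
      have "1 / real (Suc (Suc m)) \<le> 1 / real (Suc m)" by (intro divide_left_mono) auto
      then show "v \<in> K (Suc m)" using v unfolding memK by (meson diff_left_mono order_trans)
    qed
    have "(\<Union>m. K m) = F \<inter> open_cube L"
    proof (intro equalityI subsetI)
      fix v assume v: "v \<in> F \<inter> open_cube L"
      have lim: "(\<lambda>m. L - 1 / real (Suc m)) \<longlonglongrightarrow> L - 0"
        by (intro tendsto_diff tendsto_const LIMSEQ_Suc lim_1_over_n)
      have "\<forall>j. eventually (\<lambda>m. \<bar>v $ j\<bar> < L - 1 / real (Suc m)) sequentially"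
        using v order_tendstoD(1)[OF lim] by (simp add: mem_open_cube)
      then have "eventually (\<lambda>m. \<forall>j. \<bar>v $ j\<bar> < L - 1 / real (Suc m)) sequentially"
        by (intro eventually_all_finite) simp
      then obtain m where "\<forall>j. \<bar>v $ j\<bar> < L - 1 / real (Suc m)" by (auto simp: eventually_sequentially)
      then have "v \<in> K m" using v unfolding memK by (auto intro: less_imp_le)
      then show "v \<in> (\<Union>m. K m)" by blast
    next
      fix v assume "v \<in> (\<Union>m. K m)"
      then show "v \<in> F \<inter> open_cube L" using sub memK by blast
    qed
    then show ?thesis
      using trig_approx_incseq[of K L, OF _ inc trig_approx_indicator_compact[OF L K sub]] K
      by (simp add: borel_compact)
  qed
  have "Int_stable (Collect closed :: (real^'n) set set)" "(Collect closed :: (real^'n) set set) \<subseteq> Pow UNIV"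
    "A \<in> sigma_sets UNIV (Collect closed)"
    using A by (auto simp: borel_eq_closed Int_stable_def)
  then show ?thesis
  proof (induction rule: sigma_sets_induct_disjoint)
    case (basic F)
    then show ?case using closed by simp
  next
    case empty
    show ?case using closed[of "{}"] by (simp add: indicator_def[abs_def])
  next
    case (compl A)
    have "indicator ((UNIV - A) \<inter> open_cube L) v = (indicator (UNIV \<inter> open_cube L) v + (-1) * indicator (A \<inter> open_cube L) v :: real)" for v
      by (auto simp: indicator_def)
    then have "indicator ((UNIV - A) \<inter> open_cube L) = (\<lambda>v. indicator (UNIV \<inter> open_cube L) v + (-1) * indicator (A \<inter> open_cube L) v :: real)"
      by (rule ext)
    then show ?case
      using trig_approx_add[OF closed[OF closed_UNIV] trig_approx_cmult[OF compl(2), of "-1"]] by metis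
  next
    case (union A)
    have Ab: "A i \<in> sets borel" for i using union(2) by (auto simp: borel_eq_closed)
    define B where "B n = (\<Union>i<n. A i) \<inter> open_cube L" for n
    have "trig_approx L (indicator (B n))" for n
    proof (induction n)
      case 0
      show ?case using closed[of "{}"] by (simp add: B_def indicator_def[abs_def])
    next
      case (Suc n)
      have "A i \<inter> A n = {}" if "i < n" for i
        using union(1) that by (auto simp: disjoint_family_on_def)
      then have "indicator (B (Suc n)) v = (indicator (B n) v + indicator (A n \<inter> open_cube L) v :: real)" for v
        unfolding B_def lessThan_Suc by (auto simp: indicator_def)
      then have "indicator (B (Suc n)) = (\<lambda>v. indicator (B n) v + indicator (A n \<inter> open_cube L) v :: real)" by (rule ext)
      then show ?case using trig_approx_add[OF Suc union(3)[of n]] by metis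
    qed
    moreover have "incseq B" by (rule incseq_SucI) (auto simp: B_def less_Suc_eq)
    moreover have "(\<Union>n. B n) = (\<Union>i. A i) \<inter> open_cube L" by (auto simp: B_def)
    moreover have "B n \<in> sets borel" for n using Ab by (auto simp: B_def)
    ultimately show ?case using trig_approx_incseq[of B L] by simp
  qed
qed

lemma trig_approx_cong_AE:
  assumes f: "trig_approx L f" and g: "g \<in> borel_measurable (MD L)" "AE v in MD L. f v = g v"
  shows "trig_approx L g"
  unfolding trig_approx_def
proof (intro conjI allI impI)
  have fs: "sq_int (MD L) f" using f by (simp add: trig_approx_def)
  show gs: "sq_int (MD L) g" using sq_int_cong_AE(1)[OF fs g] .
  fix e :: real assume "e > 0"
  then obtain N p where p: "trig_poly L N p" "norm2 (MD L) (\<lambda>v. f v - p v) < e"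
    using f unfolding trig_approx_def by meson
  have "norm2 (MD L) (\<lambda>v. g v - p v) = norm2 (MD L) (\<lambda>v. f v - p v)"
    using g(2) by (intro sq_int_cong_AE(2) sq_int_diff fs trig_poly_sq_int[OF p(1)] sq_int_measurable[OF sq_int_diff[OF gs trig_poly_sq_int[OF p(1)]]]) auto
  then show "\<exists>N p. trig_poly L N p \<and> norm2 (MD L) (\<lambda>v. g v - p v) < e"
    by (intro exI[of _ N] exI[of _ p]) (simp add: p)
qed

text \<open>Simple functions are linear combinations of indicators, up to the null boundary of the
  cube; simple functions dominated by \<open>2 |g|\<close> converge to g, and domination upgrades
  this to L2 convergence.\<close>

lemma trig_poly_dense:
  fixes g :: "real^'n::finite \<Rightarrow> real"
  assumes L: "L > 0" and g: "sq_int (MD L) g"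
  shows "trig_approx L g"
proof -
  have ind: "trig_approx L (\<lambda>v. c * indicator A v)" if A: "A \<in> sets (MD L)" for c and A :: "(real^'n) set"
  proof (rule trig_approx_cong_AE)
    have "A \<in> sets borel" using A by (auto simp: sets_restrict_space)
    then show "trig_approx L (\<lambda>v. c * indicator (A \<inter> open_cube L) v)"
      by (intro trig_approx_cmult trig_approx_indicator_borel L)
    show "(\<lambda>v. c * indicator A v) \<in> borel_measurable (MD L)" using A by simp
    show "AE v in MD L. c * indicator (A \<inter> open_cube L) v = c * indicator A v"
      using AE_open_cube[of L] by eventually_elim (simp add: indicator_def)
  qed
  have simple: "trig_approx L s" if s: "simple_function (MD L) s" for s :: "real^'n \<Rightarrow> real"
  proof (rule trig_approx_cong_AE)
    have fin: "finite (s ` space (MD L))" using s by (rule simple_functionD)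
    have "trig_approx L (\<lambda>v. \<Sum>y\<in>Y. y * indicator (s -` {y} \<inter> space (MD L)) v)" if "finite Y" for Y
      using that
    proof (induction Y)
      case empty
      show ?case using ind[of "{}" 0] by simp
    next
      case (insert y Y)
      have "s -` {y} \<inter> space (MD L) \<in> sets (MD L)" using s by (rule simple_functionD)
      then show ?case unfolding sum.insert[OF insert(1,2)] by (intro trig_approx_add ind insert)
    qed
    then show "trig_approx L (\<lambda>v. \<Sum>y\<in>s ` space (MD L). y * indicator (s -` {y} \<inter> space (MD L)) v)" using fin .
    show "s \<in> borel_measurable (MD L)" using s by (rule borel_measurable_simple_function)
    show "AE v in MD L. (\<Sum>y\<in>s ` space (MD L). y * indicator (s -` {y} \<inter> space (MD L)) v) = s v"
    proof (rule AE_I2)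
      fix v assume v: "v \<in> space (MD L :: (real^'n) measure)"
      have "(\<Sum>y\<in>s ` space (MD L). y * indicator (s -` {y} \<inter> space (MD L)) v) = (\<Sum>y\<in>s ` space (MD L). if y = s v then y else 0)"
        using v by (intro sum.cong refl) (auto simp: indicator_def)
      then show "(\<Sum>y\<in>s ` space (MD L). y * indicator (s -` {y} \<inter> space (MD L)) v) = s v" using fin v by simp
    qed
  qed
  obtain s where s: "\<And>i. simple_function (MD L) (s i)" "\<And>v. v \<in> space (MD L) \<Longrightarrow> (\<lambda>i. s i v) \<longlonglongrightarrow> g v"
    "\<And>i v. v \<in> space (MD L) \<Longrightarrow> dist (s i v) 0 \<le> 2 * dist (g v) 0"
    using borel_measurable_implies_sequence_metric[OF sq_int_measurable[OF g], of 0] by metis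
  show ?thesis
  proof (rule trig_approx_limit[OF g simple])
    show "simple_function (MD L) (s i)" for i by (rule s)
    show "(\<lambda>i. norm2 (MD L) (\<lambda>v. g v - s i v)) \<longlonglongrightarrow> 0"
    proof (rule MD.tendsto_norm2_dominated[where w = "\<lambda>v. 2 * \<bar>g v\<bar>"])
      show "s i \<in> borel_measurable (MD L)" for i using s(1) by (rule borel_measurable_simple_function)
      show "sq_int (MD L) (\<lambda>v. 2 * \<bar>g v\<bar>)" by (intro sq_int_cmult sq_int_abs g)
    qed (use s g in auto)
  qed
qed

text \<open>A good approximant of degree N stays admissible for all larger degrees, so best
  approximation turns density into convergence.\<close>

lemma proj_tendsto:
  fixes g :: "real^'n::finite \<Rightarrow> real"
  assumes L: "L > 0" and g: "sq_int (MD L) g"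
  shows "(\<lambda>N. norm2 (MD L) (\<lambda>v. g v - proj L N g v)) \<longlonglongrightarrow> 0"
proof (rule LIMSEQ_I)
  fix e :: real assume "e > 0"
  then obtain N p where p: "trig_poly L N p" "norm2 (MD L) (\<lambda>v. g v - p v) < e"
    using trig_poly_dense[OF L g] unfolding trig_approx_def by meson
  have "norm2 (MD L) (\<lambda>v. g v - proj L M g v) < e" if "M \<ge> N" for M
    using proj_best_approximation[OF L g trig_poly_mono[OF p(1) that]] p(2) by simp
  then show "\<exists>no. \<forall>n\<ge>no. norm (norm2 (MD L) (\<lambda>v. g v - proj L n g v) - 0) < e" by auto
qed

subsection \<open>Decay of the Fourier coefficients\<close>

text \<open>Differentiation adds pi/2 to the phase, so iterated derivatives keep this shape and no
  case distinction between cosine and sine or by the parity of the order is needed.\<close>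

definition cosph :: "real \<Rightarrow> int^'n::finite \<Rightarrow> real \<Rightarrow> real^'n \<Rightarrow> real" where
  "cosph L k \<theta> v = cos (pi / L * kdot k v + \<theta>)"

lemma cosph_expand: "cosph L k \<theta> v = cos \<theta> * cosk L k v - sin \<theta> * sink L k v"
  by (simp add: cosph_def cosk_def sink_def cos_add)

lemma DERIV_cosph:
  "((\<lambda>s. c * cosph L k \<theta> (v + s *\<^sub>R axis j 1)) has_real_derivative (c * (pi / L * k $ j) * cosph L k (\<theta> + pi / 2) v)) (at 0)"
proof -
  define a where "a = pi / L"
  have "((\<lambda>s. c * cos (a * (kdot k v + s * k $ j) + \<theta>)) has_real_derivative c * (a * k $ j) * (- sin (a * kdot k v + \<theta>))) (at 0)"
    by (auto intro!: derivative_eq_intros)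
  moreover have "- sin (a * kdot k v + \<theta>) = cos (a * kdot k v + (\<theta> + pi / 2))"
    by (simp add: add.assoc[symmetric] cos_add)
  ultimately show ?thesis unfolding cosph_def kdot_add kdot_scaleR kdot_axis a_def[symmetric] by simp
qed

lemma pd_cosph:
  "pd js (cosph L k \<theta>) = (\<lambda>v. (\<Prod>j\<leftarrow>js. pi / L * k $ j) * cosph L k (\<theta> + length js * (pi / 2)) v)"
proof (induction js)
  case (Cons j js)
  have "\<theta> + length js * (pi / 2) + pi / 2 = \<theta> + length (j # js) * (pi / 2)"
    by (simp add: field_simps)
  then show ?case
    unfolding pd.simps Cons DERIV_imp_deriv[OF DERIV_cosph] by (simp only: list.map prod_list.Cons mult_ac)
qed simp

lemma test_fn_cosph:
  assumes L: "L > 0"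
  shows "test_fn L (cosph L k \<theta>)"
  unfolding test_fn_def pd_cosph
proof (intro conjI allI)
  show "periodic_L L (cosph L k \<theta>)"
    using periodic_cosk[OF L, of k] periodic_sink[OF L, of k] by (simp add: periodic_L_def cosph_expand)
  show "continuous_on UNIV (\<lambda>v. (\<Prod>j\<leftarrow>js. pi / L * k $ j) * cosph L k (\<theta> + length js * (pi / 2)) v)" for js
    unfolding cosph_def by (intro continuous_intros)
  show "(\<lambda>s. (\<Prod>j\<leftarrow>js. pi / L * k $ j) * cosph L k (\<theta> + length js * (pi / 2)) (v + s *\<^sub>R axis j 1)) differentiable at 0" for js j v
    using DERIV_cosph real_differentiable_def by blast
qed

lemma set_integral_MD:
  fixes h :: "real^'n::finite \<Rightarrow> real"
  shows "(LINT v:dom_L L|lborel. h v) = (\<integral>v. h v \<partial>MD L)"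
  by (simp add: integral_restrict_space set_lebesgue_integral_def)

text \<open>Testing against a phase-shifted cosine rotates the pair of Fourier coefficients, which leaves its length unchanged.\<close>
lemma weak_deriv_coeffs:
  fixes g h :: "real^'n::finite \<Rightarrow> real"
  assumes L: "L > 0" and wd: "weak_deriv L (replicate m j) g h" and g: "sq_int (MD L) g"
  shows "(fcos L h k)\<^sup>2 + (fsin L h k)\<^sup>2 = ((pi / L * k $ j) ^ m)\<^sup>2 * ((fcos L g k)\<^sup>2 + (fsin L g k)\<^sup>2)"
proof -
  define \<kappa> where "\<kappa> = (pi / L * real_of_int (k $ j)) ^ m"
  define \<alpha> where "\<alpha> = real m * (pi / 2)"
  define I where "I f \<theta> = (\<integral>v. f v * cosph L k \<theta> v \<partial>MD L)" for f \<theta>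
  define V where "V = (2 * L) ^ CARD('n)"
  have V: "V \<noteq> 0" using L by (simp add: V_def)
  have h: "sq_int (MD L) h" using wd by (simp add: weak_deriv_def in_L2_iff)
  have expand: "I f \<theta> = V * (cos \<theta> * fcos L f k - sin \<theta> * fsin L f k)" if f: "sq_int (MD L) f" for f \<theta>
  proof -
    have "I f \<theta> = (\<integral>v. cos \<theta> * (f v * cosk L k v) - sin \<theta> * (f v * sink L k v) \<partial>MD L)"
      unfolding I_def by (intro Bochner_Integration.integral_cong refl) (simp add: cosph_expand algebra_simps)
    also have "\<dots> = cos \<theta> * (\<integral>v. f v * cosk L k v \<partial>MD L) - sin \<theta> * (\<integral>v. f v * sink L k v \<partial>MD L)"
      by (simp add: sq_int_mult f)
    also have "\<dots> = V * (cos \<theta> * fcos L f k - sin \<theta> * fsin L f k)"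
      unfolding fcos_def fsin_def V_def[symmetric] using V by (simp add: right_diff_distrib)
    finally show ?thesis .
  qed
  \<comment> \<open>The weak derivative is moved onto the test function, which shifts its phase by
    \<open>\<alpha>\<close> and scales it by \<open>\<kappa>\<close>; the phase
    \<open>\<theta>\<close> stays free.\<close>
  have eq: "\<kappa> * I g (\<theta> + \<alpha>) = (-1) ^ m * I h \<theta>" for \<theta>
  proof -
    have p: "pd (replicate m j) (cosph L k \<theta>) = (\<lambda>v. \<kappa> * cosph L k (\<theta> + \<alpha>) v)"
      unfolding pd_cosph by (simp add: \<kappa>_def \<alpha>_def prod_list_replicate)
    have "(LINT v:dom_L L|lborel. g v * pd (replicate m j) (cosph L k \<theta>) v)
          = (-1) ^ length (replicate m j) * (LINT v:dom_L L|lborel. h v * cosph L k \<theta> v)"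
      using wd test_fn_cosph[OF L] unfolding weak_deriv_def by blast
    then show ?thesis unfolding set_integral_MD p by (simp add: I_def mult.left_commute)
  qed
  define a b a' b' where "a = fcos L g k" and "b = fsin L g k" and "a' = fcos L h k" and "b' = fsin L h k"
  have "\<kappa> * (V * (cos \<alpha> * a - sin \<alpha> * b)) = (-1) ^ m * (V * a')"
    using eq[of 0] unfolding expand[OF g] expand[OF h] by (simp add: a_def b_def a'_def)
  then have "V * (\<kappa> * (cos \<alpha> * a - sin \<alpha> * b)) = V * ((-1) ^ m * a')"
    by (simp add: mult_ac)
  then have 1: "\<kappa> * (cos \<alpha> * a - sin \<alpha> * b) = (-1) ^ m * a'"
    using V by simp
  \<comment> \<open>The phase -pi/2 singles out the sine coefficient of h, as the phase 0 singled
    out the cosine coefficient.\<close>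
  have "\<kappa> * (V * (sin \<alpha> * a + cos \<alpha> * b)) = (-1) ^ m * (V * b')"
    using eq[of "- pi / 2"] unfolding expand[OF g] expand[OF h] by (simp add: a_def b_def b'_def cos_diff sin_diff)
  then have "V * (\<kappa> * (sin \<alpha> * a + cos \<alpha> * b)) = V * ((-1) ^ m * b')"
    by (simp add: mult_ac)
  then have 2: "\<kappa> * (sin \<alpha> * a + cos \<alpha> * b) = (-1) ^ m * b'"
    using V by simp
  have sq: "((-1) ^ m * x)\<^sup>2 = x\<^sup>2" for x :: real
    by (cases "even m") simp_all
  have "a'\<^sup>2 + b'\<^sup>2 = (\<kappa> * (cos \<alpha> * a - sin \<alpha> * b))\<^sup>2 + (\<kappa> * (sin \<alpha> * a + cos \<alpha> * b))\<^sup>2"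
    unfolding 1 2 sq ..
  also have "\<dots> = \<kappa>\<^sup>2 * ((sin \<alpha>)\<^sup>2 + (cos \<alpha>)\<^sup>2) * (a\<^sup>2 + b\<^sup>2)"
    by algebra
  finally show ?thesis unfolding sin_cos_squared_add by (simp add: a_def b_def a'_def b'_def \<kappa>_def)
qed

section \<open>From the Sobolev bound to the projection error\<close>

lemma finite_multi_idx: "finite (multi_idx k :: ('n::finite \<Rightarrow> nat) set)"
proof (rule finite_subset)
  show "multi_idx k \<subseteq> (PiE UNIV (\<lambda>_. {..k}) :: ('n \<Rightarrow> nat) set)"
  proof
    fix \<nu> :: "'n \<Rightarrow> nat" assume "\<nu> \<in> multi_idx k"
    then have "\<nu> i \<le> k" for i
      using member_le_sum[of i UNIV \<nu>] by (simp add: multi_idx_def)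
    then show "\<nu> \<in> PiE UNIV (\<lambda>_. {..k})" by auto
  qed
qed (intro finite_PiE, auto)

text \<open>The multi-index of the pure m-th derivative in direction j. Pure derivatives match the
  way a frequency leaves \<open>modes N\<close>, namely by one large component.\<close>

definition single_idx :: "nat \<Rightarrow> 'n \<Rightarrow> 'n \<Rightarrow> nat" where
  "single_idx m j = (\<lambda>i. if i = j then m else 0)"

lemma single_idx_multi_idx: "m \<le> k \<Longrightarrow> single_idx m j \<in> multi_idx k"
  by (simp add: multi_idx_def single_idx_def)

text \<open>\<open>mi_list\<close> picks some list with prescribed multiplicities, so its order is
  unspecified in general; with a single direction the list is forced.\<close>

lemma mi_list_single_idx: "mi_list (single_idx m j) = replicate m j"
proof -
  have "\<exists>js. \<forall>i. count_list js i = single_idx m j i"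
    by (rule exI[of _ "replicate m j"]) (auto simp: single_idx_def count_list_eq_length_filter)
  then have c: "count_list (mi_list (single_idx m j)) i = single_idx m j i" for i
    unfolding mi_list_def by (rule someI2_ex) blast
  have sub: "i = j" if "i \<in> set (mi_list (single_idx m j))" for i
  proof (rule ccontr)
    assume "i \<noteq> j"
    then have "count_list (mi_list (single_idx m j)) i = 0" using c[of i] by (simp add: single_idx_def)
    then show False using that by (simp add: count_list_0_iff)
  qed
  then have r: "mi_list (single_idx m j) = replicate (length (mi_list (single_idx m j))) j"
    by (simp add: replicate_eqI)
  have "count_list (replicate n j) j = n" for n by (induction n) auto
  then have "length (mi_list (single_idx m j)) = m"
    using c[of j] by (subst (asm) r) (simp add: single_idx_def)
  then show ?thesis using r by simp
qed

lemma Hk_le_derivs: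
  fixes g :: "real^'n::finite \<Rightarrow> real"
  assumes g: "Hk_le L k g C" and k: "k \<ge> 1"
  obtains H0 H where "weak_deriv L [] g H0" "norm2 (MD L) H0 \<le> C"
    "\<And>j. weak_deriv L (replicate k j) g (H j)" "(\<Sum>j\<in>UNIV. (norm2 (MD L) (H j))\<^sup>2) \<le> C\<^sup>2" "0 \<le> C"
proof -
  obtain G where G: "\<And>\<nu>. \<nu> \<in> multi_idx k \<Longrightarrow> weak_deriv L (mi_list \<nu>) g (G \<nu>)"
    "sqrt (\<Sum>\<nu>\<in>multi_idx k. (norm2 (MD L) (G \<nu>))\<^sup>2) \<le> C"
    using g unfolding Hk_le_def L2norm_eq by blast
  have nn: "(0::real) \<le> (\<Sum>\<nu>\<in>multi_idx k. (norm2 (MD L) (G \<nu>))\<^sup>2)" by (intro sum_nonneg) simp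
  then have C0: "0 \<le> C" using G(2) by (meson order_trans real_sqrt_ge_zero)
  have sum: "(\<Sum>\<nu>\<in>multi_idx k. (norm2 (MD L) (G \<nu>))\<^sup>2) \<le> C\<^sup>2"
    using G(2) nn by (metis C0 real_sqrt_le_iff real_sqrt_abs abs_of_nonneg)
  \<comment> \<open>Any direction will do: for order 0 the index \<open>single_idx 0 j0\<close> is
    the zero multi-index.\<close>
  fix j0 :: 'n
  show thesis
  proof (rule that[of "G (single_idx 0 j0)" "\<lambda>j. G (single_idx k j)"])
    show "weak_deriv L [] g (G (single_idx 0 j0))"
      using G(1)[OF single_idx_multi_idx[of 0 k j0]] by (simp add: mi_list_single_idx)
    have "(norm2 (MD L) (G (single_idx 0 j0)))\<^sup>2 \<le> (\<Sum>\<nu>\<in>multi_idx k. (norm2 (MD L) (G \<nu>))\<^sup>2)"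
      by (rule member_le_sum[of _ _ "\<lambda>\<nu>. (norm2 (MD L) (G \<nu>))\<^sup>2"]) (auto simp: single_idx_multi_idx finite_multi_idx)
    then show "norm2 (MD L) (G (single_idx 0 j0)) \<le> C"
      using sum C0 by (meson order_trans power2_le_imp_le)
    show "weak_deriv L (replicate k j) g (G (single_idx k j))" for j
      using G(1)[OF single_idx_multi_idx[of k k j]] by (simp add: mi_list_single_idx)
    \<comment> \<open>For k = 0 all these indices would coincide; k \<ge> 1 makes the sum over
      directions a subsum of the Sobolev norm.\<close>
    have inj: "inj (single_idx k :: 'n \<Rightarrow> _)"
      using k by (auto simp: inj_def single_idx_def fun_eq_iff split: if_splits)
    have "(\<Sum>j\<in>UNIV. (norm2 (MD L) (G (single_idx k j)))\<^sup>2) = (\<Sum>\<nu>\<in>range (single_idx k). (norm2 (MD L) (G \<nu>))\<^sup>2)"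
      by (simp add: sum.reindex[OF inj])
    also have "\<dots> \<le> (\<Sum>\<nu>\<in>multi_idx k. (norm2 (MD L) (G \<nu>))\<^sup>2)"
      by (intro sum_mono2 finite_multi_idx) (auto simp: single_idx_multi_idx)
    finally show "(\<Sum>j\<in>UNIV. (norm2 (MD L) (G (single_idx k j)))\<^sup>2) \<le> C\<^sup>2" using sum by simp
  qed (rule C0)
qed

text \<open>\<open>Hk_le\<close> bounds a weak derivative of order zero, not g itself. Both have
  Fourier coefficients of the same size, hence projections of the same norm, and N tends to
  infinity.\<close>

lemma Hk_le_imp_norm2_le:
  fixes g :: "real^'n::finite \<Rightarrow> real"
  assumes L: "L > 0" and g: "sq_int (MD L) g" and H: "Hk_le L k g C" and k: "k \<ge> 1"
  shows "norm2 (MD L) g \<le> C"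
proof -
  obtain H0 where wd: "weak_deriv L [] g H0" and le: "norm2 (MD L) H0 \<le> C" and "0 \<le> C"
    using Hk_le_derivs[OF H k] by metis
  have H0: "sq_int (MD L) H0" using wd by (simp add: weak_deriv_def in_L2_iff)
  have "(fcos L H0 l)\<^sup>2 + (fsin L H0 l)\<^sup>2 = (fcos L g l)\<^sup>2 + (fsin L g l)\<^sup>2" for l
    using weak_deriv_coeffs[OF L _ g, of 0] wd by simp
  then have "(norm2 (MD L) (proj L N g))\<^sup>2 = (norm2 (MD L) (proj L N H0))\<^sup>2" for N
    by (simp add: norm2_proj_eq_coeffs[OF L g] norm2_proj_eq_coeffs[OF L H0])
  then have eq: "norm2 (MD L) (proj L N g) = norm2 (MD L) (proj L N H0)" for N
    by (metis norm2_nonneg power2_eq_iff_nonneg)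
  have "norm2 (MD L) g \<le> norm2 (MD L) (\<lambda>v. g v - proj L N g v) + C" for N
  proof -
    have "norm2 (MD L) g \<le> norm2 (MD L) (\<lambda>v. g v - proj L N g v) + norm2 (MD L) (proj L N g)"
      using norm2_triangle[OF sq_int_diff[OF g proj_sq_int[of L N g]] proj_sq_int[of L N g]] by simp
    then show ?thesis using norm2_proj_le[OF L H0, of N] le unfolding eq by simp
  qed
  moreover have "(\<lambda>N. norm2 (MD L) (\<lambda>v. g v - proj L N g v) + C) \<longlonglongrightarrow> 0 + C"
    by (intro tendsto_intros proj_tendsto L g)
  ultimately show ?thesis by (intro LIMSEQ_le_const[where X = "\<lambda>N. norm2 (MD L) (\<lambda>v. g v - proj L N g v) + C"]) auto
qed

text \<open>A frequency outside \<open>modes N\<close> has a component above N/2, and the k-th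
  derivative in that direction multiplies the coefficient by at least
  \<open>(pi N / (2 L)) ^ k\<close>. The reciprocal is the rate.\<close>

lemma Hk_le_proj_error:
  fixes g :: "real^'n::finite \<Rightarrow> real"
  assumes L: "L > 0" and g: "sq_int (MD L) g" and Hk: "Hk_le L k g C" and k: "k \<ge> 1" and N: "N \<ge> 1"
  shows "norm2 (MD L) (\<lambda>v. g v - proj L N g v) \<le> (2 * L / (pi * real N)) ^ k * C"
proof -
  obtain H where wd: "\<And>j. weak_deriv L (replicate k j) g (H j)"
    and le: "(\<Sum>j\<in>UNIV. (norm2 (MD L) (H j))\<^sup>2) \<le> C\<^sup>2" and C0: "0 \<le> C"
    using Hk_le_derivs[OF Hk k] by metis
  have H: "sq_int (MD L) (H j)" for j using wd[of j] by (simp add: weak_deriv_def in_L2_iff)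
  define q where "q = (2 * L / (pi * real N)) ^ k"
  have q0: "q \<ge> 0" using L by (simp add: q_def)
  define cf where "cf f l = (fcos L f l)\<^sup>2 + (fsin L f l)\<^sup>2" for f and l :: "int^'n"
  have cf0: "cf f l \<ge> 0" for f l by (simp add: cf_def)
  have tail: "cf g l \<le> q\<^sup>2 * (\<Sum>j\<in>UNIV. cf (H j) l)" if l: "l \<notin> modes N" for l
  proof -
    \<comment> \<open>The large component depends on l, which is why the bound sums over all
      directions.\<close>
    obtain j where j: "\<bar>real_of_int (l $ j)\<bar> > real N / 2" using l by (auto simp: mem_modes not_le)
    have "1 \<le> 2 * L / (pi * real N) * \<bar>pi / L * l $ j\<bar>"
      using j L N by (simp add: abs_mult field_simps)
    then have "1 \<le> (2 * L / (pi * real N) * \<bar>pi / L * l $ j\<bar>) ^ k" by (rule one_le_power)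
    then have "1 \<le> q * \<bar>pi / L * l $ j\<bar> ^ k" unfolding q_def power_mult_distrib .
    then have "1 \<le> q * \<bar>(pi / L * l $ j) ^ k\<bar>" by (simp only: power_abs)
    then have "1 \<le> (q * \<bar>(pi / L * l $ j) ^ k\<bar>)\<^sup>2" by (rule one_le_power)
    then have one: "1 \<le> q\<^sup>2 * ((pi / L * l $ j) ^ k)\<^sup>2" by (simp only: power_mult_distrib power2_abs)
    have "cf g l \<le> q\<^sup>2 * ((pi / L * l $ j) ^ k)\<^sup>2 * cf g l"
      using mult_right_mono[OF one cf0[of g l]] by simp
    also have "\<dots> = q\<^sup>2 * cf (H j) l"
      unfolding cf_def weak_deriv_coeffs[OF L wd g] by (simp only: mult.assoc)
    also have "\<dots> \<le> q\<^sup>2 * (\<Sum>j\<in>UNIV. cf (H j) l)"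
      by (intro mult_left_mono member_le_sum) (auto simp: cf0)
    finally show ?thesis .
  qed
  define V where "V = (2 * L) ^ CARD('n)"
  have V0: "V \<ge> 0" using L by (simp add: V_def)
  \<comment> \<open>The tail is handled as a finite difference of two projections; only at the end
    does M tend to infinity, where density of trigonometric polynomials enters.\<close>
  have bound: "(norm2 (MD L) (\<lambda>v. g v - proj L N g v))\<^sup>2 \<le> (norm2 (MD L) (\<lambda>v. g v - proj L M g v))\<^sup>2 + q\<^sup>2 * C\<^sup>2"
    if M: "M \<ge> N" for M
  proof -
    have "(norm2 (MD L) (\<lambda>v. g v - proj L N g v))\<^sup>2 = (norm2 (MD L) (\<lambda>v. g v - proj L M g v))\<^sup>2
        + (norm2 (MD L) (proj L M g))\<^sup>2 - (norm2 (MD L) (proj L N g))\<^sup>2"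
      using norm2_proj_sq[OF L g, of M] norm2_proj_sq[OF L g, of N] by simp
    also have "(norm2 (MD L) (proj L M g))\<^sup>2 = V * (\<Sum>l\<in>modes M - modes N. cf g l) + V * (\<Sum>l\<in>modes N. cf g l)"
      unfolding norm2_proj_eq_coeffs[OF L g] cf_def V_def
      by (subst sum.subset_diff[OF modes_mono[OF M] finite_modes]) (simp only: distrib_left)
    also have "(norm2 (MD L) (proj L N g))\<^sup>2 = V * (\<Sum>l\<in>modes N. cf g l)"
      unfolding norm2_proj_eq_coeffs[OF L g] cf_def V_def ..
    finally have eq: "(norm2 (MD L) (\<lambda>v. g v - proj L N g v))\<^sup>2
      = (norm2 (MD L) (\<lambda>v. g v - proj L M g v))\<^sup>2 + V * (\<Sum>l\<in>modes M - modes N. cf g l)" by simp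
    have "(\<Sum>l\<in>modes M - modes N. cf g l) \<le> (\<Sum>l\<in>modes M - modes N. q\<^sup>2 * (\<Sum>j\<in>UNIV. cf (H j) l))"
      by (intro sum_mono tail) auto
    also have "\<dots> \<le> (\<Sum>l\<in>modes M. q\<^sup>2 * (\<Sum>j\<in>UNIV. cf (H j) l))"
      by (intro sum_mono2) (auto simp: cf0 sum_nonneg)
    finally have "V * (\<Sum>l\<in>modes M - modes N. cf g l) \<le> V * (\<Sum>l\<in>modes M. q\<^sup>2 * (\<Sum>j\<in>UNIV. cf (H j) l))"
      using V0 by (rule mult_left_mono)
    also have "\<dots> = q\<^sup>2 * (\<Sum>j\<in>UNIV. V * (\<Sum>l\<in>modes M. cf (H j) l))"
    proof -
      have "(\<Sum>l\<in>modes M. \<Sum>j\<in>UNIV. cf (H j) l) = (\<Sum>j\<in>UNIV. \<Sum>l\<in>modes M. cf (H j) l)"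
        by (rule sum.swap)
      then show ?thesis by (simp only: sum_distrib_left[symmetric] mult.left_commute)
    qed
    also have "\<dots> = q\<^sup>2 * (\<Sum>j\<in>UNIV. (norm2 (MD L) (proj L M (H j)))\<^sup>2)"
      unfolding norm2_proj_eq_coeffs[OF L H] cf_def V_def ..
    also have "\<dots> \<le> q\<^sup>2 * (\<Sum>j\<in>UNIV. (norm2 (MD L) (H j))\<^sup>2)"
      by (intro mult_left_mono sum_mono power_mono norm2_proj_le L H) auto
    also have "\<dots> \<le> q\<^sup>2 * C\<^sup>2" using le by (rule mult_left_mono) simp
    finally show ?thesis unfolding eq by simp
  qed
  have "(\<lambda>M. (norm2 (MD L) (\<lambda>v. g v - proj L M g v))\<^sup>2 + q\<^sup>2 * C\<^sup>2) \<longlonglongrightarrow> 0\<^sup>2 + q\<^sup>2 * C\<^sup>2"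
    by (intro tendsto_intros proj_tendsto L g)
  then have "(norm2 (MD L) (\<lambda>v. g v - proj L N g v))\<^sup>2 \<le> 0\<^sup>2 + q\<^sup>2 * C\<^sup>2"
    by (rule LIMSEQ_le_const) (use bound in blast)
  then have "(norm2 (MD L) (\<lambda>v. g v - proj L N g v))\<^sup>2 \<le> (q * C)\<^sup>2" by (simp add: power_mult_distrib)
  then show ?thesis unfolding q_def[symmetric] using q0 C0 by (auto intro: power2_le_imp_le)
qed

section \<open>The collision operator on square integrable functions\<close>

text \<open>Both iterated integrals of \<open>1\<^sub>B(x) G(x + U y)\<close>, with \<open>B\<close> the unit ball, are multiples of an
  integral of \<open>G\<close> with the same factor.\<close>
lemma nn_integral_lborel_orthogonal:
  fixes U :: "'a::euclidean_space \<Rightarrow> 'a" and G :: "'a \<Rightarrow> ennreal"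
  assumes U: "orthogonal_transformation U" and [measurable]: "G \<in> borel_measurable borel"
  shows "(\<integral>\<^sup>+y. G (U y) \<partial>lborel) = (\<integral>\<^sup>+y. G y \<partial>lborel)"
proof -
  define B where "B = ball (0 :: 'a) 1"
  define V where "V = inv U"
  have V: "orthogonal_transformation V" using U by (simp add: V_def orthogonal_transformation_inv)
  have UV: "U (V x) = x" "V (U x) = x" for x
    using orthogonal_transformation_bij[OF U] by (simp_all add: V_def bij_def surj_f_inv_f)
  have lin: "linear U" "linear V" using U V by (auto simp: orthogonal_transformation_def)
  have Um [measurable]: "U \<in> borel \<rightarrow>\<^sub>M borel"
    using lin(1) by (intro borel_measurable_continuous_onI linear_continuous_on) (simp add: linear_conv_bounded_linear)
  have Bm [measurable]: "B \<in> sets borel" by (simp add: B_def)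
  have s1: "(\<integral>\<^sup>+y. G (x + U y) \<partial>lborel) = (\<integral>\<^sup>+y. G (U y) \<partial>lborel)" for x
  proof -
    have "(\<integral>\<^sup>+y. G (x + U y) \<partial>lborel) = (\<integral>\<^sup>+y. G (U (y + V x)) \<partial>lborel)"
      by (simp add: linear_add[OF lin(1)] UV add.commute)
    then show ?thesis by (simp add: nn_integral_lborel_shift[of "\<lambda>y. G (U y)"])
  qed
  have s2: "(\<integral>\<^sup>+y. indicator B (x - U y) \<partial>lborel) = emeasure lborel B" for x
  proof -
    have "x - U y = U (V x - y)" for y by (simp add: linear_diff[OF lin(1)] UV)
    then have "norm (x - U y) = norm (y - V x)" for y
      by (simp add: orthogonal_transformation_norm[OF U] norm_minus_commute)
    then have "(\<integral>\<^sup>+y. indicator B (x - U y) \<partial>lborel) = (\<integral>\<^sup>+y. indicator B (y + (- V x)) \<partial>lborel)"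
      by (intro nn_integral_cong) (simp add: B_def indicator_def)
    also have "\<dots> = (\<integral>\<^sup>+y. indicator B y \<partial>lborel)" by (rule nn_integral_lborel_shift) simp
    finally show ?thesis by simp
  qed
  have "emeasure lborel B * (\<integral>\<^sup>+y. G (U y) \<partial>lborel) = (\<integral>\<^sup>+x. indicator B x * (\<integral>\<^sup>+y. G (x + U y) \<partial>lborel) \<partial>lborel)"
    unfolding s1 by (simp add: nn_integral_multc)
  also have "\<dots> = (\<integral>\<^sup>+x. (\<integral>\<^sup>+y. indicator B x * G (x + U y) \<partial>lborel) \<partial>lborel)"
    by (intro nn_integral_cong nn_integral_cmult[symmetric]) simp
  also have "\<dots> = (\<integral>\<^sup>+y. (\<integral>\<^sup>+x. indicator B x * G (x + U y) \<partial>lborel) \<partial>lborel)"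
    by (rule lborel_pair.Fubini'[symmetric]) simp
  also have "\<dots> = (\<integral>\<^sup>+y. (\<integral>\<^sup>+x. indicator B (x - U y) * G x \<partial>lborel) \<partial>lborel)"
  proof (rule nn_integral_cong)
    fix y
    show "(\<integral>\<^sup>+x. indicator B x * G (x + U y) \<partial>lborel) = (\<integral>\<^sup>+x. indicator B (x - U y) * G x \<partial>lborel)"
      using nn_integral_lborel_shift[of "\<lambda>x. indicator B (x - U y) * G x" "U y"] by simp
  qed
  also have "\<dots> = (\<integral>\<^sup>+x. (\<integral>\<^sup>+y. indicator B (x - U y) * G x \<partial>lborel) \<partial>lborel)"
    by (rule lborel_pair.Fubini') simp
  also have "\<dots> = (\<integral>\<^sup>+x. emeasure lborel B * G x \<partial>lborel)"
    by (intro nn_integral_cong) (simp add: nn_integral_multc s2)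
  also have "\<dots> = emeasure lborel B * (\<integral>\<^sup>+x. G x \<partial>lborel)" by (simp add: nn_integral_cmult)
  finally have "emeasure lborel B * (\<integral>\<^sup>+y. G (U y) \<partial>lborel) = emeasure lborel B * (\<integral>\<^sup>+x. G x \<partial>lborel)" .
  moreover have "emeasure lborel B < \<infinity>" unfolding B_def by (rule emeasure_bounded_finite) simp
  moreover have "emeasure lborel B \<noteq> 0"
    unfolding B_def by (simp add: emeasure_ball unit_ball_vol_pos ennreal_eq_0_iff not_le)
  ultimately show ?thesis by (auto simp: ennreal_mult_cancel_left)
qed

section \<open>Angular integrals, with directions represented by points of the unit ball\<close>

lemma ball_borel [measurable]: "ball x r \<in> sets borel" "cball x r \<in> sets borel"
  by simp_all

abbreviation hat :: "'a::real_normed_vector \<Rightarrow> 'a" where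
  "hat x \<equiv> x /\<^sub>R norm x"

text \<open>Up to the factor \<open>CARD('n)\<close>, the surface integral of
  \<open>b (\<sigma> \<bullet> e)\<close> with \<open>\<sigma> = hat x\<close>. Being extended-real
  valued, it can be compared between directions before it is known to be finite.\<close>

definition sphere_mass :: "(real \<Rightarrow> real) \<Rightarrow> real^'n::finite \<Rightarrow> ennreal" where
  "sphere_mass b e = (\<integral>\<^sup>+x. indicator (ball 0 1) x * ennreal (b (hat x \<bullet> e)) \<partial>lborel)"

lemma hat_measurable [measurable]: "(hat :: 'a::euclidean_space \<Rightarrow> 'a) \<in> borel \<rightarrow>\<^sub>M borel"
  by measurable

text \<open>A rotation carrying e to e' preserves both the unit ball and Lebesgue measure, and the
  integrand sees only the inner product.\<close>

lemma sphere_mass_cong: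
  fixes e e' :: "real^'n::finite"
  assumes [measurable]: "b \<in> borel_measurable borel" and e: "norm e = 1" "norm e' = 1"
  shows "sphere_mass b e = sphere_mass b e'"
proof -
  obtain U where U: "orthogonal_transformation U" "U e = e'"
    using orthogonal_transformation_exists[of e e'] e by auto
  have "U x \<bullet> e' = x \<bullet> e" for x
    using U by (metis orthogonal_transformation_def)
  then have "sphere_mass b e = (\<integral>\<^sup>+x. indicator (ball 0 1) (U x) * ennreal (b (hat (U x) \<bullet> e')) \<partial>lborel)"
    unfolding sphere_mass_def by (simp add: orthogonal_transformation_norm[OF U(1)] indicator_def)
  also have "\<dots> = sphere_mass b e'"
    unfolding sphere_mass_def
    by (rule nn_integral_lborel_orthogonal[OF U(1)])
       (intro borel_measurable_times_ennreal borel_measurable_indicator measurable_compose[OF _ measurable_ennreal]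
         measurable_compose[OF _ assms(1)] borel_measurable_inner hat_measurable, auto)
  finally show ?thesis .
qed

section \<open>Independence of radius and direction in a ball\<close>

lemma emeasure_cone:
  fixes B :: "'a::euclidean_space set"
  assumes [measurable]: "B \<in> sets borel" and r: "r > 0"
  shows "emeasure lborel {q. norm q \<le> r \<and> hat q \<in> B} = ennreal (r ^ DIM('a)) * emeasure lborel {q. norm q \<le> 1 \<and> hat q \<in> B}"
proof -
  define S where "S = {q :: 'a. norm q \<le> r \<and> hat q \<in> B}"
  have [measurable]: "S \<in> sets borel" unfolding S_def by measurable
  have "emeasure lborel S = (\<integral>\<^sup>+q. indicator S q \<partial>lborel)" by simp
  also have "\<dots> = (\<integral>\<^sup>+q. indicator S q \<partial>(density (distr lborel borel (\<lambda>x. 0 + r *\<^sub>R x)) (\<lambda>_. ennreal (\<bar>r\<bar> ^ DIM('a)))))"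
    using r by (subst lborel_affine[of r 0]) auto
  also have "\<dots> = ennreal (r ^ DIM('a)) * (\<integral>\<^sup>+q. indicator S (r *\<^sub>R q) \<partial>lborel)"
    using r by (subst nn_integral_density) (simp_all add: nn_integral_distr nn_integral_cmult del: nn_integral_indicator)
  also have "(\<lambda>q. indicator S (r *\<^sub>R q) :: ennreal) = indicator {q. norm q \<le> 1 \<and> hat q \<in> B}"
  proof -
    have h: "hat (r *\<^sub>R q) = hat q" and n: "norm (r *\<^sub>R q) \<le> r \<longleftrightarrow> norm q \<le> 1" for q :: 'a
      using r by (simp_all add: field_simps)
    show ?thesis by (rule ext) (simp only: S_def indicator_def mem_Collect_eq h n)
  qed
  also have "(\<integral>\<^sup>+q. indicator {q::'a. norm q \<le> 1 \<and> hat q \<in> B} q \<partial>lborel) = emeasure lborel {q::'a. norm q \<le> 1 \<and> hat q \<in> B}"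
    by (subst nn_integral_indicator) measurable
  finally show ?thesis by (simp add: S_def)
qed

lemma emeasure_cone_ball:
  fixes B :: "'a::euclidean_space set"
  assumes [measurable]: "B \<in> sets borel"
  shows "emeasure lborel {q. norm q \<le> 1 \<and> hat q \<in> B} = emeasure lborel {q. norm q < 1 \<and> hat q \<in> B}"
proof (rule emeasure_eq_AE)
  have "AE q in lborel. q \<notin> sphere (0::'a) 1"
    using negligible_sphere[of "0::'a" 1]
    by (intro AE_not_in) (simp add: negligible_iff_null_sets null_sets_completion_iff)
  then show "AE x in lborel. (x \<in> {q. norm q \<le> 1 \<and> hat q \<in> B}) = (x \<in> {q. norm q < 1 \<and> hat q \<in> B})"
    by eventually_elim auto
qed measurable

text \<open>The volume of a spherical shell over a set of directions splits into a radial and an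
  angular factor. The maximum and minimum let t range over all reals, as needed to compare measures
  on all half-lines.\<close>

lemma emeasure_shell:
  fixes B :: "'a::euclidean_space set"
  assumes [measurable]: "B \<in> sets borel" and R: "R > 0"
  shows "emeasure lborel {q. t < norm q \<and> norm q \<le> R \<and> hat q \<in> B}
    = ennreal (R ^ DIM('a) - (min R (max 0 t)) ^ DIM('a)) * emeasure lborel {q. norm q < 1 \<and> hat q \<in> B}"
proof -
  define c where "c = emeasure lborel {q. norm q < 1 \<and> hat q \<in> B}"
  have "c \<le> emeasure lborel (ball (0::'a) 1)"
    unfolding c_def by (intro emeasure_mono) auto
  also have "\<dots> < \<infinity>" by (rule emeasure_bounded_finite) simp
  finally have "c \<noteq> top" by simp
  have cone: "emeasure lborel {q. norm q \<le> r \<and> hat q \<in> B} = ennreal (r ^ DIM('a)) * c" if "r > 0" for r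
    unfolding emeasure_cone[OF assms(1) that] emeasure_cone_ball[OF assms(1)] c_def ..
  consider "t \<ge> R" | "t < 0" | "t = 0" | "0 < t" "t < R" by linarith
  then have "emeasure lborel {q. t < norm q \<and> norm q \<le> R \<and> hat q \<in> B}
    = ennreal (R ^ DIM('a) - (min R (max 0 t)) ^ DIM('a)) * c"
  proof cases
    case 1
    then have e: "{q. t < norm q \<and> norm q \<le> R \<and> hat q \<in> B} = {}" by auto
    show ?thesis unfolding e using 1 R by simp
  next
    case 2
    then have e: "{q. t < norm q \<and> norm q \<le> R \<and> hat q \<in> B} = {q. norm q \<le> R \<and> hat q \<in> B}"
      by (auto intro: less_le_trans)
    show ?thesis unfolding e using 2 R by (simp add: cone zero_power)
  next
    \<comment> \<open>For t = 0 the strict inequality removes the origin, which may lie in the cone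
      because \<open>hat 0 = 0\<close> can belong to B; a single point is null.\<close>
    case 3
    have "AE q in lborel. q \<notin> {0::'a}" by (rule AE_not_in) (simp add: null_sets_def)
    then have e: "emeasure lborel {q. t < norm q \<and> norm q \<le> R \<and> hat q \<in> B} = emeasure lborel {q. norm q \<le> R \<and> hat q \<in> B}"
      using 3 by (intro emeasure_eq_AE) (auto elim!: eventually_mono)
    show ?thesis unfolding e using 3 R by (simp add: cone zero_power)
  next
    case 4
    have "{q. t < norm q \<and> norm q \<le> R \<and> hat q \<in> B} = {q. norm q \<le> R \<and> hat q \<in> B} - {q. norm q \<le> t \<and> hat q \<in> B}"
      by auto
    also have "emeasure lborel \<dots> = emeasure lborel {q. norm q \<le> R \<and> hat q \<in> B} - emeasure lborel {q. norm q \<le> t \<and> hat q \<in> B}"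
    proof (rule emeasure_Diff)
      have "emeasure lborel {q. norm q \<le> t \<and> hat q \<in> B} \<le> emeasure lborel (cball (0::'a) t)"
        by (intro emeasure_mono) auto
      also have "\<dots> < \<infinity>" by (rule emeasure_bounded_finite) simp
      finally show "emeasure lborel {q. norm q \<le> t \<and> hat q \<in> B} \<noteq> \<infinity>" by simp
      show "{q. norm q \<le> R \<and> hat q \<in> B} \<in> sets lborel" by measurable
      show "{q. norm q \<le> t \<and> hat q \<in> B} \<in> sets lborel" by measurable
    qed (use 4 in auto)
    also have "\<dots> = (ennreal (R ^ DIM('a)) - ennreal (t ^ DIM('a))) * c"
      using 4 R \<open>c \<noteq> top\<close> by (simp add: cone ennreal_right_diff_distrib mult.commute)
    also have "ennreal (R ^ DIM('a)) - ennreal (t ^ DIM('a)) = ennreal (R ^ DIM('a) - t ^ DIM('a))"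
      using 4 by (intro ennreal_minus) simp
    finally show ?thesis using 4 by simp
  qed
  then show ?thesis by (simp only: c_def)
qed

text \<open>Radius and direction of a uniform point of a ball are independent.\<close>
lemma nn_integral_polar:
  fixes H :: "real \<times> 'a::euclidean_space \<Rightarrow> ennreal"
  assumes [measurable]: "H \<in> borel_measurable borel" and R: "R > 0"
  shows "(\<integral>\<^sup>+x. indicator (ball 0 1) x * (\<integral>\<^sup>+q. indicator (cball 0 R) q * H (norm (q::'a), hat x) \<partial>lborel) \<partial>lborel)
    = emeasure lborel (ball (0::'a) 1) * (\<integral>\<^sup>+q. indicator (cball 0 R) q * H (norm q, hat q) \<partial>lborel)"
proof -
  define QB where "QB = density lborel (indicator (cball (0::'a) R) :: _ \<Rightarrow> ennreal)"
  define XB where "XB = density lborel (indicator (ball (0::'a) 1) :: _ \<Rightarrow> ennreal)"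
  define S0 where "S0 = emeasure lborel (ball (0::'a) 1)"
  \<comment> \<open>Unnormalised laws: \<open>a\<close> of the radius in the large ball,
    \<open>s\<close> of the direction in the unit ball, and \<open>m\<close> of the pair radius and
    direction in the large ball, scaled by the unit volume S0. The claim is that \<open>m\<close> is
    the product of \<open>a\<close> and \<open>s\<close>.\<close>
  define a where "a = distr QB borel (norm :: 'a \<Rightarrow> real)"
  define s where "s = distr XB borel (hat :: 'a \<Rightarrow> 'a)"
  define m where "m = scale_measure S0 (distr QB (borel \<Otimes>\<^sub>M borel) (\<lambda>q. (norm q, hat q)))"
  have [measurable_cong]: "sets QB = sets borel" "sets XB = sets borel" by (simp_all add: QB_def XB_def)
  have fin: "emeasure lborel (cball (0::'a) R) < \<infinity>" "S0 < \<infinity>"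
    unfolding S0_def by (rule emeasure_bounded_finite, simp)+
  have UB: "(UNIV :: 'a set) \<in> sets borel" by simp
  have eQ: "emeasure QB A = emeasure lborel (cball 0 R \<inter> A)" if "A \<in> sets borel" for A
    unfolding QB_def using that by (subst emeasure_density) (auto simp: indicator_inter_arith[symmetric] intro!: borel_measurable_indicator)
  have eX: "emeasure XB A = emeasure lborel (ball 0 1 \<inter> A)" if "A \<in> sets borel" for A
    unfolding XB_def using that by (subst emeasure_density) (auto simp: indicator_inter_arith[symmetric] intro!: borel_measurable_indicator)
  have es: "emeasure s B = emeasure lborel {q. norm q < 1 \<and> hat q \<in> B}" if [measurable]: "B \<in> sets borel" for B
  proof -
    have "emeasure s B = emeasure XB {q. hat q \<in> B}"
      unfolding s_def by (subst emeasure_distr) (auto simp: vimage_def XB_def)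
    also have "\<dots> = emeasure lborel (ball 0 1 \<inter> {q. hat q \<in> B})" by (rule eX) measurable
    finally show ?thesis by (simp add: Int_def ball_def)
  qed
  have S0: "emeasure s UNIV = S0" unfolding es[OF UB] S0_def
    by (rule arg_cong[of _ _ "emeasure lborel"]) auto
  interpret a: finite_measure a
  proof
    show "emeasure a (space a) \<noteq> \<infinity>"
      unfolding a_def using fin(1) by (subst emeasure_distr) (auto simp: eQ QB_def[symmetric], simp add: QB_def eQ[unfolded QB_def])
  qed
  interpret s: finite_measure s
  proof
    show "emeasure s (space s) \<noteq> \<infinity>" using S0 fin(2) by (simp add: s_def)
  qed
  interpret QB: finite_measure QB
  proof
    show "emeasure QB (space QB) \<noteq> \<infinity>"
      using fin(1) eQ[OF UB] by (simp add: QB_def)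
  qed
  have rect: "emeasure a A * emeasure s B = emeasure m (A \<times> B)" if A [measurable]: "A \<in> sets borel" and B [measurable]: "B \<in> sets borel" for A B
  proof -
    \<comment> \<open>With B fixed, both sides are measures on the line as functions of A. They
      agree on half-lines by \<open>emeasure_shell\<close>, hence on all Borel sets.\<close>
    define n1 where "n1 = scale_measure (emeasure s B) a"
    define n2 where "n2 = scale_measure S0 (distr (density QB (\<lambda>q. indicator B (hat q))) borel norm)"
    have n2: "emeasure n2 C = S0 * emeasure lborel {q. norm q \<in> C \<and> norm q \<le> R \<and> hat q \<in> B}" if [measurable]: "C \<in> sets borel" for C
    proof -
      have "emeasure n2 C = S0 * emeasure (density QB (\<lambda>q. indicator B (hat q))) {q. norm q \<in> C}"
        unfolding n2_def by (simp add: emeasure_distr vimage_def QB_def)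
      also have "emeasure (density QB (\<lambda>q. indicator B (hat q))) {q. norm q \<in> C} = (\<integral>\<^sup>+q. indicator B (hat q) * indicator {q. norm q \<in> C} q \<partial>QB)"
        by (rule emeasure_density) measurable
      also have "\<dots> = (\<integral>\<^sup>+q. indicator {q. norm q \<in> C \<and> hat q \<in> B} q \<partial>QB)"
        by (intro nn_integral_cong) (auto simp: indicator_def)
      also have "\<dots> = emeasure QB {q. norm q \<in> C \<and> hat q \<in> B}" by (rule nn_integral_indicator) measurable
      also have "\<dots> = emeasure lborel (cball 0 R \<inter> {q. norm q \<in> C \<and> hat q \<in> B})" by (rule eQ) measurable
      also have "cball 0 R \<inter> {q. norm q \<in> C \<and> hat q \<in> B} = {q. norm q \<in> C \<and> norm q \<le> R \<and> hat q \<in> B}" by auto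
      finally show ?thesis .
    qed
    have ea: "emeasure a C = emeasure lborel {q::'a. norm q \<in> C \<and> norm q \<le> R \<and> hat q \<in> UNIV}" if [measurable]: "C \<in> sets borel" for C
    proof -
      have "emeasure a C = emeasure QB {q. norm q \<in> C}"
        unfolding a_def by (subst emeasure_distr) (auto simp: vimage_def QB_def)
      also have "\<dots> = emeasure lborel (cball 0 R \<inter> {q::'a. norm q \<in> C})" by (rule eQ) measurable
      also have "cball 0 R \<inter> {q::'a. norm q \<in> C} = {q::'a. norm q \<in> C \<and> norm q \<le> R \<and> hat q \<in> UNIV}" by auto
      finally show ?thesis .
    qed
    have UN: "{q::'a. norm q < 1 \<and> hat q \<in> UNIV} = ball 0 1" by auto
    have "n1 = n2"
    proof (rule measure_eqI_lessThan)
      show "sets n1 = sets borel" "sets n2 = sets borel" by (simp_all add: n1_def n2_def a_def)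
      fix t :: real
      have tb: "{t<..} \<in> sets borel" by simp
      have sB: "emeasure s B < \<infinity>" by (simp add: s.emeasure_eq_measure)
      show "emeasure n1 {t<..} < \<infinity>" unfolding n1_def emeasure_scale_measure using sB
        by (simp add: a.emeasure_eq_measure ennreal_mult_less_top)
      show "emeasure n1 {t<..} = emeasure n2 {t<..}"
        unfolding n1_def emeasure_scale_measure ea[OF tb] n2[OF tb] greaterThan_iff
          emeasure_shell[OF B R] emeasure_shell[OF UB R] es[OF B] UN S0_def
        by (simp add: mult_ac)
    qed
    then have "emeasure n1 A = emeasure n2 A" by simp
    then have "emeasure a A * emeasure s B = S0 * emeasure lborel {q. norm q \<in> A \<and> norm q \<le> R \<and> hat q \<in> B}"
      unfolding n2[OF A] by (simp add: n1_def mult.commute)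
    also have "emeasure lborel {q. norm q \<in> A \<and> norm q \<le> R \<and> hat q \<in> B} = emeasure QB {q. norm q \<in> A \<and> hat q \<in> B}"
      by (subst eQ) (measurable, auto intro!: arg_cong[of _ _ "emeasure lborel"])
    also have "S0 * \<dots> = emeasure m (A \<times> B)"
      unfolding m_def emeasure_scale_measure by (subst emeasure_distr) (auto simp: vimage_def QB_def)
    finally show ?thesis .
  qed
  have pm: "a \<Otimes>\<^sub>M s = m"
  proof (rule pair_measure_eqI)
    show "sigma_finite_measure a" "sigma_finite_measure s" by unfold_locales
    show "sets (a \<Otimes>\<^sub>M s) = sets m"
      by (simp add: a_def s_def m_def cong: sets_pair_measure_cong)
    show "emeasure a A * emeasure s B = emeasure m (A \<times> B)" if "A \<in> sets a" "B \<in> sets s" for A B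
      using that rect by (simp add: a_def s_def)
  qed
  have Hm [measurable]: "H \<in> borel_measurable (borel \<Otimes>\<^sub>M borel)" by (simp add: borel_prod)
  have [measurable_cong]: "sets a = sets borel" "sets s = sets borel" by (simp_all add: a_def s_def)
  interpret as: pair_sigma_finite a s ..
  have QBi: "(\<integral>\<^sup>+q. h q \<partial>QB) = (\<integral>\<^sup>+q. indicator (cball 0 R) q * h q \<partial>lborel)" if "h \<in> borel_measurable borel" for h
    unfolding QB_def using that by (subst nn_integral_density) (auto intro!: borel_measurable_indicator)
  have XBi: "(\<integral>\<^sup>+x. h x \<partial>XB) = (\<integral>\<^sup>+x. indicator (ball 0 1) x * h x \<partial>lborel)" if "h \<in> borel_measurable borel" for h
    unfolding XB_def using that by (subst nn_integral_density) (auto intro!: borel_measurable_indicator)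
  have [measurable]: "(\<lambda>x. \<integral>\<^sup>+q. indicator (cball 0 R) q * H (norm (q::'a), hat x) \<partial>lborel) \<in> borel_measurable borel"
    by measurable
  have "(\<integral>\<^sup>+x. indicator (ball 0 1) x * (\<integral>\<^sup>+q. indicator (cball 0 R) q * H (norm (q::'a), hat x) \<partial>lborel) \<partial>lborel)
     = (\<integral>\<^sup>+x. (\<integral>\<^sup>+q. indicator (cball 0 R) q * H (norm (q::'a), hat x) \<partial>lborel) \<partial>XB)"
    by (rule XBi[symmetric]) measurable
  also have "\<dots> = (\<integral>\<^sup>+x. (\<integral>\<^sup>+q. H (norm q, hat x) \<partial>QB) \<partial>XB)"
    by (intro nn_integral_cong QBi[symmetric]) measurable
  also have "\<dots> = (\<integral>\<^sup>+w. (\<integral>\<^sup>+q. H (norm q, w) \<partial>QB) \<partial>s)"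
    unfolding s_def by (rule nn_integral_distr[symmetric]) measurable
  also have "\<dots> = (\<integral>\<^sup>+w. (\<integral>\<^sup>+r. H (r, w) \<partial>a) \<partial>s)"
    unfolding a_def by (intro nn_integral_cong nn_integral_distr[symmetric]) measurable
  also have "\<dots> = (\<integral>\<^sup>+z. H z \<partial>(a \<Otimes>\<^sub>M s))"
    by (subst as.nn_integral_snd[symmetric]) simp_all
  also have "\<dots> = S0 * (\<integral>\<^sup>+q. H (norm q, hat q) \<partial>QB)"
    unfolding pm m_def by (subst nn_integral_scale_measure) (simp_all add: nn_integral_distr)
  also have "(\<integral>\<^sup>+q. H (norm q, hat q) \<partial>QB) = (\<integral>\<^sup>+q. indicator (cball 0 R) q * H (norm q, hat q) \<partial>lborel)"
    by (rule QBi) measurable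
  finally show ?thesis unfolding S0_def .
qed

text \<open>By \<open>sphere_mass_cong\<close> it suffices to know the angular integral in one direction \<open>e0\<close>.\<close>
locale collision_kernel =
  fixes R P :: real and \<Phi> b :: "real \<Rightarrow> real" and e0 :: "real^'n::finite"
  assumes R: "R > 0"
    and \<Phi>_nonneg: "\<And>r. 0 \<le> r \<Longrightarrow> 0 \<le> \<Phi> r" and \<Phi>_le: "\<And>r. 0 \<le> r \<Longrightarrow> r \<le> R \<Longrightarrow> \<Phi> r \<le> P"
    and \<Phi>_meas [measurable]: "\<Phi> \<in> borel_measurable borel"
    and b_nonneg: "\<And>s. 0 \<le> b s"
    and b_meas [measurable]: "b \<in> borel_measurable borel"
    and e0: "norm e0 = 1" and finite_mass: "sphere_mass b e0 < \<infinity>"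
begin

section \<open>The collision kernel as a finite measure\<close>

lemma P_nonneg: "0 \<le> P"
  using \<Phi>_nonneg[of R] \<Phi>_le[of R] R by simp

text \<open>The whole density of the collision integral in the pair (q, x), where x in the unit ball
  stands for \<open>\<sigma> = hat x\<close>; the dimension factor is that of
  \<open>sphere_int\<close>.\<close>

definition weight :: "real^'n \<Rightarrow> real^'n \<Rightarrow> real" where
  "weight q x = indicator (cball 0 R) q * (indicator (ball 0 1) x * (CARD('n) * \<Phi> (norm q) * b (hat x \<bullet> hat q)))"

lemma weight_nonneg: "0 \<le> weight q x"
  by (simp add: weight_def \<Phi>_nonneg b_nonneg)

lemma weight_measurable [measurable]: "(\<lambda>z. weight (fst z) (snd z)) \<in> borel_measurable (borel \<Otimes>\<^sub>M borel)"
proof -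
  show ?thesis unfolding weight_def by measurable
qed

text \<open>Makes the iterated collision integral a single integral against a finite measure, so
  that Cauchy-Schwarz and Fubini apply directly.\<close>

definition kmeasure :: "((real^'n) \<times> (real^'n)) measure" where
  "kmeasure = density (lborel \<Otimes>\<^sub>M lborel) (\<lambda>z. ennreal (weight (fst z) (snd z)))"

lemma sets_kmeasure [measurable_cong]: "sets kmeasure = sets (borel \<Otimes>\<^sub>M borel)"
  by (simp add: kmeasure_def cong: sets_pair_measure_cong)

lemma nn_integral_kmeasure:
  assumes [measurable]: "F \<in> borel_measurable (borel \<Otimes>\<^sub>M borel)"
  shows "(\<integral>\<^sup>+z. F z \<partial>kmeasure) = (\<integral>\<^sup>+q. (\<integral>\<^sup>+x. ennreal (weight q x) * F (q, x) \<partial>lborel) \<partial>lborel)"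
proof -
  have "(\<integral>\<^sup>+z. F z \<partial>kmeasure) = (\<integral>\<^sup>+z. ennreal (weight (fst z) (snd z)) * F z \<partial>(lborel \<Otimes>\<^sub>M lborel))"
    unfolding kmeasure_def by (rule nn_integral_density) measurable
  also have "\<dots> = (\<integral>\<^sup>+q. (\<integral>\<^sup>+x. ennreal (weight q x) * F (q, x) \<partial>lborel) \<partial>lborel)"
    by (subst lborel.nn_integral_fst[symmetric]) simp_all
  finally show ?thesis .
qed

lemma ennreal_weight:
  "ennreal (weight q x) = indicator (cball 0 R) q * (indicator (ball 0 1) x * (ennreal (CARD('n) * \<Phi> (norm q)) * ennreal (b (hat x \<bullet> hat q))))"
  by (simp add: weight_def \<Phi>_nonneg b_nonneg ennreal_mult indicator_def)

definition kconst :: real where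
  "kconst = CARD('n) * P * enn2real (sphere_mass b e0)"

lemma kconst_nonneg: "0 \<le> kconst"
  by (simp add: kconst_def P_nonneg)

lemma sphere_mass_eq: "norm e = 1 \<Longrightarrow> sphere_mass b e = ennreal (enn2real (sphere_mass b e0))" for e :: "real^'n"
  using sphere_mass_cong[OF b_meas, of e e0] e0 finite_mass by (simp add: less_top[symmetric])

lemma hat_unit: "q \<noteq> 0 \<Longrightarrow> norm (hat q) = 1" for q :: "real^'n"
  by simp

lemma AE_nonzero: "AE q in lborel. q \<noteq> (0 :: real^'n)"
proof -
  have "AE q in lborel. q \<notin> {0 :: real^'n}" by (rule AE_not_in) (simp add: null_sets_def)
  then show ?thesis by simp
qed

lemma ennreal_\<Phi>_le: "norm q \<le> R \<Longrightarrow> ennreal (CARD('n) * \<Phi> (norm q)) * ennreal (enn2real (sphere_mass b e0)) \<le> ennreal kconst" for q :: "real^'n"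
  unfolding kconst_def using \<Phi>_nonneg[of "norm q"] \<Phi>_le[of "norm q"]
  by (simp add: ennreal_mult[symmetric] ennreal_leI mult_left_mono mult_right_mono)

text \<open>Integrating out x leaves \<open>\<Phi>\<close> times the angular mass, and that mass is
  the same for every q other than 0. This is the law of the shift in the loss term.\<close>

lemma kmeasure_marginal_velocity:
  fixes F :: "real^'n \<Rightarrow> ennreal"
  assumes [measurable]: "F \<in> borel_measurable borel"
  shows "(\<integral>\<^sup>+z. F (fst z) \<partial>kmeasure) \<le> ennreal kconst * (\<integral>\<^sup>+q. indicator (cball 0 R) q * F q \<partial>lborel)"
proof -
  have "(\<integral>\<^sup>+z. F (fst z) \<partial>kmeasure) = (\<integral>\<^sup>+q. (\<integral>\<^sup>+x. ennreal (weight q x) * F q \<partial>lborel) \<partial>lborel)"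
    by (subst nn_integral_kmeasure) simp_all
  also have "\<dots> \<le> (\<integral>\<^sup>+q. ennreal kconst * (indicator (cball 0 R) q * F q) \<partial>lborel)"
  proof (rule nn_integral_mono_AE)
    show "AE q in lborel. (\<integral>\<^sup>+x. ennreal (weight q x) * F q \<partial>lborel) \<le> ennreal kconst * (indicator (cball 0 R) q * F q)"
      using AE_nonzero
    proof eventually_elim
      case (elim q)
      define c where "c = indicator (cball 0 R) q * ennreal (CARD('n) * \<Phi> (norm q)) * F q"
      have "(\<integral>\<^sup>+x. ennreal (weight q x) * F q \<partial>lborel) = (\<integral>\<^sup>+x. c * (indicator (ball 0 1) x * ennreal (b (hat x \<bullet> hat q))) \<partial>lborel)"
        unfolding ennreal_weight c_def by (intro nn_integral_cong) (simp only: mult_ac)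
      also have "\<dots> = c * sphere_mass b (hat q)"
        unfolding sphere_mass_def by (rule nn_integral_cmult) measurable
      also have "\<dots> = indicator (cball 0 R) q * F q * (ennreal (CARD('n) * \<Phi> (norm q)) * ennreal (enn2real (sphere_mass b e0)))"
        unfolding sphere_mass_eq[OF hat_unit[OF elim]] c_def by (simp only: mult_ac)
      also have "\<dots> \<le> indicator (cball 0 R) q * F q * ennreal kconst"
        using ennreal_\<Phi>_le[of q] by (cases "norm q \<le> R") (auto intro!: mult_left_mono)
      finally show ?case by (simp only: mult_ac)
    qed
  qed
  also have "\<dots> = ennreal kconst * (\<integral>\<^sup>+q. indicator (cball 0 R) q * F q \<partial>lborel)"
    by (rule nn_integral_cmult) measurable
  finally show ?thesis .
qed

text \<open>Exchanging the directions of \<open>q\<close> and \<open>\<sigma>\<close> preserves the kernel; this replaces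
  the usual change of variables for the gain term.\<close>
lemma kmeasure_marginal_deflection:
  fixes F :: "real^'n \<Rightarrow> ennreal"
  assumes [measurable]: "F \<in> borel_measurable borel"
  shows "(\<integral>\<^sup>+z. F (norm (fst z) *\<^sub>R hat (snd z)) \<partial>kmeasure) \<le> ennreal kconst * (\<integral>\<^sup>+q. indicator (cball 0 R) q * F q \<partial>lborel)"
proof -
  define S0 where "S0 = emeasure lborel (ball (0 :: real^'n) 1)"
  have S0: "S0 \<noteq> 0" "S0 < \<infinity>"
    unfolding S0_def by (simp add: emeasure_ball unit_ball_vol_pos ennreal_eq_0_iff not_le, rule emeasure_bounded_finite, simp)
  define K where "K r w = ennreal (CARD('n) * \<Phi> r) * F (r *\<^sub>R w)" for r and w :: "real^'n"
  have [measurable]: "(\<lambda>z. K (f z) (g z)) \<in> borel_measurable N"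
    if "f \<in> borel_measurable N" "g \<in> borel_measurable N" for f and g :: "'z \<Rightarrow> real^'n" and N
    unfolding K_def using that by measurable
  have [measurable]: "(\<lambda>z. ennreal (b (f z \<bullet> g z))) \<in> borel_measurable N"
    if [measurable]: "f \<in> borel_measurable N" "g \<in> borel_measurable N" for f g :: "'z \<Rightarrow> real^'n" and N
    by measurable
  have "(\<integral>\<^sup>+z. F (norm (fst z) *\<^sub>R hat (snd z)) \<partial>kmeasure) = (\<integral>\<^sup>+q. (\<integral>\<^sup>+x. ennreal (weight q x) * F (norm q *\<^sub>R hat x) \<partial>lborel) \<partial>lborel)"
    by (subst nn_integral_kmeasure) simp_all
  also have "\<dots> = (\<integral>\<^sup>+x. (\<integral>\<^sup>+q. ennreal (weight q x) * F (norm q *\<^sub>R hat x) \<partial>lborel) \<partial>lborel)"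
    by (rule lborel_pair.Fubini'[symmetric]) measurable
  also have "\<dots> = (\<integral>\<^sup>+x. indicator (ball 0 1) x * (\<integral>\<^sup>+q. indicator (cball 0 R) q * (K (norm q) (hat x) * ennreal (b (hat x \<bullet> hat q))) \<partial>lborel) \<partial>lborel)"
    unfolding ennreal_weight K_def
    by (intro nn_integral_cong, subst nn_integral_cmult[symmetric]) (measurable, simp only: mult_ac)
  finally have "S0 * (\<integral>\<^sup>+z. F (norm (fst z) *\<^sub>R hat (snd z)) \<partial>kmeasure) =
    (\<integral>\<^sup>+x. indicator (ball 0 1) x * (S0 * (\<integral>\<^sup>+q. indicator (cball 0 R) q * (K (norm q) (hat x) * ennreal (b (hat x \<bullet> hat q))) \<partial>lborel)) \<partial>lborel)"
    by (simp add: nn_integral_cmult[symmetric] mult.left_commute)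
  \<comment> \<open>\<open>nn_integral_polar\<close> read from right to left, after multiplying by
    S0: q is replaced by its radius and an independent direction y.\<close>
  also have "\<dots> = (\<integral>\<^sup>+x. indicator (ball 0 1) x * (\<integral>\<^sup>+y. indicator (ball 0 1) y * (\<integral>\<^sup>+q. indicator (cball 0 R) q * (K (norm (q :: real^'n)) (hat x) * ennreal (b (hat x \<bullet> hat y))) \<partial>lborel) \<partial>lborel) \<partial>lborel)"
  proof (intro nn_integral_cong arg_cong2[of _ _ _ _ "(*)"] refl)
    fix x :: "real^'n"
    show "S0 * (\<integral>\<^sup>+q. indicator (cball 0 R) q * (K (norm q) (hat x) * ennreal (b (hat x \<bullet> hat q))) \<partial>lborel) =
      (\<integral>\<^sup>+y. indicator (ball 0 1) y * (\<integral>\<^sup>+q. indicator (cball 0 R) q * (K (norm (q :: real^'n)) (hat x) * ennreal (b (hat x \<bullet> hat y))) \<partial>lborel) \<partial>lborel)"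
      unfolding S0_def using nn_integral_polar[of "\<lambda>z. K (fst z) (hat x) * ennreal (b (hat x \<bullet> snd z))" R] R
      by (simp add: borel_prod[symmetric])
  qed
  \<comment> \<open>The inner product is symmetric, so y can now be integrated out and leaves the
    angular mass for direction x.\<close>
  also have "\<dots> = (\<integral>\<^sup>+x. indicator (ball 0 1) x * (sphere_mass b (hat x) * (\<integral>\<^sup>+q. indicator (cball 0 R) q * K (norm (q :: real^'n)) (hat x) \<partial>lborel)) \<partial>lborel)"
  proof (intro nn_integral_cong arg_cong2[of _ _ _ _ "(*)"] refl)
    fix x :: "real^'n"
    define J where "J = (\<integral>\<^sup>+q. indicator (cball 0 R) q * K (norm (q :: real^'n)) (hat x) \<partial>lborel)"
    have J: "(\<integral>\<^sup>+q. indicator (cball 0 R) q * (K (norm (q :: real^'n)) (hat x) * c) \<partial>lborel) = J * c" for c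
      unfolding J_def mult.assoc[symmetric] by (rule nn_integral_multc) measurable
    have "(\<integral>\<^sup>+y. indicator (ball 0 1) y * (J * ennreal (b (hat x \<bullet> hat y))) \<partial>lborel) = (\<integral>\<^sup>+y. indicator (ball 0 1) y * ennreal (b (hat y \<bullet> hat x)) * J \<partial>lborel)"
      by (intro nn_integral_cong) (simp only: inner_commute mult_ac)
    also have "\<dots> = sphere_mass b (hat x) * J"
      unfolding sphere_mass_def by (rule nn_integral_multc) measurable
    finally show "(\<integral>\<^sup>+y. indicator (ball 0 1) y * (\<integral>\<^sup>+q. indicator (cball 0 R) q * (K (norm (q :: real^'n)) (hat x) * ennreal (b (hat x \<bullet> hat y))) \<partial>lborel) \<partial>lborel)
      = sphere_mass b (hat x) * (\<integral>\<^sup>+q. indicator (cball 0 R) q * K (norm (q :: real^'n)) (hat x) \<partial>lborel)"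
      unfolding J J_def[symmetric] .
  qed
  also have "\<dots> = (\<integral>\<^sup>+x. ennreal (enn2real (sphere_mass b e0)) * (indicator (ball 0 1) x * (\<integral>\<^sup>+q. indicator (cball 0 R) q * K (norm (q :: real^'n)) (hat x) \<partial>lborel)) \<partial>lborel)"
  proof (rule nn_integral_cong_AE)
    show "AE x in lborel. indicator (ball 0 1) x * (sphere_mass b (hat x) * (\<integral>\<^sup>+q. indicator (cball 0 R) q * K (norm (q :: real^'n)) (hat x) \<partial>lborel))
     = ennreal (enn2real (sphere_mass b e0)) * (indicator (ball 0 1) x * (\<integral>\<^sup>+q. indicator (cball 0 R) q * K (norm (q :: real^'n)) (hat x) \<partial>lborel))"
      using AE_nonzero
    proof eventually_elim
      case (elim x)
      show ?case unfolding sphere_mass_eq[OF hat_unit[OF elim]] by (simp only: mult_ac)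
    qed
  qed
  \<comment> \<open>\<open>nn_integral_polar\<close> read from left to right: the radius of q and
    the direction of x are fused into one vector, on which F is evaluated.\<close>
  also have "\<dots> = ennreal (enn2real (sphere_mass b e0)) * (S0 * (\<integral>\<^sup>+q. indicator (cball 0 R) q * K (norm (q :: real^'n)) (hat q) \<partial>lborel))"
    unfolding S0_def using nn_integral_polar[of "\<lambda>z. K (fst z) (snd z :: real^'n)" R] R
    by (subst nn_integral_cmult) (measurable, simp add: borel_prod[symmetric])
  also have "\<dots> = S0 * (\<integral>\<^sup>+q. ennreal (enn2real (sphere_mass b e0)) * (indicator (cball 0 R) q * K (norm (q :: real^'n)) (hat q)) \<partial>lborel)"
    by (subst nn_integral_cmult) (measurable, simp only: mult_ac)
  finally have "(\<integral>\<^sup>+z. F (norm (fst z) *\<^sub>R hat (snd z)) \<partial>kmeasure)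
     = (\<integral>\<^sup>+q. ennreal (enn2real (sphere_mass b e0)) * (indicator (cball 0 R) q * K (norm (q :: real^'n)) (hat q)) \<partial>lborel)"
    using S0 by (auto simp: ennreal_mult_cancel_left)
  also have "\<dots> \<le> (\<integral>\<^sup>+q. ennreal kconst * (indicator (cball 0 R) q * F q) \<partial>lborel)"
  proof (rule nn_integral_mono)
    fix q :: "real^'n"
    have "ennreal (enn2real (sphere_mass b e0)) * (indicator (cball 0 R) q * K (norm q) (hat q))
      = indicator (cball 0 R) q * F q * (ennreal (CARD('n) * \<Phi> (norm q)) * ennreal (enn2real (sphere_mass b e0)))"
      \<comment> \<open>At q = 0 both sides evaluate F at 0, because
        \<open>hat 0 = 0\<close>.\<close>
      unfolding K_def by (cases "q = 0") (simp_all add: mult_ac)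
    also have "\<dots> \<le> indicator (cball 0 R) q * F q * ennreal kconst"
      using ennreal_\<Phi>_le[of q] by (cases "norm q \<le> R") (auto intro!: mult_left_mono)
    finally show "ennreal (enn2real (sphere_mass b e0)) * (indicator (cball 0 R) q * K (norm q) (hat q)) \<le> ennreal kconst * (indicator (cball 0 R) q * F q)"
      by (simp only: mult_ac)
  qed
  also have "\<dots> = ennreal kconst * (\<integral>\<^sup>+q. indicator (cball 0 R) q * F q \<partial>lborel)"
    by (rule nn_integral_cmult) measurable
  finally show ?thesis .
qed

lemma finite_kmeasure: "finite_measure kmeasure"
proof
  have "emeasure kmeasure (space kmeasure) = (\<integral>\<^sup>+z. (\<lambda>_. 1) (fst z) \<partial>kmeasure)" by simp
  also have "\<dots> \<le> ennreal kconst * (\<integral>\<^sup>+q. indicator (cball (0 :: real^'n) R) q * 1 \<partial>lborel)"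
    by (rule kmeasure_marginal_velocity) simp
  also have "\<dots> < \<infinity>"
    using emeasure_bounded_finite[of "cball (0 :: real^'n) R"] by (simp add: ennreal_mult_less_top)
  finally show "emeasure kmeasure (space kmeasure) \<noteq> \<infinity>" by simp
qed

end

text \<open>Covers gain and loss at once. After Cauchy-Schwarz in \<open>\<rho>\<close>, translating
  v by \<open>\<alpha>\<close> over one period leaves only the difference
  \<open>\<alpha> - \<gamma>\<close> in the argument of f. The kernel hypothesis bounds the law of
  this difference by Lebesgue measure on a ball: it is \<open>|q| \<sigma>\<close> for the gain and
  q for the loss.\<close>

lemma nn_integral_bilinear_bound:
  fixes \<alpha> \<gamma> :: "'z \<Rightarrow> real^'n::finite" and g f :: "real^'n \<Rightarrow> real"
  assumes \<rho>: "finite_measure \<rho>" and L: "0 < L" "R \<le> L" and C: "0 \<le> C"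
    and \<alpha>\<gamma> [measurable]: "\<alpha> \<in> borel_measurable \<rho>" "\<gamma> \<in> borel_measurable \<rho>"
    and kernel: "\<And>F. F \<in> borel_measurable borel \<Longrightarrow>
      (\<integral>\<^sup>+z. F (\<alpha> z - \<gamma> z) \<partial>\<rho>) \<le> ennreal C * (\<integral>\<^sup>+q. indicator (cball 0 R) q * F q \<partial>lborel)"
    and g: "periodic_L L g" "sq_int (MD L) g" and f: "periodic_L L f" "sq_int (MD L) f"
  shows "(\<integral>\<^sup>+v. (\<integral>\<^sup>+z. ennreal \<bar>g (v - \<alpha> z) * f (v - \<gamma> z)\<bar> \<partial>\<rho>)\<^sup>2 \<partial>MD L)
    \<le> ennreal (measure \<rho> (space \<rho>) * C * ((norm2 (MD L) g)\<^sup>2 * (norm2 (MD L) f)\<^sup>2))"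
proof -
  interpret \<rho>: finite_measure \<rho> by (rule \<rho>)
  interpret P: pair_sigma_finite "MD L :: (real^'n) measure" \<rho> ..
  have gm [measurable]: "g \<in> borel_measurable borel" and fm [measurable]: "f \<in> borel_measurable borel"
    using periodic_borel_measurable[OF L(1)] g f sq_int_measurable by blast+
  have id [measurable]: "(\<lambda>v. v) \<in> MD L \<rightarrow>\<^sub>M (borel :: (real^'n) measure)"
    by (rule borel_measurable_MD) simp
  have fst [measurable]: "fst \<in> MD L \<Otimes>\<^sub>M \<rho> \<rightarrow>\<^sub>M (borel :: (real^'n) measure)"
    by (rule measurable_compose[OF measurable_fst id])
  define G where "G v = ennreal ((g v)\<^sup>2)" for v
  define F where "F v = ennreal ((f v)\<^sup>2)" for v
  have [measurable]: "G \<in> borel_measurable borel" "F \<in> borel_measurable borel"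
    unfolding G_def F_def by measurable
  define E where "E = emeasure \<rho> (space \<rho>)"
  have E: "E = ennreal (measure \<rho> (space \<rho>))" by (simp add: E_def \<rho>.emeasure_eq_measure)
  have 1: "(\<integral>\<^sup>+z. ennreal \<bar>g (v - \<alpha> z) * f (v - \<gamma> z)\<bar> \<partial>\<rho>)\<^sup>2 \<le> E * (\<integral>\<^sup>+z. G (v - \<alpha> z) * F (v - \<gamma> z) \<partial>\<rho>)" for v
  proof -
    \<comment> \<open>Pairing with the constant 1 produces the total mass of
      \<open>\<rho>\<close>.\<close>
    have "(\<integral>\<^sup>+z. 1 * ennreal \<bar>g (v - \<alpha> z) * f (v - \<gamma> z)\<bar> \<partial>\<rho>)\<^sup>2
      \<le> (\<integral>\<^sup>+z. 1\<^sup>2 \<partial>\<rho>) * (\<integral>\<^sup>+z. (ennreal \<bar>g (v - \<alpha> z) * f (v - \<gamma> z)\<bar>)\<^sup>2 \<partial>\<rho>)"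
      by (rule Cauchy_Schwarz_nn_integral) measurable
    moreover have "(ennreal \<bar>x * y\<bar>)\<^sup>2 = ennreal (x\<^sup>2) * ennreal (y\<^sup>2)" for x y
      by (simp add: ennreal_power ennreal_mult[symmetric] power_mult_distrib)
    ultimately show ?thesis by (simp add: E_def G_def F_def)
  qed
  have "(\<integral>\<^sup>+v. (\<integral>\<^sup>+z. ennreal \<bar>g (v - \<alpha> z) * f (v - \<gamma> z)\<bar> \<partial>\<rho>)\<^sup>2 \<partial>MD L)
     \<le> (\<integral>\<^sup>+v. E * (\<integral>\<^sup>+z. G (v - \<alpha> z) * F (v - \<gamma> z) \<partial>\<rho>) \<partial>MD L)"
    by (intro nn_integral_mono 1)
  also have "\<dots> = E * (\<integral>\<^sup>+v. (\<integral>\<^sup>+z. G (v - \<alpha> z) * F (v - \<gamma> z) \<partial>\<rho>) \<partial>MD L)"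
    by (rule nn_integral_cmult) measurable
  finally have 2: "(\<integral>\<^sup>+v. (\<integral>\<^sup>+z. ennreal \<bar>g (v - \<alpha> z) * f (v - \<gamma> z)\<bar> \<partial>\<rho>)\<^sup>2 \<partial>MD L)
     \<le> E * (\<integral>\<^sup>+v. (\<integral>\<^sup>+z. G (v - \<alpha> z) * F (v - \<gamma> z) \<partial>\<rho>) \<partial>MD L)" .
  have "(\<integral>\<^sup>+v. (\<integral>\<^sup>+z. G (v - \<alpha> z) * F (v - \<gamma> z) \<partial>\<rho>) \<partial>MD L) = (\<integral>\<^sup>+z. (\<integral>\<^sup>+v. G (v - \<alpha> z) * F (v - \<gamma> z) \<partial>MD L) \<partial>\<rho>)"
    by (rule P.Fubini'[symmetric]) measurable
  also have "\<dots> = (\<integral>\<^sup>+z. (\<integral>\<^sup>+v. G v * F (v + (\<alpha> z - \<gamma> z)) \<partial>MD L) \<partial>\<rho>)"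
  proof (rule nn_integral_cong)
    fix z
    have "(\<integral>\<^sup>+v. G (v + - \<alpha> z) * F ((v + - \<alpha> z) + (\<alpha> z - \<gamma> z)) \<partial>MD L) = (\<integral>\<^sup>+v. G v * F (v + (\<alpha> z - \<gamma> z)) \<partial>MD L)"
    proof (rule nn_integral_MD_shift[OF L(1), of "\<lambda>v. G v * F (v + (\<alpha> z - \<gamma> z))"])
      fix v and m :: "int^'n"
      have "v + lat L m + (\<alpha> z - \<gamma> z) = v + (\<alpha> z - \<gamma> z) + lat L m" by simp
      then show "G (v + lat L m) * F (v + lat L m + (\<alpha> z - \<gamma> z)) = G v * F (v + (\<alpha> z - \<gamma> z))"
        by (simp only: G_def F_def periodic_lat[OF g(1)] periodic_lat[OF f(1)])
    qed measurable
    then show "(\<integral>\<^sup>+v. G (v - \<alpha> z) * F (v - \<gamma> z) \<partial>MD L) = (\<integral>\<^sup>+v. G v * F (v + (\<alpha> z - \<gamma> z)) \<partial>MD L)" by simp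
  qed
  also have "\<dots> = (\<integral>\<^sup>+v. (\<integral>\<^sup>+z. G v * F (v + (\<alpha> z - \<gamma> z)) \<partial>\<rho>) \<partial>MD L)"
    by (rule P.Fubini') measurable
  also have "\<dots> \<le> (\<integral>\<^sup>+v. G v * (ennreal C * ennreal ((norm2 (MD L) f)\<^sup>2)) \<partial>MD L)"
  proof (rule nn_integral_mono)
    fix v :: "real^'n"
    have "(\<integral>\<^sup>+z. F (v + (\<alpha> z - \<gamma> z)) \<partial>\<rho>) \<le> ennreal C * (\<integral>\<^sup>+q. indicator (cball 0 R) q * F (v + q) \<partial>lborel)"
      by (rule kernel) measurable
    \<comment> \<open>Here \<open>R \<le> L\<close> is used: the ball of radius R lies in one period
      cube, so the integral is at most the squared norm of f.\<close>
    also have "(\<integral>\<^sup>+q. indicator (cball 0 R) q * F (v + q) \<partial>lborel) \<le> (\<integral>\<^sup>+q. F (q + v) * indicator (dom_L L) q \<partial>lborel)"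
    proof (rule nn_integral_mono)
      fix q :: "real^'n"
      have "q \<in> dom_L L" if "norm q \<le> R"
      proof -
        have "\<bar>q $ j\<bar> \<le> L" for j using component_le_norm_cart[of q j] that L by simp
        then show ?thesis by (simp add: mem_dom_L abs_le_iff) (metis minus_le_iff)
      qed
      then show "indicator (cball 0 R) q * F (v + q) \<le> F (q + v) * indicator (dom_L L) q"
        by (auto simp: indicator_def add.commute)
    qed
    also have "\<dots> = (\<integral>\<^sup>+q. F (q + v) \<partial>MD L)" by (simp add: nn_integral_restrict_space)
    also have "\<dots> = (\<integral>\<^sup>+q. F q \<partial>MD L)"
      by (rule nn_integral_MD_shift[OF L(1)]) (simp_all add: F_def periodic_lat[OF f(1)])
    also have "\<dots> = ennreal ((norm2 (MD L) f)\<^sup>2)" unfolding F_def by (rule MD.ennreal_norm2[OF f(2)])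
    finally have "(\<integral>\<^sup>+z. F (v + (\<alpha> z - \<gamma> z)) \<partial>\<rho>) \<le> ennreal C * ennreal ((norm2 (MD L) f)\<^sup>2)"
      by (simp add: mult_left_mono)
    then have "G v * (\<integral>\<^sup>+z. F (v + (\<alpha> z - \<gamma> z)) \<partial>\<rho>) \<le> G v * (ennreal C * ennreal ((norm2 (MD L) f)\<^sup>2))"
      by (intro mult_left_mono) auto
    then show "(\<integral>\<^sup>+z. G v * F (v + (\<alpha> z - \<gamma> z)) \<partial>\<rho>) \<le> G v * (ennreal C * ennreal ((norm2 (MD L) f)\<^sup>2))"
      by (subst nn_integral_cmult) measurable
  qed
  also have "\<dots> = ennreal ((norm2 (MD L) g)\<^sup>2) * (ennreal C * ennreal ((norm2 (MD L) f)\<^sup>2))"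
    unfolding MD.ennreal_norm2[OF g(2), symmetric] G_def by (rule nn_integral_multc) measurable
  finally have "(\<integral>\<^sup>+v. (\<integral>\<^sup>+z. G (v - \<alpha> z) * F (v - \<gamma> z) \<partial>\<rho>) \<partial>MD L)
    \<le> ennreal ((norm2 (MD L) g)\<^sup>2) * (ennreal C * ennreal ((norm2 (MD L) f)\<^sup>2))" .
  then have "E * (\<integral>\<^sup>+v. (\<integral>\<^sup>+z. G (v - \<alpha> z) * F (v - \<gamma> z) \<partial>\<rho>) \<partial>MD L)
    \<le> E * (ennreal ((norm2 (MD L) g)\<^sup>2) * (ennreal C * ennreal ((norm2 (MD L) f)\<^sup>2)))"
    by (intro mult_left_mono) auto
  also have "\<dots> = ennreal (measure \<rho> (space \<rho>) * C * ((norm2 (MD L) g)\<^sup>2 * (norm2 (MD L) f)\<^sup>2))"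
    using C by (simp add: E ennreal_mult[symmetric] mult_ac)
  finally show ?thesis using 2 by (rule order_trans[rotated])
qed

lemma ennreal_power2_sum_le: "((a::ennreal) + b)\<^sup>2 \<le> 2 * (a\<^sup>2 + b\<^sup>2)"
proof (cases a b rule: ennreal2_cases)
  case (real_real x y)
  have "(x + y)\<^sup>2 \<le> 2 * (x\<^sup>2 + y\<^sup>2)" using sum_squares_bound[of x y] by (simp add: power2_sum)
  then have "ennreal ((x + y)\<^sup>2) \<le> ennreal (2 * (x\<^sup>2 + y\<^sup>2))" by (rule ennreal_leI)
  moreover have "(a + b)\<^sup>2 = ennreal ((x + y)\<^sup>2)"
    using real_real by (simp add: ennreal_plus[symmetric] ennreal_power del: ennreal_plus)
  moreover have "2 * (a\<^sup>2 + b\<^sup>2) = ennreal (2 * (x\<^sup>2 + y\<^sup>2))"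
    using real_real by (simp add: ennreal_mult ennreal_power)
  ultimately show ?thesis by simp
qed (simp_all add: power2_eq_square ennreal_mult_top ennreal_top_mult)

lemma ennreal_power2_sum4_le: "((a::ennreal) + b + (c + d))\<^sup>2 \<le> 4 * (a\<^sup>2 + b\<^sup>2 + (c\<^sup>2 + d\<^sup>2))"
proof -
  have "(a + b + (c + d))\<^sup>2 \<le> 2 * ((a + b)\<^sup>2 + (c + d)\<^sup>2)" by (rule ennreal_power2_sum_le)
  also have "\<dots> \<le> 2 * (2 * (a\<^sup>2 + b\<^sup>2) + 2 * (c\<^sup>2 + d\<^sup>2))"
    by (intro mult_left_mono add_mono ennreal_power2_sum_le) auto
  also have "\<dots> = 4 * (a\<^sup>2 + b\<^sup>2 + (c\<^sup>2 + d\<^sup>2))" by (simp add: distrib_left mult.assoc[symmetric])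
  finally show ?thesis .
qed

context collision_kernel
begin

interpretation kmeasure: finite_measure kmeasure by (rule finite_kmeasure)

definition vplus :: "(real^'n) \<times> (real^'n) \<Rightarrow> real^'n" where
  "vplus z = (1/2) *\<^sub>R (fst z + norm (fst z) *\<^sub>R hat (snd z))"

definition vminus :: "(real^'n) \<times> (real^'n) \<Rightarrow> real^'n" where
  "vminus z = (1/2) *\<^sub>R (fst z - norm (fst z) *\<^sub>R hat (snd z))"

lemma vpm_measurable [measurable]:
  "vplus \<in> borel_measurable (borel \<Otimes>\<^sub>M borel)" "vminus \<in> borel_measurable (borel \<Otimes>\<^sub>M borel)"
  unfolding vplus_def vminus_def by measurable

definition gain :: "(real^'n \<Rightarrow> real) \<Rightarrow> (real^'n \<Rightarrow> real) \<Rightarrow> real^'n \<Rightarrow> ennreal" where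
  "gain g f v = (\<integral>\<^sup>+z. ennreal \<bar>g (v - vplus z) * f (v - vminus z)\<bar> \<partial>kmeasure)"

text \<open>The argument \<open>v - 0\<close> keeps the shape \<open>v - \<gamma> z\<close> of the
  bilinear bound, with \<open>\<gamma> = 0\<close>.\<close>

definition loss :: "(real^'n \<Rightarrow> real) \<Rightarrow> (real^'n \<Rightarrow> real) \<Rightarrow> real^'n \<Rightarrow> ennreal" where
  "loss g f v = (\<integral>\<^sup>+z. ennreal \<bar>g (v - fst z) * f (v - 0)\<bar> \<partial>kmeasure)"

definition kbound :: real where
  "kbound = measure kmeasure (space kmeasure) * kconst"

lemma kbound_nonneg: "0 \<le> kbound"
  by (simp add: kbound_def kconst_nonneg)

text \<open>The two marginal estimates are exactly the kernel hypotheses of the bilinear bound,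
  since \<open>vplus - vminus\<close> is the deflected vector \<open>|q| \<sigma>\<close>.\<close>

lemma gain_loss_bound:
  assumes L: "R \<le> L"
    and g: "periodic_L L g" "sq_int (MD L) g" and f: "periodic_L L f" "sq_int (MD L) f"
  shows "(\<integral>\<^sup>+v. (gain g f v)\<^sup>2 \<partial>MD L) \<le> ennreal (kbound * ((norm2 (MD L) g)\<^sup>2 * (norm2 (MD L) f)\<^sup>2))"
    and "(\<integral>\<^sup>+v. (loss g f v)\<^sup>2 \<partial>MD L) \<le> ennreal (kbound * ((norm2 (MD L) g)\<^sup>2 * (norm2 (MD L) f)\<^sup>2))"
proof -
  have L0: "L > 0" using L R by simp
  have eq: "vplus z - vminus z = norm (fst z) *\<^sub>R hat (snd z)" for z
  proof -
    have "(1/2) *\<^sub>R (a + c) - (1/2) *\<^sub>R (a - c) = c" for a c :: "real^'n"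
      by (simp add: vec_eq_iff field_simps)
    then show ?thesis by (simp only: vplus_def vminus_def)
  qed
  show "(\<integral>\<^sup>+v. (gain g f v)\<^sup>2 \<partial>MD L) \<le> ennreal (kbound * ((norm2 (MD L) g)\<^sup>2 * (norm2 (MD L) f)\<^sup>2))"
    unfolding gain_def kbound_def
    by (rule nn_integral_bilinear_bound[OF finite_kmeasure L0 L kconst_nonneg _ _ _ g f])
       (measurable, measurable, simp only: eq kmeasure_marginal_deflection)
  show "(\<integral>\<^sup>+v. (loss g f v)\<^sup>2 \<partial>MD L) \<le> ennreal (kbound * ((norm2 (MD L) g)\<^sup>2 * (norm2 (MD L) f)\<^sup>2))"
    unfolding loss_def kbound_def
    by (rule nn_integral_bilinear_bound[OF finite_kmeasure L0 L kconst_nonneg _ _ _ g f])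
       (measurable, measurable, simp only: diff_zero kmeasure_marginal_velocity)
qed

abbreviation Q :: "(real^'n \<Rightarrow> real) \<Rightarrow> real^'n \<Rightarrow> real" where
  "Q f \<equiv> QR R \<Phi> b f f"

lemma QR_measurable:
  fixes f :: "real^'n \<Rightarrow> real"
  assumes [measurable]: "f \<in> borel_measurable borel"
  shows "Q f \<in> borel_measurable borel"
proof -
  show ?thesis unfolding QR_def sphere_int_def set_lebesgue_integral_def by measurable
qed

lemma gain_measurable [measurable]:
  assumes [measurable]: "g \<in> borel_measurable borel" "f \<in> borel_measurable borel"
  shows "gain g f \<in> borel_measurable borel" "loss g f \<in> borel_measurable borel"
  unfolding gain_def loss_def by measurable

text \<open>The nested integrals of \<open>QR\<close> merge into one only under absolute
  integrability, which is known for almost every v, namely where gain and loss are finite.\<close>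

lemma QR_eq:
  assumes f [measurable]: "f \<in> borel_measurable borel" and fin: "gain f f v < \<infinity>" "loss f f v < \<infinity>"
  defines "X \<equiv> \<lambda>z. f (v - vplus z) * f (v - vminus z) - f (v - fst z) * f v"
  shows "integrable kmeasure X" "Q f v = (\<integral>z. X z \<partial>kmeasure)"
proof -
  have i: "integrable kmeasure (\<lambda>z. f (v - vplus z) * f (v - vminus z))" "integrable kmeasure (\<lambda>z. f (v - fst z) * f v)"
    using fin unfolding gain_def loss_def diff_zero real_norm_def[symmetric] by (intro integrableI_bounded; measurable)+
  then show iX: "integrable kmeasure X" unfolding X_def by (rule Bochner_Integration.integrable_diff)
  have Xm [measurable]: "X \<in> borel_measurable (borel \<Otimes>\<^sub>M borel)" unfolding X_def by measurable
  have wi: "integrable (lborel \<Otimes>\<^sub>M lborel) (\<lambda>z. weight (fst z) (snd z) * X z)"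
    using iX unfolding kmeasure_def by (subst (asm) integrable_density) (simp_all add: weight_nonneg)
  have "(\<integral>z. X z \<partial>kmeasure) = (\<integral>z. weight (fst z) (snd z) * X z \<partial>(lborel \<Otimes>\<^sub>M lborel))"
    unfolding kmeasure_def by (subst integral_density) (simp_all add: weight_nonneg)
  also have "\<dots> = (\<integral>q. (\<integral>x. weight q x * X (q, x) \<partial>lborel) \<partial>lborel)"
    using lborel_pair.integral_fst'[OF wi] by simp
  also have "\<dots> = Q f v"
    unfolding QR_def sphere_int_def set_lebesgue_integral_def
  proof (intro Bochner_Integration.integral_cong refl)
    fix q :: "real^'n"
    define Y where "Y x = indicator (ball 0 1) x *\<^sub>R (b (hat x \<bullet> hat q) *
          (f (v - (1/2) *\<^sub>R (q + norm q *\<^sub>R hat x)) * f (v - (1/2) *\<^sub>R (q - norm q *\<^sub>R hat x)) - f (v - q) * f v))" for x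
    have "(\<integral>x. weight q x * X (q, x) \<partial>lborel) = (\<integral>x. (indicator (cball 0 R) q * (\<Phi> (norm q) * CARD('n))) * Y x \<partial>lborel)"
      unfolding weight_def X_def vplus_def vminus_def Y_def fst_conv snd_conv real_scaleR_def
      by (intro Bochner_Integration.integral_cong refl) (simp only: mult_ac)
    also have "\<dots> = indicator (cball 0 R) q *\<^sub>R (\<Phi> (norm q) * (real CARD('n) * (\<integral>x. Y x \<partial>lborel)))"
      by (subst integral_mult_right_zero) simp
    finally show "(\<integral>x. weight q x * X (q, x) \<partial>lborel) = indicator (cball 0 R) q *\<^sub>R (\<Phi> (norm q) * (real CARD('n) *
      (\<integral>x. indicator (ball 0 1) x *\<^sub>R (b (hat x \<bullet> hat q) *
          (f (v - (1/2) *\<^sub>R (q + norm q *\<^sub>R hat x)) * f (v - (1/2) *\<^sub>R (q - norm q *\<^sub>R hat x)) - f (v - q) * f v)) \<partial>lborel)))"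
      unfolding Y_def .
  qed
  finally show "Q f v = (\<integral>z. X z \<partial>kmeasure)" ..
qed

lemma AE_finite_of_square:
  assumes [measurable]: "F \<in> borel_measurable borel" and le: "(\<integral>\<^sup>+v. (F v)\<^sup>2 \<partial>MD L) \<le> ennreal B"
  shows "AE v in MD L. F (v :: real^'n) < (\<infinity> :: ennreal)"
proof -
  have [measurable]: "F \<in> borel_measurable (MD L)" by (rule borel_measurable_MD) simp
  have "(\<integral>\<^sup>+v. (F v)\<^sup>2 \<partial>MD L) \<noteq> \<infinity>" using le by (auto simp: top_unique)
  then have "AE v in MD L. (F v)\<^sup>2 \<noteq> \<infinity>" by (intro nn_integral_PInf_AE) measurable
  then show ?thesis
  proof eventually_elim
    case (elim v)
    then show ?case by (cases "F v" rule: ennreal_cases) (simp_all add: power2_eq_square ennreal_top_mult)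
  qed
qed

text \<open>With d = f - h, polarisation gives \<open>Q f - Q h = Q(d,f) + Q(h,d)\<close>. The
  splitting is carried out inside the integral against \<open>kmeasure\<close>, at points where all
  terms are integrable, and leaves two gain and two loss terms.\<close>

lemma QR_diff_bound:
  fixes f h :: "real^'n \<Rightarrow> real"
  assumes L: "R \<le> L"
    and f: "periodic_L L f" "sq_int (MD L) f" and h: "periodic_L L h" "sq_int (MD L) h"
  shows "sq_int (MD L) (\<lambda>v. Q f v - Q h v)"
    "norm2 (MD L) (\<lambda>v. Q f v - Q h v)
      \<le> sqrt (8 * kbound) * (norm2 (MD L) f + norm2 (MD L) h) * norm2 (MD L) (\<lambda>v. f v - h v)"
proof -
  have L0: "L > 0" using L R by simp
  define d where "d v = f v - h v" for v
  have d: "periodic_L L d" "sq_int (MD L) d"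
    using f h by (auto simp: d_def[abs_def] periodic_L_def intro: sq_int_diff)
  have fm [measurable]: "f \<in> borel_measurable borel" and hm [measurable]: "h \<in> borel_measurable borel" and dm [measurable]: "d \<in> borel_measurable borel"
    using periodic_borel_measurable[OF L0] f h d sq_int_measurable by blast+
  note gl = gain_loss_bound[OF L]
  define S where "S v = gain d f v + gain h d v + (loss d f v + loss h d v)" for v
  have AE: "AE v in MD L. ennreal \<bar>Q f v - Q h v\<bar> \<le> S v"
    using AE_finite_of_square[OF gain_measurable(1)[OF fm fm] gl(1)[OF f f]]
      AE_finite_of_square[OF gain_measurable(2)[OF fm fm] gl(2)[OF f f]]
      AE_finite_of_square[OF gain_measurable(1)[OF hm hm] gl(1)[OF h h]]
      AE_finite_of_square[OF gain_measurable(2)[OF hm hm] gl(2)[OF h h]]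
  proof eventually_elim
    case (elim v)
    define X where "X u z = u (v - vplus z) * u (v - vminus z) - u (v - fst z) * u v" for u :: "real^'n \<Rightarrow> real" and z
    have Xf: "integrable kmeasure (X f)" "Q f v = (\<integral>z. X f z \<partial>kmeasure)"
      using QR_eq[OF fm, of v] elim unfolding X_def[abs_def] by auto
    have Xh: "integrable kmeasure (X h)" "Q h v = (\<integral>z. X h z \<partial>kmeasure)"
      using QR_eq[OF hm, of v] elim unfolding X_def[abs_def] by auto
    have "ennreal \<bar>Q f v - Q h v\<bar> = ennreal (norm (\<integral>z. X f z - X h z \<partial>kmeasure))"
      using Xf Xh by simp
    also have "\<dots> \<le> (\<integral>\<^sup>+z. ennreal (norm (X f z - X h z)) \<partial>kmeasure)"
      using Xf Xh by (intro integral_norm_bound_ennreal) simp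
    also have "\<dots> \<le> (\<integral>\<^sup>+z. ennreal \<bar>d (v - vplus z) * f (v - vminus z)\<bar> + ennreal \<bar>h (v - vplus z) * d (v - vminus z)\<bar>
       + (ennreal \<bar>d (v - fst z) * f (v - 0)\<bar> + ennreal \<bar>h (v - fst z) * d (v - 0)\<bar>) \<partial>kmeasure)"
    proof (rule nn_integral_mono)
      fix z
      have "X f z - X h z = d (v - vplus z) * f (v - vminus z) + h (v - vplus z) * d (v - vminus z)
        - d (v - fst z) * f (v - 0) - h (v - fst z) * d (v - 0)"
        by (simp add: X_def d_def algebra_simps)
      then have "norm (X f z - X h z) \<le> \<bar>d (v - vplus z) * f (v - vminus z)\<bar> + \<bar>h (v - vplus z) * d (v - vminus z)\<bar>
         + (\<bar>d (v - fst z) * f (v - 0)\<bar> + \<bar>h (v - fst z) * d (v - 0)\<bar>)"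
        unfolding real_norm_def by linarith
      then show "ennreal (norm (X f z - X h z)) \<le> ennreal \<bar>d (v - vplus z) * f (v - vminus z)\<bar> + ennreal \<bar>h (v - vplus z) * d (v - vminus z)\<bar>
       + (ennreal \<bar>d (v - fst z) * f (v - 0)\<bar> + ennreal \<bar>h (v - fst z) * d (v - 0)\<bar>)"
        by (simp only: ennreal_plus[symmetric] abs_ge_zero add_nonneg_nonneg ennreal_leI)
    qed
    also have "\<dots> = S v"
      unfolding S_def gain_def loss_def by (subst nn_integral_add; measurable)+
    finally show ?case .
  qed
  have [measurable]: "gain d f \<in> borel_measurable (MD L)" "gain h d \<in> borel_measurable (MD L)"
    "loss d f \<in> borel_measurable (MD L)" "loss h d \<in> borel_measurable (MD L)"
    by (intro borel_measurable_MD gain_measurable dm fm hm)+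
  define nf nh nd where "nf = norm2 (MD L) f" and "nh = norm2 (MD L) h" and "nd = norm2 (MD L) d"
  have n0: "0 \<le> nf" "0 \<le> nh" "0 \<le> nd" by (simp_all add: nf_def nh_def nd_def)
  have "(\<integral>\<^sup>+v. ennreal ((Q f v - Q h v)\<^sup>2) \<partial>MD L) \<le> (\<integral>\<^sup>+v. (S v)\<^sup>2 \<partial>MD L)"
  proof (rule nn_integral_mono_AE)
    show "AE v in MD L. ennreal ((Q f v - Q h v)\<^sup>2) \<le> (S v)\<^sup>2"
      using AE
    proof eventually_elim
      case (elim v)
      have "(ennreal \<bar>Q f v - Q h v\<bar>)\<^sup>2 \<le> (S v)\<^sup>2" using elim by (intro power_mono) auto
      then show ?case by (simp add: ennreal_power)
    qed
  qed
  also have "\<dots> \<le> (\<integral>\<^sup>+v. 4 * ((gain d f v)\<^sup>2 + (gain h d v)\<^sup>2 + ((loss d f v)\<^sup>2 + (loss h d v)\<^sup>2)) \<partial>MD L)"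
    unfolding S_def by (intro nn_integral_mono ennreal_power2_sum4_le)
  also have "\<dots> = 4 * ((\<integral>\<^sup>+v. (gain d f v)\<^sup>2 \<partial>MD L) + (\<integral>\<^sup>+v. (gain h d v)\<^sup>2 \<partial>MD L)
     + ((\<integral>\<^sup>+v. (loss d f v)\<^sup>2 \<partial>MD L) + (\<integral>\<^sup>+v. (loss h d v)\<^sup>2 \<partial>MD L)))"
    by (simp add: nn_integral_cmult nn_integral_add)
  also have "\<dots> \<le> 4 * (ennreal (kbound * (nd\<^sup>2 * nf\<^sup>2)) + ennreal (kbound * (nh\<^sup>2 * nd\<^sup>2)) + (ennreal (kbound * (nd\<^sup>2 * nf\<^sup>2)) + ennreal (kbound * (nh\<^sup>2 * nd\<^sup>2))))"
    unfolding nf_def nh_def nd_def by (intro mult_left_mono add_mono gl d f h) auto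
  \<comment> \<open>The factor 8 is 4, from squaring a sum of four terms, times 2, since gain and
    loss obey the same bound.\<close>
  also have "\<dots> = ennreal (8 * kbound * (nf\<^sup>2 + nh\<^sup>2) * nd\<^sup>2)"
  proof -
    have "(4::ennreal) = ennreal 4" by simp
    then show ?thesis using kbound_nonneg
      by (simp only: ennreal_plus[symmetric] ennreal_mult[symmetric] add_nonneg_nonneg mult_nonneg_nonneg zero_le_power2 zero_le_numeral)
         (simp add: algebra_simps)
  qed
  also have "\<dots> \<le> ennreal ((sqrt (8 * kbound) * (nf + nh) * nd)\<^sup>2)"
  proof (rule ennreal_leI)
    have "nf\<^sup>2 + nh\<^sup>2 \<le> (nf + nh)\<^sup>2" using n0 by (simp add: power2_sum)
    then have "8 * kbound * (nf\<^sup>2 + nh\<^sup>2) * nd\<^sup>2 \<le> 8 * kbound * (nf + nh)\<^sup>2 * nd\<^sup>2"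
      using kbound_nonneg by (intro mult_right_mono mult_left_mono) auto
    then show "8 * kbound * (nf\<^sup>2 + nh\<^sup>2) * nd\<^sup>2 \<le> (sqrt (8 * kbound) * (nf + nh) * nd)\<^sup>2"
      using kbound_nonneg by (simp add: power_mult_distrib)
  qed
  finally have le: "(\<integral>\<^sup>+v. ennreal ((Q f v - Q h v)\<^sup>2) \<partial>MD L) \<le> ennreal ((sqrt (8 * kbound) * (nf + nh) * nd)\<^sup>2)" .
  have m: "(\<lambda>v. Q f v - Q h v) \<in> borel_measurable (MD L)"
    by (intro borel_measurable_MD borel_measurable_diff QR_measurable fm hm)
  have nn: "0 \<le> sqrt (8 * kbound) * (nf + nh) * nd" using n0 kbound_nonneg by simp
  show "sq_int (MD L) (\<lambda>v. Q f v - Q h v)"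
    by (rule sq_int_nn_integralI(1)[OF m le nn])
  show "norm2 (MD L) (\<lambda>v. Q f v - Q h v)
      \<le> sqrt (8 * kbound) * (norm2 (MD L) f + norm2 (MD L) h) * norm2 (MD L) (\<lambda>v. f v - h v)"
    using sq_int_nn_integralI(2)[OF m le nn] by (simp add: nf_def nh_def nd_def d_def[abs_def])
qed

lemma QR_sq_int:
  fixes f :: "real^'n \<Rightarrow> real"
  assumes L: "R \<le> L" and f: "periodic_L L f" "sq_int (MD L) f"
  shows "sq_int (MD L) (Q f)"
proof -
  \<comment> \<open>Comparing with h = 0, for which Q vanishes, turns the difference bound into
    membership in L2.\<close>
  have "Q (\<lambda>v. 0) v = 0" for v :: "real^'n"
    by (simp add: QR_def sphere_int_def)
  then show ?thesis
    using QR_diff_bound(1)[OF L f, of "\<lambda>v. 0"] by (simp add: periodic_L_def)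
qed

end

section \<open>Differentiable curves of square integrable functions\<close>

text \<open>The substitution s = t + h brings the definition into the form of a limit at t, to which
  the general limit rules apply.\<close>

lemma L2_deriv_iff:
  "L2_deriv L u u' t S \<longleftrightarrow> ((\<lambda>s. norm2 (MD L) (\<lambda>v. (u s v - u t v) / (s - t) - u' v)) \<longlongrightarrow> 0) (at t within S)"
proof -
  define G where "G s = norm2 (MD L) (\<lambda>v. (u s v - u t v) / (s - t) - u' v)" for s
  have "(((\<lambda>h. G (t + h)) \<longlongrightarrow> 0) (at 0 within {h. t + h \<in> S})) \<longleftrightarrow> (G \<longlongrightarrow> 0) (at t within S)"
    unfolding Lim_within
  proof (intro iff_allI imp_cong refl iff_exI conj_cong)
    fix e d :: real
    show "(\<forall>x\<in>{h. t + h \<in> S}. 0 < dist x 0 \<and> dist x 0 < d \<longrightarrow> dist (G (t + x)) 0 < e) \<longleftrightarrow>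
          (\<forall>x\<in>S. 0 < dist x t \<and> dist x t < d \<longrightarrow> dist (G x) 0 < e)"
    proof safe
      fix x assume *: "\<forall>x\<in>{h. t + h \<in> S}. 0 < dist x 0 \<and> dist x 0 < d \<longrightarrow> dist (G (t + x)) 0 < e"
        and "x \<in> S" "0 < dist x t" "dist x t < d"
      then show "dist (G x) 0 < e" using *[rule_format, of "x - t"] by (simp add: dist_norm)
    next
      fix x assume *: "\<forall>x\<in>S. 0 < dist x t \<and> dist x t < d \<longrightarrow> dist (G x) 0 < e"
        and "t + x \<in> S" "0 < dist x 0" "dist x 0 < d"
      then show "dist (G (t + x)) 0 < e" using *[rule_format, of "t + x"] by (simp add: dist_norm)
    qed
  qed
  then show ?thesis unfolding L2_deriv_def L2norm_eq G_def by simp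
qed

lemma L2_deriv_subset: "L2_deriv L u u' t S \<Longrightarrow> S' \<subseteq> S \<Longrightarrow> L2_deriv L u u' t S'"
  unfolding L2_deriv_iff by (rule tendsto_within_subset)

lemma L2_deriv_diff:
  assumes u: "L2_deriv L u u' t S" "\<And>s. s \<in> insert t S \<Longrightarrow> sq_int (MD L) (u s)" "sq_int (MD L) u'"
    and w: "L2_deriv L w w' t S" "\<And>s. s \<in> insert t S \<Longrightarrow> sq_int (MD L) (w s)" "sq_int (MD L) w'"
  shows "L2_deriv L (\<lambda>s v. u s v - w s v) (\<lambda>v. u' v - w' v) t S"
  unfolding L2_deriv_iff
proof (rule Lim_null_comparison)
  show "eventually (\<lambda>s. norm (norm2 (MD L) (\<lambda>v. (u s v - w s v - (u t v - w t v)) / (s - t) - (u' v - w' v)))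
    \<le> norm2 (MD L) (\<lambda>v. (u s v - u t v) / (s - t) - u' v) + norm2 (MD L) (\<lambda>v. (w s v - w t v) / (s - t) - w' v)) (at t within S)"
    unfolding eventually_at_filter
  proof (intro always_eventually allI impI)
    fix s assume s: "s \<in> S"
    have "norm2 (MD L) (\<lambda>v. ((u s v - u t v) / (s - t) - u' v) - ((w s v - w t v) / (s - t) - w' v))
      \<le> norm2 (MD L) (\<lambda>v. (u s v - u t v) / (s - t) - u' v) + norm2 (MD L) (\<lambda>v. (w s v - w t v) / (s - t) - w' v)"
      using s by (intro norm2_triangle_diff sq_int_diff sq_int_divide u w) auto
    moreover have "((u s v - u t v) / (s - t) - u' v) - ((w s v - w t v) / (s - t) - w' v)
        = (u s v - w s v - (u t v - w t v)) / (s - t) - (u' v - w' v)" for v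
      by (simp add: diff_divide_distrib)
    ultimately show "norm (norm2 (MD L) (\<lambda>v. (u s v - w s v - (u t v - w t v)) / (s - t) - (u' v - w' v)))
    \<le> norm2 (MD L) (\<lambda>v. (u s v - u t v) / (s - t) - u' v) + norm2 (MD L) (\<lambda>v. (w s v - w t v) / (s - t) - w' v)"
      by simp
  qed
  show "((\<lambda>s. norm2 (MD L) (\<lambda>v. (u s v - u t v) / (s - t) - u' v) + norm2 (MD L) (\<lambda>v. (w s v - w t v) / (s - t) - w' v)) \<longlongrightarrow> 0) (at t within S)"
    using tendsto_add[OF u(1)[unfolded L2_deriv_iff] w(1)[unfolded L2_deriv_iff]] by simp
qed

text \<open>The projection is linear and does not increase the norm, so the error of the projected
  difference quotient is dominated by the original one.\<close>

lemma L2_deriv_proj: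
  assumes L: "L > 0" and u: "L2_deriv L u u' t S" "\<And>s. s \<in> insert t S \<Longrightarrow> sq_int (MD L) (u s)" "sq_int (MD L) u'"
  shows "L2_deriv L (\<lambda>s. proj L N (u s)) (proj L N u') t S"
  unfolding L2_deriv_iff
proof (rule Lim_null_comparison)
  show "eventually (\<lambda>s. norm (norm2 (MD L) (\<lambda>v. (proj L N (u s) v - proj L N (u t) v) / (s - t) - proj L N u' v))
    \<le> norm2 (MD L) (\<lambda>v. (u s v - u t v) / (s - t) - u' v)) (at t within S)"
    unfolding eventually_at_filter
  proof (intro always_eventually allI impI)
    fix s assume s: "s \<in> S"
    have sq: "sq_int (MD L) (\<lambda>v. (u s v - u t v) / (s - t))" "sq_int (MD L) (\<lambda>v. u s v - u t v)" "sq_int (MD L) (u s)" "sq_int (MD L) (u t)"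
      using s by (auto intro!: sq_int_divide sq_int_diff u)
    have "proj L N (\<lambda>v. (u s v - u t v) / (s - t) - u' v) = (\<lambda>v. (proj L N (u s) v - proj L N (u t) v) / (s - t) - proj L N u' v)"
      by (rule ext) (simp only: proj_diff[OF sq(1) u(3)] proj_divide[OF sq(2)] proj_diff[OF sq(3,4)])
    then show "norm (norm2 (MD L) (\<lambda>v. (proj L N (u s) v - proj L N (u t) v) / (s - t) - proj L N u' v))
      \<le> norm2 (MD L) (\<lambda>v. (u s v - u t v) / (s - t) - u' v)"
      using norm2_proj_le[OF L sq_int_diff[OF sq(1) u(3)], of N] by simp
  qed
qed (use u(1) in \<open>simp add: L2_deriv_iff\<close>)

lemma L2_deriv_continuous:
  assumes u: "L2_deriv L u u' t S" "\<And>s. s \<in> insert t S \<Longrightarrow> sq_int (MD L) (u s)" "sq_int (MD L) u'"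
  shows "((\<lambda>s. norm2 (MD L) (u s)) \<longlongrightarrow> norm2 (MD L) (u t)) (at t within S)"
proof -
  define D where "D s = norm2 (MD L) (\<lambda>v. (u s v - u t v) / (s - t) - u' v)" for s
  have D: "(D \<longlongrightarrow> 0) (at t within S)" using u(1) unfolding L2_deriv_iff D_def .
  have "((\<lambda>s. norm2 (MD L) (u s) - norm2 (MD L) (u t)) \<longlongrightarrow> 0) (at t within S)"
  proof (rule Lim_null_comparison)
    show "eventually (\<lambda>s. norm (norm2 (MD L) (u s) - norm2 (MD L) (u t)) \<le> \<bar>s - t\<bar> * (D s + norm2 (MD L) u')) (at t within S)"
      unfolding eventually_at_filter
    proof (intro always_eventually allI impI)
      fix s assume s: "s \<noteq> t" "s \<in> S"
      have sq: "sq_int (MD L) (\<lambda>v. (u s v - u t v) / (s - t) - u' v)" "sq_int (MD L) (u s)" "sq_int (MD L) (u t)"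
        using s by (auto intro!: sq_int_divide sq_int_diff u)
      have "\<bar>norm2 (MD L) (u s) - norm2 (MD L) (u t)\<bar> \<le> norm2 (MD L) (\<lambda>v. u s v - u t v)"
        by (rule norm2_rev_triangle[OF sq(2,3)])
      also have "(\<lambda>v. u s v - u t v) = (\<lambda>v. (s - t) * (((u s v - u t v) / (s - t) - u' v) + u' v))"
        using s by (simp add: fun_eq_iff)
      also have "norm2 (MD L) \<dots> \<le> \<bar>s - t\<bar> * (D s + norm2 (MD L) u')"
        unfolding norm2_cmult D_def by (intro mult_left_mono norm2_triangle sq u) auto
      finally show "norm (norm2 (MD L) (u s) - norm2 (MD L) (u t)) \<le> \<bar>s - t\<bar> * (D s + norm2 (MD L) u')" by simp
    qed
    have "((\<lambda>s. \<bar>s - t\<bar> * (D s + norm2 (MD L) u')) \<longlongrightarrow> \<bar>t - t\<bar> * (0 + norm2 (MD L) u')) (at t within S)"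
      by (intro tendsto_intros D)
    then show "((\<lambda>s. \<bar>s - t\<bar> * (D s + norm2 (MD L) u')) \<longlongrightarrow> 0) (at t within S)" by simp
  qed
  then show ?thesis by (simp add: LIM_zero_iff)
qed

text \<open>The square is used because it is differentiable even where the norm vanishes, which
  happens at the initial time of the error.\<close>

lemma L2_deriv_norm2_sq:
  fixes u :: "real \<Rightarrow> real^'n::finite \<Rightarrow> real"
  assumes u: "L2_deriv L u u' t S" "\<And>s. s \<in> insert t S \<Longrightarrow> sq_int (MD L) (u s)" "sq_int (MD L) u'"
  shows "((\<lambda>s. (norm2 (MD L) (u s))\<^sup>2) has_real_derivative 2 * (\<integral>v. u t v * u' v \<partial>MD L)) (at t within S)"
proof -
  define d where "d s v = (u s v - u t v) / (s - t) - u' v" for s v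
  define n :: "(real^'n \<Rightarrow> real) \<Rightarrow> real" where "n = norm2 (MD L)"
  have D: "((\<lambda>s. n (d s)) \<longlongrightarrow> 0) (at t within S)" using u(1) unfolding L2_deriv_iff d_def n_def .
  have ut: "sq_int (MD L) (u t)" using u(2) by simp
  have "((\<lambda>s. ((n (u s))\<^sup>2 - (n (u t))\<^sup>2) / (s - t) - 2 * (\<integral>v. u t v * u' v \<partial>MD L)) \<longlongrightarrow> 0) (at t within S)"
  proof (rule Lim_null_comparison)
    show "eventually (\<lambda>s. norm (((n (u s))\<^sup>2 - (n (u t))\<^sup>2) / (s - t) - 2 * (\<integral>v. u t v * u' v \<partial>MD L))
      \<le> 2 * (n (u t) * n (d s)) + \<bar>s - t\<bar> * (n u' + n (d s))\<^sup>2) (at t within S)"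
      unfolding eventually_at_filter
    proof (intro always_eventually allI impI)
      fix s assume s: "s \<noteq> t" "s \<in> S"
      have ds: "sq_int (MD L) (d s)"
        using s unfolding d_def[abs_def] by (auto intro!: sq_int_divide sq_int_diff u)
      define w where "w v = u' v + d s v" for v
      have w: "sq_int (MD L) w" unfolding w_def[abs_def] by (intro sq_int_add ds u)
      \<comment> \<open>First-order expansion with an exact remainder: \<open>w\<close> is the
        derivative plus a term \<open>d s\<close> whose norm tends to 0.\<close>
      have us: "u s = (\<lambda>v. u t v + (s - t) * w v)" using s by (simp add: w_def d_def fun_eq_iff)
      have "(n (u s))\<^sup>2 = (n (u t))\<^sup>2 + 2 * (\<integral>v. u t v * ((s - t) * w v) \<partial>MD L) + (n (\<lambda>v. (s - t) * w v))\<^sup>2"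
        unfolding us n_def by (rule norm2_add_sq[OF ut sq_int_cmult[OF w]])
      also have "(\<integral>v. u t v * ((s - t) * w v) \<partial>MD L) = (s - t) * (\<integral>v. u t v * w v \<partial>MD L)"
        by (simp add: mult.left_commute)
      also have "(\<integral>v. u t v * w v \<partial>MD L) = (\<integral>v. u t v * u' v \<partial>MD L) + (\<integral>v. u t v * d s v \<partial>MD L)"
        unfolding w_def distrib_left by (intro Bochner_Integration.integral_add sq_int_mult ut u ds)
      also have "(n (\<lambda>v. (s - t) * w v))\<^sup>2 = (s - t)\<^sup>2 * (n w)\<^sup>2"
        by (simp add: n_def norm2_cmult power_mult_distrib)
      finally have exp: "(n (u s))\<^sup>2 = (n (u t))\<^sup>2 + 2 * ((s - t) * ((\<integral>v. u t v * u' v \<partial>MD L) + (\<integral>v. u t v * d s v \<partial>MD L))) + (s - t)\<^sup>2 * (n w)\<^sup>2" .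
      have "(a + 2 * ((s - t) * (i + j)) + (s - t)\<^sup>2 * c - a) / (s - t) - 2 * i = 2 * j + (s - t) * c" for a i j c
      proof -
        have "a + 2 * ((s - t) * (i + j)) + (s - t)\<^sup>2 * c - a = (s - t) * (2 * (i + j) + (s - t) * c)"
          by (simp add: algebra_simps power2_eq_square)
        then show ?thesis using s by simp
      qed
      then have "((n (u s))\<^sup>2 - (n (u t))\<^sup>2) / (s - t) - 2 * (\<integral>v. u t v * u' v \<partial>MD L)
        = 2 * (\<integral>v. u t v * d s v \<partial>MD L) + (s - t) * (n w)\<^sup>2"
        unfolding exp .
      also have "\<bar>\<dots>\<bar> \<le> 2 * \<bar>\<integral>v. u t v * d s v \<partial>MD L\<bar> + \<bar>s - t\<bar> * (n w)\<^sup>2"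
        by (rule order_trans[OF abs_triangle_ineq]) (simp add: abs_mult)
      also have "\<dots> \<le> 2 * (n (u t) * n (d s)) + \<bar>s - t\<bar> * (n u' + n (d s))\<^sup>2"
        unfolding n_def w_def[abs_def]
        by (intro add_mono mult_left_mono norm2_Cauchy_Schwarz power_mono norm2_triangle ut ds u) auto
      finally show "norm (((n (u s))\<^sup>2 - (n (u t))\<^sup>2) / (s - t) - 2 * (\<integral>v. u t v * u' v \<partial>MD L))
      \<le> 2 * (n (u t) * n (d s)) + \<bar>s - t\<bar> * (n u' + n (d s))\<^sup>2" by simp
    qed
    have "((\<lambda>s. 2 * (n (u t) * n (d s)) + \<bar>s - t\<bar> * (n u' + n (d s))\<^sup>2) \<longlongrightarrow> 2 * (n (u t) * 0) + \<bar>t - t\<bar> * (n u' + 0)\<^sup>2) (at t within S)"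
      by (intro tendsto_intros D)
    then show "((\<lambda>s. 2 * (n (u t) * n (d s)) + \<bar>s - t\<bar> * (n u' + n (d s))\<^sup>2) \<longlongrightarrow> 0) (at t within S)" by simp
  qed
  then show ?thesis unfolding has_field_derivative_iff n_def by (simp add: LIM_zero_iff)
qed

text \<open>Works with \<open>E + \<delta>^2\<close>, where E is the squared norm:
  \<open>2 a (a + \<delta>) \<le> 3 (a^2 + \<delta>^2)\<close> gives growth rate 3A, so multiplied
  by the matching decaying exponential it is non-increasing.\<close>

lemma L2_Gronwall:
  assumes T: "T > 0" and A: "A \<ge> 0" and \<delta>: "\<delta> \<ge> 0"
    and u: "\<And>t. t \<in> {0..T} \<Longrightarrow> L2_deriv L u (u' t) t {0..T}" "\<And>t. t \<in> {0..T} \<Longrightarrow> sq_int (MD L) (u t)"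
      "\<And>t. t \<in> {0..T} \<Longrightarrow> sq_int (MD L) (u' t)"
    and le: "\<And>t. t \<in> {0..T} \<Longrightarrow> norm2 (MD L) (u' t) \<le> A * (norm2 (MD L) (u t) + \<delta>)"
    and init: "norm2 (MD L) (u 0) = 0" and t: "t \<in> {0..T}"
  shows "norm2 (MD L) (u t) \<le> \<delta> * exp (2 * A * T)"
proof -
  define E where "E s = (norm2 (MD L) (u s))\<^sup>2" for s
  define E' where "E' s = 2 * (\<integral>v. u s v * u' s v \<partial>MD L)" for s
  define \<phi> where "\<phi> s = (E s + \<delta>\<^sup>2) * exp (- (3 * A * s))" for s
  have E: "(E has_real_derivative E' s) (at s within {0..T})" if "s \<in> {0..T}" for s
    unfolding E_def[abs_def] E'_def using that by (intro L2_deriv_norm2_sq u) auto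
  have E'le: "E' s \<le> 3 * A * (E s + \<delta>\<^sup>2)" if s: "s \<in> {0..T}" for s
  proof -
    define a where "a = norm2 (MD L) (u s)"
    have "E' s \<le> 2 * (a * norm2 (MD L) (u' s))"
      using norm2_Cauchy_Schwarz[OF u(2)[OF s] u(3)[OF s]] by (simp add: E'_def a_def)
    also have "\<dots> \<le> 2 * (a * (A * (a + \<delta>)))"
      using le[OF s] by (intro mult_left_mono) (auto simp: a_def)
    also have "\<dots> = A * (2 * a\<^sup>2 + 2 * a * \<delta>)" by (simp add: power2_eq_square algebra_simps)
    also have "\<dots> \<le> A * (3 * (a\<^sup>2 + \<delta>\<^sup>2))"
    proof (rule mult_left_mono)
      show "2 * a\<^sup>2 + 2 * a * \<delta> \<le> 3 * (a\<^sup>2 + \<delta>\<^sup>2)"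
      proof -
        have "2 * a * \<delta> \<le> a\<^sup>2 + 3 * \<delta>\<^sup>2" by (rule order_trans[OF sum_squares_bound]) simp
        then show ?thesis by (simp add: algebra_simps)
      qed
    qed (rule A)
    finally show ?thesis by (simp add: E_def a_def mult_ac)
  qed
  have \<phi>: "(\<phi> has_real_derivative (E' s - 3 * A * (E s + \<delta>\<^sup>2)) * exp (- (3 * A * s))) (at s within {0..T})" if "s \<in> {0..T}" for s
    unfolding \<phi>_def[abs_def] by (rule derivative_eq_intros E[OF that] refl)+ (simp add: algebra_simps)
  have "\<phi> t \<le> \<phi> 0"
  proof (cases "t = 0")
    case False
    then have t0: "0 < t" using t by simp
    have der: "(\<phi> has_derivative (\<lambda>h. (E' x - 3 * A * (E x + \<delta>\<^sup>2)) * exp (- (3 * A * x)) * h)) (at x within {0..t})"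
      if "x \<in> {0..t}" for x
    proof -
      have "x \<in> {0..T}" "{0..t} \<subseteq> {0..T}" using that t by auto
      then show ?thesis
        using has_derivative_subset[OF \<phi>[unfolded has_field_derivative_def]] by blast
    qed
    have "\<exists>x\<in>{0<..<t}. \<phi> t - \<phi> 0 = (E' x - 3 * A * (E x + \<delta>\<^sup>2)) * exp (- (3 * A * x)) * (t - 0)"
      by (rule mvt_simple[OF t0 der]) auto
    then obtain x where x: "x \<in> {0<..<t}" "\<phi> t - \<phi> 0 = (E' x - 3 * A * (E x + \<delta>\<^sup>2)) * exp (- (3 * A * x)) * t" by auto
    have "(E' x - 3 * A * (E x + \<delta>\<^sup>2)) * exp (- (3 * A * x)) * t \<le> 0"
      using E'le[of x] x t by (intro mult_nonpos_nonneg) auto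
    then show ?thesis using x by simp
  qed simp
  then have "(E t + \<delta>\<^sup>2) * exp (- (3 * A * t)) * exp (3 * A * t) \<le> \<delta>\<^sup>2 * exp (3 * A * t)"
    using init by (intro mult_right_mono) (auto simp: \<phi>_def E_def)
  then have "E t + \<delta>\<^sup>2 \<le> \<delta>\<^sup>2 * exp (3 * A * t)" by (simp add: mult.assoc exp_add[symmetric])
  then have "E t \<le> \<delta>\<^sup>2 * exp (3 * A * t)" using zero_le_power2[of \<delta>] by linarith
  \<comment> \<open>The exponent is rounded up from 3A to 4A so that its square root is
    \<open>exp (2 * A * T)\<close>.\<close>
  also have "\<dots> \<le> \<delta>\<^sup>2 * exp (4 * A * T)"
    using t A T by (intro mult_left_mono) (auto intro!: mult_mono)
  also have "\<dots> = (\<delta> * exp (2 * A * T))\<^sup>2"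
  proof -
    have "exp (4 * A * T) = exp (2 * A * T) * exp (2 * A * T)" by (simp add: exp_add[symmetric])
    then show ?thesis by (simp add: power2_eq_square mult_ac)
  qed
  finally show ?thesis unfolding E_def using \<delta> by (auto intro: power2_le_imp_le)
qed

section \<open>Truncation and global solvability\<close>

text \<open>The radial retraction onto the ball of radius K. Dividing by a maximum expresses it
  without a case distinction.\<close>

definition truncate :: "real \<Rightarrow> real \<Rightarrow> (real^'n::finite \<Rightarrow> real) \<Rightarrow> real^'n \<Rightarrow> real" where
  "truncate L K y v = y v / max 1 (norm2 (MD L) y / K)"

lemma truncate_eq: "norm2 (MD L) y \<le> K \<Longrightarrow> 0 < K \<Longrightarrow> truncate L K y = y"
  by (simp add: truncate_def[abs_def] max_def)

lemma truncate_sq_int: "sq_int (MD L) y \<Longrightarrow> sq_int (MD L) (truncate L K y)"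
  unfolding truncate_def[abs_def] by (rule sq_int_divide)

lemma truncate_periodic: "periodic_L L y \<Longrightarrow> periodic_L L (truncate L K y)"
  by (simp add: truncate_def periodic_L_def)

lemma norm2_truncate_le:
  assumes K: "K > 0"
  shows "norm2 (MD L) (truncate L K y) \<le> K"
proof -
  have "norm2 (MD L) y \<le> K * max 1 (norm2 (MD L) y / K)"
    using K mult_left_mono[of "norm2 (MD L) y / K" "max 1 (norm2 (MD L) y / K)" K] by simp
  moreover have "max 1 (norm2 (MD L) y / K) > 0" by simp
  ultimately show ?thesis
    unfolding truncate_def[abs_def] norm2_divide by (simp add: pos_divide_le_eq abs_of_pos del: max.absorb1 max.absorb2)
qed

text \<open>Splitting off \<open>(y - z) / a\<close> leaves a multiple of the truncated z, whose
  norm is at most K. The denominators differ by at most \<open>norm2 (y - z) / K\<close>, so each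
  part contributes one copy of the distance.\<close>

lemma truncate_lipschitz:
  assumes K: "K > 0" and y: "sq_int (MD L) y" and z: "sq_int (MD L) z"
  shows "norm2 (MD L) (\<lambda>v. truncate L K y v - truncate L K z v) \<le> 2 * norm2 (MD L) (\<lambda>v. y v - z v)"
proof -
  define a b where "a = max 1 (norm2 (MD L) y / K)" and "b = max 1 (norm2 (MD L) z / K)"
  have a: "a \<ge> 1" and b: "b \<ge> 1" by (auto simp: a_def b_def)
  have "\<bar>a - b\<bar> \<le> \<bar>norm2 (MD L) y / K - norm2 (MD L) z / K\<bar>" by (auto simp: a_def b_def max_def)
  also have "\<dots> = \<bar>norm2 (MD L) y - norm2 (MD L) z\<bar> / K" using K by (simp add: diff_divide_distrib[symmetric])
  also have "\<dots> \<le> norm2 (MD L) (\<lambda>v. y v - z v) / K"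
    using norm2_rev_triangle[OF y z] K by (intro divide_right_mono) auto
  finally have ab: "\<bar>a - b\<bar> * K \<le> norm2 (MD L) (\<lambda>v. y v - z v)" using K by (simp add: pos_le_divide_eq)
  have eq: "truncate L K y v - truncate L K z v = (y v - z v) / a + (b - a) / a * truncate L K z v" for v
    using a b by (simp add: truncate_def a_def[symmetric] b_def[symmetric] field_simps)
  have "norm2 (MD L) (\<lambda>v. truncate L K y v - truncate L K z v)
    \<le> norm2 (MD L) (\<lambda>v. (y v - z v) / a) + norm2 (MD L) (\<lambda>v. (b - a) / a * truncate L K z v)"
    unfolding eq by (intro norm2_triangle sq_int_divide sq_int_diff sq_int_cmult truncate_sq_int y z)
  also have "norm2 (MD L) (\<lambda>v. (y v - z v) / a) \<le> norm2 (MD L) (\<lambda>v. y v - z v)"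
    unfolding norm2_divide using a mult_left_mono[OF a, of "norm2 (MD L) (\<lambda>v. y v - z v)"] by (simp add: divide_le_eq)
  also have "norm2 (MD L) (\<lambda>v. (b - a) / a * truncate L K z v) \<le> \<bar>a - b\<bar> * K"
  proof -
    have "norm2 (MD L) (\<lambda>v. (b - a) / a * truncate L K z v) = \<bar>a - b\<bar> / a * norm2 (MD L) (truncate L K z)"
      unfolding norm2_cmult using a by (simp add: abs_minus_commute)
    also have "\<dots> \<le> \<bar>a - b\<bar> / 1 * K"
      using a K by (intro mult_mono divide_left_mono norm2_truncate_le) auto
    finally show ?thesis by simp
  qed
  finally show ?thesis using ab by simp
qed

text \<open>In the norm \<open>sup e\<^sup>-\<^sup>\<kappa>\<^sup>t |y t|\<close> with large \<open>\<kappa>\<close> the Picard map is a contraction on the whole interval.\<close>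
lemma global_Picard:
  fixes F :: "'e::banach \<Rightarrow> 'e"
  assumes T: "T > 0" and B: "B \<ge> 0" and lip: "\<And>x y. norm (F x - F y) \<le> B * norm (x - y)"
  shows "\<exists>y. y 0 = y0 \<and> (\<forall>t\<in>{0..T}. (y has_vector_derivative F (y t)) (at t within {0..T}))"
proof -
  \<comment> \<open>This makes the contraction factor \<open>B / \<kappa>\<close> at most 1/2; the
    added 1 covers B = 0.\<close>
  define \<kappa> where "\<kappa> = 2 * B + 1"
  have \<kappa>: "\<kappa> > 0" using B by (simp add: \<kappa>_def)
  \<comment> \<open>Clamping time to [0,T] extends curves on the interval to bounded continuous
    functions on the line, a complete type on which the fixed point theorem applies.\<close>
  define cl where "cl t = max 0 (min T t)" for t
  have cl: "cl t \<in> {0..T}" for t using T by (simp add: cl_def)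
  have cl_id: "cl t = t" if "t \<in> {0..T}" for t using that by (simp add: cl_def)
  have clc: "continuous_on UNIV cl" unfolding cl_def by (intro continuous_intros)
  have Fc: "continuous_on UNIV F"
    by (rule lipschitz_on_continuous_on[of B]) (use B lip in \<open>auto simp: lipschitz_on_def dist_norm\<close>)
  \<comment> \<open>The unknown is the rescaled curve \<open>z r = exp (- \<kappa> r) y r\<close>;
    its plain sup norm is the weighted norm of y.\<close>
  define g where "g z r = F (exp (\<kappa> * r) *\<^sub>R apply_bcontfun z r)" for z :: "real \<Rightarrow>\<^sub>C 'e" and r
  have gc: "continuous_on S (g z)" for S z
    unfolding g_def by (intro continuous_on_compose2[OF Fc] continuous_intros) auto
  have gi: "g z integrable_on {0..s}" for z s
    by (intro integrable_continuous_interval gc)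
  define G where "G z s = exp (- (\<kappa> * s)) *\<^sub>R (y0 + integral {0..s} (g z))" for z s
  have Gc: "continuous_on {0..T} (G z)" for z
    unfolding G_def by (intro continuous_intros indefinite_integral_continuous_1 gi)
  have Gb: "(\<lambda>t. G z (cl t)) \<in> bcontfun" for z
    unfolding bcontfun_def
  proof (intro CollectI conjI)
    show "continuous_on UNIV (\<lambda>t. G z (cl t))"
      by (rule continuous_on_compose2[OF Gc clc]) (use cl in auto)
    have "bounded (G z ` {0..T})" by (intro compact_imp_bounded compact_continuous_image Gc) simp
    then show "bounded (range (\<lambda>t. G z (cl t)))" by (rule bounded_subset) (use cl in auto)
  qed
  define \<Psi> where "\<Psi> z = Bcontfun (\<lambda>t. G z (cl t))" for z
  have \<Psi>: "apply_bcontfun (\<Psi> z) t = G z (cl t)" for z t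
    unfolding \<Psi>_def by (simp add: Bcontfun_inverse[OF Gb])
  have contr: "dist (\<Psi> z) (\<Psi> w) \<le> 1 / 2 * dist z w" for z w
  proof (rule dist_bound)
    fix t
    define s where "s = cl t"
    have s: "s \<in> {0..T}" unfolding s_def by (rule cl)
    have "norm (integral {0..s} (g z) - integral {0..s} (g w)) \<le> integral {0..s} (\<lambda>r. B * dist z w * exp (\<kappa> * r))"
      unfolding Henstock_Kurzweil_Integration.integral_diff[OF gi gi, symmetric]
    proof (rule integral_norm_bound_integral)
      show "(\<lambda>r. g z r - g w r) integrable_on {0..s}" by (intro Henstock_Kurzweil_Integration.integrable_diff gi)
      show "(\<lambda>r. B * dist z w * exp (\<kappa> * r)) integrable_on {0..s}"
        by (intro integrable_continuous_interval continuous_intros)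
      fix r
      have "norm (g z r - g w r) \<le> B * norm (exp (\<kappa> * r) *\<^sub>R apply_bcontfun z r - exp (\<kappa> * r) *\<^sub>R apply_bcontfun w r)"
        unfolding g_def by (rule lip)
      also have "\<dots> = B * (exp (\<kappa> * r) * dist (apply_bcontfun z r) (apply_bcontfun w r))"
        by (simp add: scaleR_diff_right[symmetric] dist_norm)
      also have "\<dots> \<le> B * (exp (\<kappa> * r) * dist z w)"
        using B by (intro mult_left_mono dist_bounded) auto
      finally show "norm (g z r - g w r) \<le> B * dist z w * exp (\<kappa> * r)" by (simp add: mult_ac)
    qed
    also have "\<dots> = B * dist z w * ((exp (\<kappa> * s) - 1) / \<kappa>)"
    proof -
      have "((\<lambda>r. exp (\<kappa> * r)) has_integral (exp (\<kappa> * s) / \<kappa> - exp (\<kappa> * 0) / \<kappa>)) {0..s}"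
        using s \<kappa> by (intro fundamental_theorem_of_calculus)
          (auto intro!: derivative_eq_intros simp: has_real_derivative_iff_has_vector_derivative[symmetric])
      then show ?thesis using \<kappa> by (simp add: integral_unique diff_divide_distrib)
    qed
    also have "\<dots> \<le> B * dist z w * (exp (\<kappa> * s) / \<kappa>)"
      using B \<kappa> by (intro mult_left_mono divide_right_mono) auto
    finally have "norm (integral {0..s} (g z) - integral {0..s} (g w)) \<le> B * dist z w * (exp (\<kappa> * s) / \<kappa>)" .
    then have "exp (- (\<kappa> * s)) * norm (integral {0..s} (g z) - integral {0..s} (g w))
      \<le> exp (- (\<kappa> * s)) * (B * dist z w * (exp (\<kappa> * s) / \<kappa>))"
      by (intro mult_left_mono) auto
    also have "\<dots> = (B / \<kappa>) * dist z w" by (simp add: exp_minus field_simps)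
    also have "\<dots> \<le> 1 / 2 * dist z w"
      using B by (intro mult_right_mono) (auto simp: \<kappa>_def field_simps)
    finally show "dist (apply_bcontfun (\<Psi> z) t) (apply_bcontfun (\<Psi> w) t) \<le> 1 / 2 * dist z w"
      unfolding \<Psi> s_def[symmetric] G_def by (simp add: dist_norm scaleR_diff_right[symmetric])
  qed
  obtain z where z: "\<Psi> z = z"
    using banach_fix_type[of "1/2" \<Psi>] contr by auto
  define y where "y t = exp (\<kappa> * t) *\<^sub>R apply_bcontfun z t" for t
  have y: "y t = y0 + integral {0..t} (\<lambda>r. F (y r))" if "t \<in> {0..T}" for t
  proof -
    have "apply_bcontfun z t = G z t" using \<Psi>[of z t] z that by (simp add: cl_id)
    then have "y t = y0 + integral {0..t} (g z)"
      unfolding y_def G_def by (simp add: exp_add[symmetric])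
    then show ?thesis unfolding g_def[abs_def] y_def .
  qed
  show ?thesis
  proof (intro exI conjI ballI)
    show "y 0 = y0" using y[of 0] T by simp
    fix t assume t: "t \<in> {0..T}"
    have "continuous_on {0..T} (\<lambda>r. F (y r))" using gc[of "{0..T}" z] unfolding g_def y_def .
    then have "((\<lambda>s. integral {0..s} (\<lambda>r. F (y r))) has_vector_derivative F (y t)) (at t within {0..T})"
      using t by (rule integral_has_vector_derivative)
    then have "((\<lambda>s. y0 + integral {0..s} (\<lambda>r. F (y r))) has_vector_derivative 0 + F (y t)) (at t within {0..T})"
      by (intro has_vector_derivative_add has_vector_derivative_const)
    then show "(y has_vector_derivative F (y t)) (at t within {0..T})"
      using t y by (subst has_vector_derivative_cong_ev[where g = "\<lambda>s. y0 + integral {0..s} (\<lambda>r. F (y r))"]) auto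
  qed
qed

instance bcontfun :: (metric_space, banach) banach ..

text \<open>On one period the sup norm dominates \<open>norm2\<close> up to a fixed factor, so a
  derivative in the Banach space is an L2 derivative.\<close>

lemma sq_int_bcontfun:
  fixes y :: "(real^'n::finite) \<Rightarrow>\<^sub>C real"
  shows "sq_int (MD L) (apply_bcontfun y)"
    and "norm2 (MD L) (apply_bcontfun y) \<le> norm y * sqrt (measure (MD L :: (real^'n) measure) (space (MD L)))"
proof -
  have m: "apply_bcontfun y \<in> borel_measurable (MD L)"
    by (intro borel_measurable_MD borel_measurable_continuous_onI) simp
  have "\<bar>apply_bcontfun y v\<bar> \<le> norm y" for v using norm_bounded[of y v] by simp
  then show "sq_int (MD L) (apply_bcontfun y)"
    and "norm2 (MD L) (apply_bcontfun y) \<le> norm y * sqrt (measure (MD L :: (real^'n) measure) (space (MD L)))"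
    by (rule MD.sq_int_bounded[OF m])+
qed

lemma L2_deriv_bcontfun:
  fixes y :: "real \<Rightarrow> ((real^'n::finite) \<Rightarrow>\<^sub>C real)"
  assumes y: "(y has_vector_derivative y') (at t within S)"
  shows "L2_deriv L (\<lambda>s. apply_bcontfun (y s)) (apply_bcontfun y') t S"
  unfolding L2_deriv_iff
proof (rule Lim_null_comparison)
  define m where "m = sqrt (measure (MD L :: (real^'n) measure) (space (MD L)))"
  define D where "D s = norm (y s - y t - (s - t) *\<^sub>R y') / norm (s - t)" for s
  have D: "(D \<longlongrightarrow> 0) (at t within S)"
    using y unfolding has_vector_derivative_def has_derivative_iff_norm D_def by simp
  show "((\<lambda>s. D s * m) \<longlongrightarrow> 0) (at t within S)"
    using tendsto_mult[OF D tendsto_const[of m]] by simp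
  show "eventually (\<lambda>s. norm (norm2 (MD L) (\<lambda>v. (apply_bcontfun (y s) v - apply_bcontfun (y t) v) / (s - t) - apply_bcontfun y' v)) \<le> D s * m) (at t within S)"
    unfolding eventually_at_filter
  proof (intro always_eventually allI impI)
    fix s assume s: "s \<noteq> t" "s \<in> S"
    define w where "w = (1 / (s - t)) *\<^sub>R (y s - y t - (s - t) *\<^sub>R y')"
    have "norm w = D s" by (simp add: w_def D_def)
    moreover have "(\<lambda>v. (apply_bcontfun (y s) v - apply_bcontfun (y t) v) / (s - t) - apply_bcontfun y' v) = apply_bcontfun w"
      using s by (simp add: w_def fun_eq_iff minus_bcontfun.rep_eq scaleR_bcontfun.rep_eq diff_divide_distrib)
    ultimately show "norm (norm2 (MD L) (\<lambda>v. (apply_bcontfun (y s) v - apply_bcontfun (y t) v) / (s - t) - apply_bcontfun y' v)) \<le> D s * m"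
      using sq_int_bcontfun(2)[of L w] by (simp add: m_def)
  qed
qed

context collision_kernel
begin

text \<open>The vector field projects its argument before truncating it, so it is defined on all
  bounded continuous functions. The solution y need not be watched for staying in the polynomial
  space: \<open>z = proj y\<close> lies there, and idempotence of the projection shows that z solves
  the equation.\<close>

lemma truncated_spectral_solution:
  fixes g0 :: "real^'n \<Rightarrow> real"
  assumes L: "R \<le> L" and K: "K > 0" and T: "T > 0" and g0: "sq_int (MD L) g0"
  shows "\<exists>z. z 0 = proj L N g0 \<and> (\<forall>t\<in>{0..T}. in_PN L N (z t) \<and>
    L2_deriv L z (proj L N (Q (truncate L K (z t)))) t {0..T})"
proof -
  have L0: "L > 0" using L R by simp
  define m where "m = sqrt (measure (MD L :: (real^'n) measure) (space (MD L)))"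
  obtain c where c: "0 \<le> c" "\<And>g v. sq_int (MD L) g \<Longrightarrow> \<bar>proj L N g v\<bar> \<le> c * norm2 (MD L) (g :: real^'n \<Rightarrow> real)"
    using proj_sup_bound by blast
  have pb: "proj L N g \<in> bcontfun" if g: "sq_int (MD L) g" for g :: "real^'n \<Rightarrow> real"
    unfolding bcontfun_def using trig_poly_continuous[OF proj_trig_poly] c(2)[OF g] by (auto simp: bounded_iff)
  define h where "h y = truncate L K (proj L N y)" for y :: "real^'n \<Rightarrow> real"
  have h: "periodic_L L (h y)" "sq_int (MD L) (h y)" "norm2 (MD L) (h y) \<le> K" for y
    unfolding h_def
    by (intro truncate_periodic trig_poly_periodic[OF L0 proj_trig_poly] truncate_sq_int proj_sq_int norm2_truncate_le[OF K])+
  define W where "W y = Q (h y)" for y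
  have W: "sq_int (MD L) (W y)" for y unfolding W_def by (rule QR_sq_int[OF L h(1,2)])
  define F where "F y = Bcontfun (proj L N (W (apply_bcontfun y)))" for y
  have F: "apply_bcontfun (F y) = proj L N (W (apply_bcontfun y))" for y
    unfolding F_def by (rule Bcontfun_inverse[OF pb[OF W]])
  \<comment> \<open>The factors stem from the sup bound of the projection, the Lipschitz bound of Q
    at truncated norms at most K, the constant 2 of the truncation, and the passage m from the sup
    norm to L2.\<close>
  define B where "B = c * (sqrt (8 * kbound) * (K + K) * (2 * m))"
  have m: "m \<ge> 0" by (simp add: m_def)
  have B: "B \<ge> 0" using c K m kbound_nonneg by (simp add: B_def)
  have lip: "norm (F x - F y) \<le> B * norm (x - y)" for x y
  proof (rule norm_bound)
    fix v
    define \<xi> \<eta> where "\<xi> = apply_bcontfun x" and "\<eta> = apply_bcontfun y"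
    have xy: "sq_int (MD L) \<xi>" "sq_int (MD L) \<eta>" unfolding \<xi>_def \<eta>_def by (rule sq_int_bcontfun)+
    have "norm2 (MD L) (\<lambda>v. h \<xi> v - h \<eta> v) \<le> 2 * norm2 (MD L) (\<lambda>v. proj L N \<xi> v - proj L N \<eta> v)"
      unfolding h_def by (rule truncate_lipschitz[OF K proj_sq_int proj_sq_int])
    also have "norm2 (MD L) (\<lambda>v. proj L N \<xi> v - proj L N \<eta> v) \<le> norm2 (MD L) (\<lambda>v. \<xi> v - \<eta> v)"
      unfolding proj_diff[OF xy, symmetric] by (rule norm2_proj_le[OF L0 sq_int_diff[OF xy]])
    also have "(\<lambda>v. \<xi> v - \<eta> v) = apply_bcontfun (x - y)"
      by (simp add: \<xi>_def \<eta>_def fun_eq_iff minus_bcontfun.rep_eq)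
    also have "norm2 (MD L) (apply_bcontfun (x - y)) \<le> norm (x - y) * m"
      unfolding m_def by (rule sq_int_bcontfun)
    finally have hd: "norm2 (MD L) (\<lambda>v. h \<xi> v - h \<eta> v) \<le> 2 * m * norm (x - y)" by (simp add: mult_ac)
    have "norm (apply_bcontfun (F x - F y) v) = \<bar>proj L N (\<lambda>v. W \<xi> v - W \<eta> v) v\<bar>"
      by (simp add: minus_bcontfun.rep_eq F proj_diff[OF W W] \<xi>_def \<eta>_def)
    also have "\<dots> \<le> c * norm2 (MD L) (\<lambda>v. W \<xi> v - W \<eta> v)"
      by (intro c(2) sq_int_diff W)
    also have "\<dots> \<le> c * (sqrt (8 * kbound) * (norm2 (MD L) (h \<xi>) + norm2 (MD L) (h \<eta>)) * norm2 (MD L) (\<lambda>v. h \<xi> v - h \<eta> v))"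
      unfolding W_def by (intro mult_left_mono QR_diff_bound(2) L h c)
    also have "\<dots> \<le> c * (sqrt (8 * kbound) * (K + K) * (2 * m * norm (x - y)))"
      using K kbound_nonneg by (intro mult_left_mono mult_mono add_mono h hd c mult_nonneg_nonneg) auto
    finally show "norm (apply_bcontfun (F x - F y) v) \<le> B * norm (x - y)"
      by (simp add: B_def mult.assoc)
  qed
  obtain y where y0: "y 0 = Bcontfun (proj L N g0)" and y: "\<And>t. t \<in> {0..T} \<Longrightarrow> (y has_vector_derivative F (y t)) (at t within {0..T})"
    using global_Picard[OF T B lip] by metis
  define z where "z t = proj L N (apply_bcontfun (y t))" for t
  have pp: "proj L N (proj L N g) = proj L N g" for g :: "real^'n \<Rightarrow> real"
    by (rule ext) (rule proj_of_trig_poly[OF L0 proj_trig_poly])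
  show ?thesis
  proof (intro exI conjI ballI)
    show "z 0 = proj L N g0" by (simp add: z_def y0 Bcontfun_inverse[OF pb[OF g0]] pp)
    fix t assume t: "t \<in> {0..T}"
    show "in_PN L N (z t)" unfolding z_def by (rule proj_in_PN)
    have "L2_deriv L z (proj L N (apply_bcontfun (F (y t)))) t {0..T}"
      unfolding z_def[abs_def] by (intro L2_deriv_proj[OF L0 L2_deriv_bcontfun[OF y[OF t]]] sq_int_bcontfun)
    then show "L2_deriv L z (proj L N (Q (truncate L K (z t)))) t {0..T}"
      unfolding F pp W_def h_def z_def .
  qed
qed

text \<open>Carries the error bound from the constructed solution to every solution. No size bound
  is given in advance, but an L2-differentiable curve has continuous norm, hence is bounded on
  [0,T]; Gronwall's inequality then applies with \<open>\<delta> = 0\<close>.\<close>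

lemma spectral_sol_unique:
  fixes f0 :: "real^'n \<Rightarrow> real"
  assumes L: "R \<le> L" and T: "T > 0" and z: "spectral_sol L R \<Phi> b N T f0 z" and w: "spectral_sol L R \<Phi> b N T f0 w"
    and t: "t \<in> {0..T}"
  shows "norm2 (MD L) (\<lambda>v. z t v - w t v) = 0"
proof -
  have L0: "L > 0" using L R by simp
  have reg: "periodic_L L (u t)" "sq_int (MD L) (u t)" "sq_int (MD L) (Q (u t))"
    "L2_deriv L u (proj L N (Q (u t))) t {0..T}"
    if "spectral_sol L R \<Phi> b N T f0 u" "t \<in> {0..T}" for u t
  proof -
    have p: "trig_poly L N (u t)" using that by (auto simp: spectral_sol_def intro: in_PN_imp_trig_poly)
    then show "periodic_L L (u t)" "sq_int (MD L) (u t)" by (auto intro: trig_poly_periodic[OF L0] trig_poly_sq_int)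
    then show "sq_int (MD L) (Q (u t))" by (rule QR_sq_int[OF L])
    show "L2_deriv L u (proj L N (Q (u t))) t {0..T}" using that by (simp add: spectral_sol_def)
  qed
  have bdd: "\<exists>W\<ge>0. \<forall>t\<in>{0..T}. norm2 (MD L) (u t) \<le> W" if u: "spectral_sol L R \<Phi> b N T f0 u" for u
  proof -
    have "continuous_on {0..T} (\<lambda>t. norm2 (MD L) (u t))"
      unfolding continuous_on_def using reg[OF u] by (intro ballI L2_deriv_continuous[OF reg(4)[OF u]]) auto
    then have "bounded ((\<lambda>t. norm2 (MD L) (u t)) ` {0..T})"
      by (intro compact_imp_bounded compact_continuous_image) simp_all
    then obtain W where "\<forall>t\<in>{0..T}. norm2 (MD L) (u t) \<le> W" unfolding bounded_iff by auto
    then show ?thesis using T by (intro exI[of _ W]) (auto intro: order_trans[OF norm2_nonneg, of _ "u 0"])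
  qed
  obtain Z W where Z: "Z \<ge> 0" "\<And>t. t \<in> {0..T} \<Longrightarrow> norm2 (MD L) (z t) \<le> Z"
    and W: "W \<ge> 0" "\<And>t. t \<in> {0..T} \<Longrightarrow> norm2 (MD L) (w t) \<le> W"
    using bdd[OF z] bdd[OF w] by blast
  have "norm2 (MD L) (\<lambda>v. z t v - w t v) \<le> 0 * exp (2 * (sqrt (8 * kbound) * (Z + W)) * T)"
  proof (rule L2_Gronwall[OF T, where u' = "\<lambda>t v. proj L N (Q (z t)) v - proj L N (Q (w t)) v"])
    show "0 \<le> sqrt (8 * kbound) * (Z + W)" using Z W kbound_nonneg by simp
    fix s assume s: "s \<in> {0..T}"
    note rz = reg[OF z s] and rw = reg[OF w s]
    show "L2_deriv L (\<lambda>t v. z t v - w t v) (\<lambda>v. proj L N (Q (z s)) v - proj L N (Q (w s)) v) s {0..T}"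
      using s reg[OF z] reg[OF w] by (intro L2_deriv_diff rz rw) auto
    show "sq_int (MD L) (\<lambda>v. z s v - w s v)" by (intro sq_int_diff rz rw)
    show "sq_int (MD L) (\<lambda>v. proj L N (Q (z s)) v - proj L N (Q (w s)) v)"
      by (intro sq_int_diff proj_sq_int)
    have "norm2 (MD L) (\<lambda>v. proj L N (Q (z s)) v - proj L N (Q (w s)) v)
      \<le> norm2 (MD L) (\<lambda>v. Q (z s) v - Q (w s) v)"
      unfolding proj_diff[OF rz(3) rw(3), symmetric] by (intro norm2_proj_le L0 sq_int_diff rz rw)
    also have "\<dots> \<le> sqrt (8 * kbound) * (norm2 (MD L) (z s) + norm2 (MD L) (w s)) * norm2 (MD L) (\<lambda>v. z s v - w s v)"
      by (intro QR_diff_bound(2) L rz rw)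
    also have "\<dots> \<le> sqrt (8 * kbound) * (Z + W) * norm2 (MD L) (\<lambda>v. z s v - w s v)"
      using kbound_nonneg Z(2)[OF s] W(2)[OF s] by (intro mult_right_mono mult_left_mono add_mono) auto
    finally show "norm2 (MD L) (\<lambda>v. proj L N (Q (z s)) v - proj L N (Q (w s)) v)
      \<le> sqrt (8 * kbound) * (Z + W) * (norm2 (MD L) (\<lambda>v. z s v - w s v) + 0)" by simp
  next
    show "norm2 (MD L) (\<lambda>v. z 0 v - w 0 v) = 0" using z w by (simp add: spectral_sol_def)
  qed (use t in auto)
  then show ?thesis using norm2_nonneg[of "MD L" "\<lambda>v. z t v - w t v"] by simp
qed

text \<open>K leaves room 1 above the bound on f. In A the factor 4 is 2 from the sum of two norms
  at most K and 2 from the truncation. C is the projection rate without its power of N, times the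
  Gronwall factor; the maximum keeps it non-negative whatever real number \<open>Ck\<close>
  is.\<close>

lemma spectral_error_bound:
  fixes f0 :: "real^'n \<Rightarrow> real" and f :: "real \<Rightarrow> real^'n \<Rightarrow> real"
    and L T Ck :: real and k N :: nat
  defines "K \<equiv> max Ck 0 + 1"
  defines "A \<equiv> 4 * (sqrt (8 * kbound) * K)"
  defines "C \<equiv> (2 * L / pi) ^ k * max Ck 0 * exp (2 * A * T)"
  assumes L: "R \<le> L" and T: "T > 0" and k: "k \<ge> 1" and N: "real N \<ge> C" "N \<ge> 1"
    and f: "boltz_sol L R \<Phi> b T f0 f" and Hk: "\<And>t. t \<ge> 0 \<Longrightarrow> Hk_le L k (f t) Ck"
  shows "\<exists>z. spectral_sol L R \<Phi> b N T f0 z \<and> (\<forall>t\<in>{0..T}. norm2 (MD L) (\<lambda>v. proj L N (f t) v - z t v) \<le> C / real N ^ k)"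
proof -
  have L0: "L > 0" using L R by simp
  have K: "K > 0" by (simp add: K_def)
  have A: "A \<ge> 0" using K kbound_nonneg by (simp add: A_def)
  have fr: "periodic_L L (f t)" "sq_int (MD L) (f t)" "sq_int (MD L) (Q (f t))" "L2_deriv L f (Q (f t)) t {0..T}"
    "Hk_le L k (f t) (max Ck 0)" if "t \<in> {0..T}" for t
  proof -
    have t: "t \<ge> 0" using that by simp
    then show "periodic_L L (f t)" "sq_int (MD L) (f t)" "sq_int (MD L) (Q (f t))"
      using f by (auto simp: boltz_sol_def in_L2_iff)
    show "L2_deriv L f (Q (f t)) t {0..T}"
      by (rule L2_deriv_subset[of _ _ _ _ "{0..}"]) (use f t in \<open>auto simp: boltz_sol_def\<close>)
    show "Hk_le L k (f t) (max Ck 0)" using Hk[OF t] unfolding Hk_le_def by (auto intro: order_trans)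
  qed
  have f0: "f 0 = f0" using f by (simp add: boltz_sol_def)
  have fK: "norm2 (MD L) (f t) \<le> max Ck 0" if "t \<in> {0..T}" for t
    by (rule Hk_le_imp_norm2_le[OF L0 fr(2)[OF that] fr(5)[OF that] k])
  then have pfK: "norm2 (MD L) (proj L N (f t)) \<le> max Ck 0" if "t \<in> {0..T}" for t
    using norm2_proj_le[OF L0 fr(2)[OF that], of N] that by force
  define \<delta> where "\<delta> = (2 * L / (pi * real N)) ^ k * max Ck 0"
  have \<delta>: "\<delta> \<ge> 0" using L0 by (simp add: \<delta>_def)
  have perr: "norm2 (MD L) (\<lambda>v. f t v - proj L N (f t) v) \<le> \<delta>" if "t \<in> {0..T}" for t
    unfolding \<delta>_def by (rule Hk_le_proj_error[OF L0 fr(2)[OF that] fr(5)[OF that] k N(2)])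
  have \<delta>C: "\<delta> * exp (2 * A * T) = C / real N ^ k"
    by (simp add: \<delta>_def C_def power_divide power_mult_distrib)
  \<comment> \<open>As k \<ge> 1, N is at most its k-th power, so \<open>N \<ge> C\<close> is
    enough.\<close>
  have CN: "C / real N ^ k \<le> 1"
  proof -
    have "real N \<le> real N ^ k" using N(2) k by (intro self_le_power) auto
    then have "C \<le> real N ^ k" using N(1) by (rule order_trans[rotated])
    then show ?thesis using N(2) by (simp add: divide_le_eq)
  qed
  obtain z where z0: "z 0 = proj L N f0" and zP: "\<And>t. t \<in> {0..T} \<Longrightarrow> in_PN L N (z t)"
    and zd: "\<And>t. t \<in> {0..T} \<Longrightarrow> L2_deriv L z (proj L N (Q (truncate L K (z t)))) t {0..T}"
    using truncated_spectral_solution[OF L K T, of f0 N] fr(2)[of 0] T f0 by auto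
  have zr: "periodic_L L (z t)" "sq_int (MD L) (z t)" if "t \<in> {0..T}" for t
    using in_PN_imp_trig_poly[OF zP[OF that]] by (auto intro: trig_poly_periodic[OF L0] trig_poly_sq_int)
  define \<psi> where "\<psi> t = truncate L K (z t)" for t
  have \<psi>: "periodic_L L (\<psi> t)" "sq_int (MD L) (\<psi> t)" "norm2 (MD L) (\<psi> t) \<le> K" if "t \<in> {0..T}" for t
    unfolding \<psi>_def by (intro truncate_periodic truncate_sq_int zr[OF that] norm2_truncate_le[OF K])+
  have \<psi>Q: "sq_int (MD L) (Q (\<psi> t))" if "t \<in> {0..T}" for t
    by (rule QR_sq_int[OF L \<psi>(1,2)[OF that]])
  have err: "norm2 (MD L) (\<lambda>v. proj L N (f t) v - z t v) \<le> C / real N ^ k" if t: "t \<in> {0..T}" for t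
    unfolding \<delta>C[symmetric]
  proof (rule L2_Gronwall[OF T A \<delta>, where u' = "\<lambda>t v. proj L N (Q (f t)) v - proj L N (Q (\<psi> t)) v"])
    fix s assume s: "s \<in> {0..T}"
    show "L2_deriv L (\<lambda>t v. proj L N (f t) v - z t v) (\<lambda>v. proj L N (Q (f s)) v - proj L N (Q (\<psi> s)) v) s {0..T}"
      using s zd[OF s] unfolding \<psi>_def[symmetric]
      by (intro L2_deriv_diff L2_deriv_proj L0 fr proj_sq_int) (auto intro: zr fr)
    show "sq_int (MD L) (\<lambda>v. proj L N (f s) v - z s v)" by (intro sq_int_diff proj_sq_int zr s)
    show "sq_int (MD L) (\<lambda>v. proj L N (Q (f s)) v - proj L N (Q (\<psi> s)) v)"
      by (intro sq_int_diff proj_sq_int)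
    \<comment> \<open>The truncation fixes \<open>P_N f\<close>, so it can be inserted there for
      free and its Lipschitz bound compares with z.\<close>
    have "truncate L K (proj L N (f s)) = proj L N (f s)"
      using pfK[OF s] K by (intro truncate_eq) (auto simp: K_def)
    then have tr: "norm2 (MD L) (\<lambda>v. proj L N (f s) v - \<psi> s v) \<le> 2 * norm2 (MD L) (\<lambda>v. proj L N (f s) v - z s v)"
      using truncate_lipschitz[OF K proj_sq_int[of L N "f s"] zr(2)[OF s]] by (simp add: \<psi>_def)
    have "norm2 (MD L) (\<lambda>v. f s v - \<psi> s v) \<le> norm2 (MD L) (\<lambda>v. f s v - proj L N (f s) v) + norm2 (MD L) (\<lambda>v. proj L N (f s) v - \<psi> s v)"
      by (intro norm2_triangle3 fr \<psi> proj_sq_int s)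
    \<comment> \<open>The projection error enters once, but is doubled to match the form required by
      Gronwall's inequality.\<close>
    also have "\<dots> \<le> 2 * (norm2 (MD L) (\<lambda>v. proj L N (f s) v - z s v) + \<delta>)"
      using tr perr[OF s] \<delta> by simp
    finally have f\<psi>: "norm2 (MD L) (\<lambda>v. f s v - \<psi> s v) \<le> 2 * (norm2 (MD L) (\<lambda>v. proj L N (f s) v - z s v) + \<delta>)" .
    have fK': "norm2 (MD L) (f s) \<le> K" using fK[OF s] by (simp add: K_def)
    have "norm2 (MD L) (\<lambda>v. proj L N (Q (f s)) v - proj L N (Q (\<psi> s)) v)
      \<le> norm2 (MD L) (\<lambda>v. Q (f s) v - Q (\<psi> s) v)"
      unfolding proj_diff[OF fr(3)[OF s] \<psi>Q[OF s], symmetric] by (intro norm2_proj_le L0 sq_int_diff fr \<psi>Q s)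
    also have "\<dots> \<le> sqrt (8 * kbound) * (norm2 (MD L) (f s) + norm2 (MD L) (\<psi> s)) * norm2 (MD L) (\<lambda>v. f s v - \<psi> s v)"
      by (intro QR_diff_bound(2) L fr \<psi> s)
    also have "\<dots> \<le> sqrt (8 * kbound) * (K + K) * (2 * (norm2 (MD L) (\<lambda>v. proj L N (f s) v - z s v) + \<delta>))"
      using K kbound_nonneg by (intro mult_mono mult_left_mono add_mono f\<psi> fK' \<psi> s) auto
    finally show "norm2 (MD L) (\<lambda>v. proj L N (Q (f s)) v - proj L N (Q (\<psi> s)) v)
      \<le> A * (norm2 (MD L) (\<lambda>v. proj L N (f s) v - z s v) + \<delta>)" by (simp add: A_def algebra_simps)
  next
    show "norm2 (MD L) (\<lambda>v. proj L N (f 0) v - z 0 v) = 0" by (simp add: z0 f0)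
  qed (rule t)
  \<comment> \<open>Closing the loop: the projected solution is bounded by K - 1 and the error by 1,
    so z stays inside the ball on which the truncation is the identity.\<close>
  have "norm2 (MD L) (z t) \<le> K" if t: "t \<in> {0..T}" for t
  proof -
    have "norm2 (MD L) (\<lambda>v. proj L N (f t) v - (proj L N (f t) v - z t v)) \<le> norm2 (MD L) (proj L N (f t)) + norm2 (MD L) (\<lambda>v. proj L N (f t) v - z t v)"
      by (intro norm2_triangle_diff sq_int_diff proj_sq_int zr t)
    then show ?thesis using pfK[OF t] err[OF t] CN by (simp add: K_def)
  qed
  then have "truncate L K (z t) = z t" if "t \<in> {0..T}" for t using that K by (intro truncate_eq) auto
  then have "spectral_sol L R \<Phi> b N T f0 z"
    unfolding spectral_sol_def using z0 zP zd by auto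
  then show ?thesis using err by blast
qed

end

theorem theorem5p1:
  fixes L R T Ck :: real and k :: nat
    and \<Phi> b :: "real \<Rightarrow> real"
    and f0 :: "real^'n::finite \<Rightarrow> real"
  assumes dim: "CARD('n) \<ge> 2"
    and LR: "0 < R" "R \<le> L"
    and Phi_nonneg: "\<forall>r\<ge>0. \<Phi> r \<ge> 0"
    and Phi_meas: "\<Phi> \<in> borel_measurable borel"
    and Phi_bdd: "bdd_above (\<Phi> ` {0..R})"
    and b_nonneg: "\<forall>s. b s \<ge> 0"
    and b_neg: "\<forall>s<0. b s = 0"
    and b_meas: "b \<in> borel_measurable borel"
    and b_int: "\<forall>e::real^'n. norm e = 1 \<longrightarrow> sphere_integrable (\<lambda>\<sigma>. b (\<sigma> \<bullet> e))"
    and k: "k \<ge> 1"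
    and T: "T > 0"
    and f0_per: "periodic_L L f0"
    and f0_nonneg: "\<forall>v. f0 v \<ge> 0"
    and f0_L1: "set_integrable lborel (dom_L L) f0"
    and f0_nonzero: "(LINT v:dom_L L|lborel. f0 v) > 0"
    and f0_Hk: "in_Hk L k f0"
    and f0_neg: "(\<lambda>N. L2norm L (\<lambda>v. max (- proj L N f0 v) 0)) \<longlonglongrightarrow> 0"
  shows "\<exists>N0::nat. \<exists>C::real. \<forall>f.
           boltz_sol L R \<Phi> b T f0 f \<and> (\<forall>t\<ge>0. Hk_le L k (f t) Ck) \<longrightarrow>
           (\<forall>N>N0. (\<exists>fN. spectral_sol L R \<Phi> b N T f0 fN) \<and>
              (\<forall>fN. spectral_sol L R \<Phi> b N T f0 fN \<longrightarrow>
                 (\<forall>t\<in>{0..T}. L2norm L (\<lambda>v. proj L N (f t) v - fN t v) \<le> C / real N ^ k)))"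
proof -
  obtain P where P: "\<forall>r\<in>{0..R}. \<Phi> r \<le> P" using Phi_bdd by (auto simp: bdd_above_def)
  \<comment> \<open>An arbitrary unit vector; the axis index is irrelevant.\<close>
  define e0 :: "real^'n" where "e0 = axis undefined 1"
  have e0: "norm e0 = 1" by (simp add: e0_def)
  interpret collision_kernel R P \<Phi> b e0
  proof
    have "integrable lborel (\<lambda>x. indicator (ball (0::real^'n) 1) x *\<^sub>R b (hat x \<bullet> e0))"
      using b_int e0 unfolding sphere_integrable_def set_integrable_def by auto
    then have "(\<integral>\<^sup>+x. ennreal (norm (indicator (ball (0::real^'n) 1) x *\<^sub>R b (hat x \<bullet> e0))) \<partial>lborel) < \<infinity>"
      by (simp only: integrable_iff_bounded)
    also have "(\<lambda>x. ennreal (norm (indicator (ball (0::real^'n) 1) x *\<^sub>R b (hat x \<bullet> e0))))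
      = (\<lambda>x. indicator (ball 0 1) x * ennreal (b (hat x \<bullet> e0)))"
      using b_nonneg by (auto simp: indicator_def fun_eq_iff)
    finally show "sphere_mass b e0 < \<infinity>" unfolding sphere_mass_def .
  qed (use LR Phi_nonneg Phi_meas b_nonneg b_meas e0 P in auto)
  \<comment> \<open>The constants are fixed before f is, so that they serve for every solution with
    the given Sobolev bound.\<close>
  define K where "K = max Ck 0 + 1"
  define A where "A = 4 * (sqrt (8 * kbound) * K)"
  define C where "C = (2 * L / pi) ^ k * max Ck 0 * exp (2 * A * T)"
  show ?thesis
  proof (intro exI allI impI)
    \<comment> \<open>The witnesses are \<open>nat \<lceil>C\<rceil>\<close> for N0 and C itself; a
      larger N satisfies both \<open>C \<le> N\<close> and \<open>1 \<le> N\<close>.\<close>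
    fix f N assume f: "boltz_sol L R \<Phi> b T f0 f \<and> (\<forall>t\<ge>0. Hk_le L k (f t) Ck)" and N: "nat \<lceil>C\<rceil> < N"
    have "C \<le> real N" "1 \<le> N" using N by linarith+
    then obtain z where z: "spectral_sol L R \<Phi> b N T f0 z"
      and err: "\<And>t. t \<in> {0..T} \<Longrightarrow> norm2 (MD L) (\<lambda>v. proj L N (f t) v - z t v) \<le> C / real N ^ k"
      using spectral_error_bound[OF LR(2) T k, of Ck N f0 f] f unfolding C_def A_def K_def by blast
    \<comment> \<open>The constructed solution z obeys the bound, and any other solution is at
      distance 0 from it.\<close>
    have "L2norm L (\<lambda>v. proj L N (f t) v - fN t v) \<le> C / real N ^ k"
      if w: "spectral_sol L R \<Phi> b N T f0 fN" and t: "t \<in> {0..T}" for fN t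
    proof -
      have sq: "sq_int (MD L) (u t)" if "spectral_sol L R \<Phi> b N T f0 u" for u
      proof -
        have "in_PN L N (u t)" using that t unfolding spectral_sol_def by blast
        then show ?thesis by (rule trig_poly_sq_int[OF in_PN_imp_trig_poly])
      qed
      have "norm2 (MD L) (\<lambda>v. proj L N (f t) v - fN t v) \<le> norm2 (MD L) (\<lambda>v. proj L N (f t) v - z t v) + norm2 (MD L) (\<lambda>v. z t v - fN t v)"
        by (intro norm2_triangle3 proj_sq_int sq z w)
      then show ?thesis
        using err[OF t] spectral_sol_unique[OF LR(2) T z w t] by (simp add: L2norm_eq)
    qed
    then show "(\<exists>fN. spectral_sol L R \<Phi> b N T f0 fN) \<and>
              (\<forall>fN. spectral_sol L R \<Phi> b N T f0 fN \<longrightarrow>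
                 (\<forall>t\<in>{0..T}. L2norm L (\<lambda>v. proj L N (f t) v - fN t v) \<le> C / real N ^ k))"
      using z by blast
  qed
qed

end
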